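(* (1) Assume that $\Sigma=\{|x|\le1\}$ is the ball in $\mathbb{R}^d$ with $d\ge4$, and that $\mu$ is an arbitrary Borel probability measure on $\mathbb{R}$. Then for every $p>2d/(d-3)$, $$\limsup_{H,R\to+\infty}\left\{\int_{\mathbb{T}^d}\left(\int_{\mathbb{R}}\left|r^{-(d-1)/2}\mathcal{D}(r\Sigma-x)\right|^2d\mu_{H,R}(r)\right)^{p/2}dx\right\}^{1/p}=+\infty.$$ (2) If in addition the Fourier transform of $\mu$ vanishes at infinity, $\lim_{|\zeta|\to+\infty}|\widehat{\mu}(\zeta)|=0$, the supremum limit can be replaced by a limit, $$\lim_{H,R\to+\infty}\left\{\int_{\mathbb{T}^d}\left(\int_{\mathbb{R}}\left|r^{-(d-1)/2}\mathcal{D}(r\Sigma-x)\right|^2d\mu_{H,R}(r)\right)^{p/2}dx\right\}^{1/p}=+\infty.$$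
   Context: $\mathbb{T}^d=\mathbb{R}^d/\mathbb{Z}^d$ is the torus. For a bounded domain $\Omega\subset\mathbb{R}^d$, dilated by a factor $r$ and translated by a vector $x$, the discrepancy between the number of integer points and the volume is $$\mathcal{D}(r\Omega-x)=\sum_{k\in\mathbb{Z}^d}\chi_{r\Omega-x}(k)-r^d|\Omega|,$$ where $\chi_E$ is the characteristic function of $E$ and $|\Omega|$ is the measure of $\Omega$. The Fourier transform of $\mu$ is $\widehat{\mu}(\zeta)=\int_{\mathbb{R}}e^{-2\pi i\zeta r}d\mu(r)$. For $0<H<+\infty$ and $-\infty<R<+\infty$, the dilated and translated measure $\mu_{H,R}$ is defined by $\int_{\mathbb{R}}f(r)\,d\mu_{H,R}(r)=\int_{\mathbb{R}}f(R+Hr)\,d\mu(r)$. *)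

theory Defs
  imports "HOL-Probability.Probability"
begin

definition integer_lattice :: "(real ^ 'n) set" where
  "integer_lattice = {k. \<forall>i. k $ i \<in> \<int>}"

text \<open>Functions on the torus are treated as periodic functions on the whole space; integration
  over the torus is integration over the half-open unit cube.\<close>

definition unit_cube :: "(real ^ 'n) set" where
  "unit_cube = {x. \<forall>i. 0 \<le> x $ i \<and> x $ i < 1}"

definition dilate_translate :: "real \<Rightarrow> (real ^ 'n) set \<Rightarrow> real ^ 'n \<Rightarrow> (real ^ 'n) set" where
  "dilate_translate r \<Omega> x = (\<lambda>y. r *\<^sub>R y - x) ` \<Omega>"

text \<open>The measures below may charge the negative half-line, so the volume of the dilated domain
  is written with \<open>\<bar>r\<bar>\<close>; this is \<open>r ^ d\<close> when \<open>r \<ge> 0\<close>. The family of characteristic functions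
  has finite support in \<open>k\<close> when the domain is bounded, and then the sum is an ordinary one.\<close>

definition discrepancy :: "(real ^ 'n) set \<Rightarrow> real \<Rightarrow> real ^ 'n \<Rightarrow> real" where
  "discrepancy \<Omega> r x =
     (\<Sum>\<^sub>\<infinity>k\<in>integer_lattice. indicat_real (dilate_translate r \<Omega> x) k)
       - \<bar>r\<bar> ^ CARD('n) * measure lebesgue \<Omega>"

definition fourier_transform :: "real measure \<Rightarrow> real \<Rightarrow> complex" where
  "fourier_transform \<mu> \<zeta> =
     (\<integral>r. exp (- 2 * complex_of_real pi * \<i> * complex_of_real \<zeta> * complex_of_real r) \<partial>\<mu>)"

definition dilated_translated_measure :: "real measure \<Rightarrow> real \<Rightarrow> real \<Rightarrow> real measure" where
  "dilated_translated_measure \<mu> H R = distr \<mu> borel (\<lambda>r. R + H * r)"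

text \<open>Powers with real exponent \<open>a > 0\<close> in \<open>[0, \<infinity>]\<close>.\<close>

definition ennpowr :: "ennreal \<Rightarrow> real \<Rightarrow> ennreal" where
  "ennpowr t a = (if t = \<infinity> then \<infinity> else ennreal (enn2real t powr a))"

text \<open>The integrals are taken in \<open>[0, \<infinity>]\<close> since they may diverge. For negative \<open>r\<close> the modulus of
  \<open>r\<close> to the power \<open>-(d-1)/2\<close> is the power of \<open>\<bar>r\<bar>\<close>. At \<open>r = 0\<close> the library's \<open>powr\<close> gives
  the value 0; this is immaterial, because there the discrepancy already vanishes for every \<open>x\<close>
  outside the integer lattice, which is a null set.\<close>

definition mixed_norm :: "real \<Rightarrow> (real ^ 'n) set \<Rightarrow> real measure \<Rightarrow> ennreal" where
  "mixed_norm p \<Omega> \<nu> =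
     ennpowr
       (\<integral>\<^sup>+x\<in>unit_cube.
          ennpowr
            (\<integral>\<^sup>+r. ennreal
                 (\<bar>\<bar>r\<bar> powr (- (real CARD('n) - 1) / 2) * discrepancy \<Omega> r x\<bar> ^ 2) \<partial>\<nu>)
            (p / 2) \<partial>lborel)
       (1 / p)"

end

theory Submission
  imports Defs
begin

text \<open>Near the lattice points the discrepancy of a ball is large in mean square. Let \<open>g\<close> be the
  product Fejer kernel of the box \<open>{0..<N} ^ d\<close>; it is nonnegative, has integral one over the torus
  and is bounded by \<open>N ^ d\<close>. Integrating the discrepancy against \<open>g\<close> and multiplying by
  \<open>r powr (- (d - 1) / 2)\<close> leaves a finite sum of Fourier coefficients of balls. The rescaled Fourier
  transform of a ball solves a perturbation of \<open>u'' + u = 0\<close> that is integrable at infinity, so it is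
  asymptotic to a nonzero wave, and the sum approaches a trigonometric polynomial \<open>P\<close> as \<open>r \<rightarrow> \<infinity>\<close>.
  The frequencies of \<open>P\<close> are the numbers \<open>2 * pi * norm (m - m')\<close> for points \<open>m \<noteq> m'\<close> of the box. There are
  about \<open>N ^ (2 * d)\<close> pairs of points but only \<open>O(N\<^sup>2)\<close> distinct distances, so by Cauchy-Schwarz the mean
  of \<open>P\<^sup>2\<close> is at least of order \<open>N ^ (d - 3)\<close>. Since \<open>g \<le> N ^ d\<close>, Jensen's inequality bounds the mixed
  norm below by a multiple of \<open>N powr ((d - 3) / 2 - d / p)\<close>, whose exponent is positive exactly when
  \<open>p > 2 * d / (d - 3)\<close>.

  For arbitrary \<open>\<mu>\<close> and fixed \<open>H\<close>, the integral of \<open>P (R + H * r)\<^sup>2\<close> in \<open>r\<close> is a trigonometric polynomial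
  in \<open>R\<close> with the mean of \<open>P\<^sup>2\<close> as its constant term, so it cannot stay below a smaller value
  for all large \<open>R\<close>. If the Fourier transform of \<open>\<mu>\<close> vanishes at infinity, the same holds for the
  restriction of \<open>\<mu>\<close> to any Borel set, and all oscillating terms disappear in the limit. As \<open>P\<close>
  describes the discrepancy in terms of \<open>\<bar>r\<bar>\<close>, one restricts to a set of positive measure on which
  \<open>R + H * r\<close> has constant sign.\<close>

section \<open>Fourier transform of the ball\<close>

text \<open>Variation of constants: \<open>Z\<close> is the solution vector in the rotating frame,
  so its derivative contains only the term with \<open>q\<close>. As
  \<open>\<kappa> / s\<^sup>2\<close> is integrable at infinity, \<open>Z\<close> converges to some
  \<open>\<gamma>\<close>. A Gronwall estimate in both directions bounds the energy \<open>E\<close>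
  above and away from zero; the lower bound gives \<open>\<gamma> \<noteq> 0\<close>.\<close>

lemma perturbed_oscillator_asymptotics:
  fixes u u' q :: "real \<Rightarrow> real"
  assumes u: "\<And>s. s > 0 \<Longrightarrow> (u has_real_derivative u' s) (at s)"
    and u': "\<And>s. s > 0 \<Longrightarrow> (u' has_real_derivative (q s - 1) * u s) (at s)"
    and q: "\<And>s. s > 0 \<Longrightarrow> \<bar>q s\<bar> \<le> \<kappa> / s\<^sup>2"
    and nontrivial: "u 1 \<noteq> 0"
  obtains \<gamma> where "\<gamma> \<noteq> 0" "((\<lambda>s. u s - Re (\<gamma> * cis s)) \<longlongrightarrow> 0) at_top"
proof -
  define E where "E s = (u s)\<^sup>2 + (u' s)\<^sup>2" for s
  define Z where "Z s = cis (- s) * Complex (u s) (- u' s)" for s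
  have E_deriv: "(E has_real_derivative 2 * q s * u s * u' s) (at s)" if "s > 0" for s
    unfolding E_def using that
    by (auto intro!: derivative_eq_intros u u' simp: algebra_simps)
  have E_bound: "\<bar>2 * q s * u s * u' s\<bar> \<le> \<kappa> / s\<^sup>2 * E s" if "s > 0" for s
  proof -
    have "\<bar>2 * q s * u s * u' s\<bar> = \<bar>q s\<bar> * (2 * \<bar>u s\<bar> * \<bar>u' s\<bar>)"
      by (simp add: abs_mult)
    also have "\<dots> \<le> \<bar>q s\<bar> * E s"
      using sum_squares_bound[of "\<bar>u s\<bar>" "\<bar>u' s\<bar>"] unfolding E_def
      by (intro mult_left_mono) auto
    also have "\<dots> \<le> \<kappa> / s\<^sup>2 * E s"
      using q[OF that] by (intro mult_right_mono) (auto simp: E_def)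
    finally show ?thesis .
  qed
  have \<kappa>: "\<kappa> \<ge> 0" using q[of 1] by simp
  have upper: "E s \<le> E 1 * exp \<kappa>" if "s \<ge> 1" for s
  proof -
    \<comment> \<open>Gronwall's inequality in monotone form: the logarithmic derivative of
      \<open>exp (\<kappa> / s)\<close> is \<open>- \<kappa> / s\<^sup>2\<close>, which offsets the
      largest growth rate of \<open>E\<close> allowed by \<open>E_bound\<close>. The opposite sign
      serves for the lower bound.\<close>
    have "E s * exp (\<kappa> / s) \<le> E 1 * exp (\<kappa> / 1)"
    proof (rule DERIV_nonpos_imp_nonincreasing[OF that])
      fix x assume x: "1 \<le> x" "x \<le> s"
      have "((\<lambda>s. E s * exp (\<kappa> / s)) has_real_derivative
          (2 * q x * u x * u' x - \<kappa> / x\<^sup>2 * E x) * exp (\<kappa> / x)) (at x)"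
        using x by (auto intro!: derivative_eq_intros E_deriv simp: field_simps power2_eq_square)
      moreover have "(2 * q x * u x * u' x - \<kappa> / x\<^sup>2 * E x) * exp (\<kappa> / x) \<le> 0"
        using E_bound[of x] x by (intro mult_nonpos_nonneg) (auto simp: abs_le_iff)
      ultimately show "\<exists>y. ((\<lambda>s. E s * exp (\<kappa> / s)) has_real_derivative y) (at x) \<and> y \<le> 0"
        by blast
    qed
    moreover have "E s \<le> E s * exp (\<kappa> / s)"
      using that \<kappa> mult_left_mono[of 1 "exp (\<kappa> / s)" "E s"] by (simp add: E_def)
    ultimately show ?thesis by simp
  qed
  have lower: "E s \<ge> E 1 * exp (- \<kappa>)" if "s \<ge> 1" for s
  proof -
    have "E 1 * exp (- \<kappa> / 1) \<le> E s * exp (- \<kappa> / s)"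
    proof (rule DERIV_nonneg_imp_nondecreasing[OF that])
      fix x assume x: "1 \<le> x" "x \<le> s"
      have "((\<lambda>s. E s * exp (- \<kappa> / s)) has_real_derivative
          (2 * q x * u x * u' x + \<kappa> / x\<^sup>2 * E x) * exp (- \<kappa> / x)) (at x)"
        using x by (auto intro!: derivative_eq_intros E_deriv simp: field_simps power2_eq_square)
      moreover have "(2 * q x * u x * u' x + \<kappa> / x\<^sup>2 * E x) * exp (- \<kappa> / x) \<ge> 0"
        using E_bound[of x] x by (intro mult_nonneg_nonneg) (auto simp: abs_le_iff)
      ultimately show "\<exists>y. ((\<lambda>s. E s * exp (- \<kappa> / s)) has_real_derivative y) (at x) \<and> y \<ge> 0"
        by blast
    qed
    moreover have "E s * exp (- \<kappa> / s) \<le> E s"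
      using that \<kappa> by (auto simp: E_def intro!: mult_left_le)
    ultimately show ?thesis by simp
  qed
  have Z_norm: "norm (Z s) = sqrt (E s)" for s
    by (simp add: Z_def norm_mult E_def complex_norm)
  have Z_deriv: "(Z has_vector_derivative (- \<i> * cis (- s) * of_real (q s * u s))) (at s)"
    if "s > 0" for s
  proof -
    have cis_deriv: "((\<lambda>s. cis (- s)) has_vector_derivative (- \<i> * cis (- s))) (at s)"
      by (rule has_vector_derivative_eq_rhs)
         (auto simp: has_vector_derivative_complex_iff intro!: derivative_eq_intros)
    have "((\<lambda>s. cis (- s) * (of_real (u s) - \<i> * of_real (u' s))) has_vector_derivative
        cis (- s) * (of_real (u' s) - \<i> * of_real ((q s - 1) * u s)) +
        (- \<i> * cis (- s)) * (of_real (u s) - \<i> * of_real (u' s))) (at s)"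
      by (intro has_vector_derivative_mult has_vector_derivative_diff cis_deriv
            has_vector_derivative_mult_right has_vector_derivative_of_real u[OF that] u'[OF that])
    also have "cis (- s) * (of_real (u' s) - \<i> * of_real ((q s - 1) * u s)) +
        (- \<i> * cis (- s)) * (of_real (u s) - \<i> * of_real (u' s)) =
        - \<i> * cis (- s) * of_real (q s * u s)"
      by (simp add: complex_eq_iff algebra_simps)
    moreover have "cis (- s) * (of_real (u s) - \<i> * of_real (u' s)) = Z s" for s
      by (simp add: Z_def complex_eq_iff)
    ultimately show ?thesis by simp
  qed
  \<comment> \<open>The derivative of \<open>Z\<close> has norm
    \<open>\<bar>q x\<bar> * \<bar>u x\<bar>\<close>, and \<open>upper\<close> bounds
    \<open>\<bar>u x\<bar>\<close> by the square root, so the norm is at most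
    \<open>C / x\<^sup>2\<close>, the derivative of \<open>- C / x\<close>.\<close>
  define C where "C = \<kappa> * sqrt (E 1 * exp \<kappa>)"
  have C: "C \<ge> 0" using \<kappa> by (simp add: C_def E_def)
  have Z_diff: "norm (Z t - Z s) \<le> C / s - C / t" if "1 \<le> s" "s < t" for s t
  proof -
    have "norm (Z t - Z s) \<le> (- C / t) - (- C / s)"
    proof (rule differentiable_bound_general[OF \<open>s < t\<close>])
      show "continuous_on {s..t} Z"
        using Z_deriv that
        by (meson atLeastAtMost_iff continuous_at_imp_continuous_on has_vector_derivative_continuous
            less_le_trans zero_less_one)
      show "continuous_on {s..t} (\<lambda>x. - C / x)" using that by (auto intro!: continuous_intros)
      show "(Z has_vector_derivative (- \<i> * cis (- x) * of_real (q x * u x))) (at x)"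
        if "s < x" "x < t" for x using Z_deriv that \<open>1 \<le> s\<close> by simp
      show "((\<lambda>x. - C / x) has_vector_derivative C / x\<^sup>2) (at x)" if "s < x" "x < t" for x
        using that \<open>1 \<le> s\<close> unfolding has_real_derivative_iff_has_vector_derivative[symmetric]
        by (auto intro!: derivative_eq_intros simp: power2_eq_square)
      show "norm (- \<i> * cis (- x) * of_real (q x * u x)) \<le> C / x\<^sup>2" if x: "s < x" "x < t" for x
      proof -
        have "norm (- \<i> * cis (- x) * of_real (q x * u x)) = \<bar>q x\<bar> * \<bar>u x\<bar>"
          by (simp add: norm_mult)
        also have "\<dots> \<le> \<kappa> / x\<^sup>2 * sqrt (E 1 * exp \<kappa>)"
        proof (intro mult_mono q)
          have "(u x)\<^sup>2 \<le> E x" by (simp add: E_def)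
          also have "\<dots> \<le> E 1 * exp \<kappa>" using upper x \<open>1 \<le> s\<close> by simp
          finally show "\<bar>u x\<bar> \<le> sqrt (E 1 * exp \<kappa>)" by (intro real_le_rsqrt) simp
        qed (use x \<open>1 \<le> s\<close> \<kappa> in auto)
        finally show ?thesis by (simp add: C_def)
      qed
    qed
    then show ?thesis by simp
  qed
  \<comment> \<open>The limit is first found along the positive integers; \<open>bound\<close> then
    compares every real \<open>s \<ge> 1\<close> with it, at rate \<open>C / s\<close>.\<close>
  have "Cauchy (\<lambda>n. Z (real (Suc n)))"
  proof (rule CauchyI')
    fix e :: real assume "e > 0"
    obtain M where M: "C / e < real M" using reals_Archimedean2 by blast
    have "norm (Z (real (Suc m)) - Z (real (Suc n))) < e" if "m \<ge> M" "n > m" for m n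
    proof -
      have "norm (Z (real (Suc n)) - Z (real (Suc m))) \<le> C / real (Suc m) - C / real (Suc n)"
        using that by (intro Z_diff) auto
      also have "\<dots> \<le> C / real (Suc m)" using C by simp
      also have "\<dots> < e"
      proof -
        have "C < e * real M" using M \<open>e > 0\<close> by (simp add: field_simps)
        also have "\<dots> \<le> e * real (Suc m)" using that \<open>e > 0\<close> by (intro mult_left_mono) auto
        finally show ?thesis by (simp add: field_simps)
      qed
      finally show ?thesis by (simp add: norm_minus_commute)
    qed
    then show "\<exists>M. \<forall>m\<ge>M. \<forall>n>m. dist (Z (real (Suc m))) (Z (real (Suc n))) < e"
      by (auto simp: dist_norm)
  qed
  then obtain \<gamma> where \<gamma>: "(\<lambda>n. Z (real (Suc n))) \<longlonglongrightarrow> \<gamma>"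
    using Cauchy_convergent_iff convergent_def by blast
  have bound: "norm (\<gamma> - Z s) \<le> C / s" if "s \<ge> 1" for s
  proof (rule tendsto_upperbound)
    show "(\<lambda>n. norm (Z (real (Suc n)) - Z s)) \<longlonglongrightarrow> norm (\<gamma> - Z s)"
      by (intro tendsto_intros \<gamma>)
    have "\<forall>\<^sub>F n in sequentially. real n > s"
      using eventually_gt_at_top filterlim_real_sequentially by (rule eventually_compose_filterlim)
    then show "\<forall>\<^sub>F n in sequentially. norm (Z (real (Suc n)) - Z s) \<le> C / s"
    proof eventually_elim
      case (elim n)
      have "norm (Z (real (Suc n)) - Z s) \<le> C / s - C / real (Suc n)"
        using elim that by (intro Z_diff) auto
      also have "\<dots> \<le> C / s" using C by simp
      finally show ?case .
    qed
  qed simp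
  have Z_lim: "(Z \<longlongrightarrow> \<gamma>) at_top"
  proof -
    have "((\<lambda>s. norm (Z s - \<gamma>)) \<longlongrightarrow> 0) at_top"
    proof (rule tendsto_sandwich)
      show "\<forall>\<^sub>F s in at_top. 0 \<le> norm (Z s - \<gamma>)" by simp
      show "\<forall>\<^sub>F s in at_top. norm (Z s - \<gamma>) \<le> C / s"
        using eventually_ge_at_top[of 1] by eventually_elim (use bound norm_minus_commute in metis)
      show "((\<lambda>s. C / s) \<longlongrightarrow> 0) at_top"
        by (intro tendsto_divide_0[OF tendsto_const] filterlim_at_top_imp_at_infinity filterlim_ident)
    qed simp
    then show ?thesis by (simp add: tendsto_norm_zero_iff LIM_zero_iff)
  qed
  have "\<gamma> \<noteq> 0"
  proof
    assume "\<gamma> = 0"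
    have E1: "E 1 > 0" using nontrivial by (auto simp: E_def intro: add_pos_nonneg)
    have "sqrt (E 1 * exp (- \<kappa>)) \<le> norm \<gamma>"
    proof (rule tendsto_lowerbound)
      show "((\<lambda>s. norm (Z s)) \<longlongrightarrow> norm \<gamma>) at_top" by (intro tendsto_intros Z_lim)
      show "\<forall>\<^sub>F s in at_top. sqrt (E 1 * exp (- \<kappa>)) \<le> norm (Z s)"
        using eventually_ge_at_top[of 1] by eventually_elim (use lower Z_norm in auto)
    qed simp
    then show False using E1 \<open>\<gamma> = 0\<close> by (simp add: mult_le_0_iff)
  qed
  moreover have "((\<lambda>s. u s - Re (\<gamma> * cis s)) \<longlongrightarrow> 0) at_top"
  proof -
    have "((\<lambda>s. norm (Z s - \<gamma>)) \<longlongrightarrow> 0) at_top"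
      using Z_lim by (simp add: tendsto_norm_zero_iff LIM_zero_iff)
    moreover have "\<bar>u s - Re (\<gamma> * cis s)\<bar> \<le> norm (Z s - \<gamma>)" for s
    proof -
      \<comment> \<open>Rotating back recovers \<open>u\<close> as a real part, and rotation
        preserves the distance between \<open>Z s\<close> and \<open>\<gamma>\<close>.\<close>
      have "cis s * Z s = Complex (u s) (- u' s)"
        by (simp add: Z_def cis_mult mult.assoc[symmetric])
      then have "u s - Re (\<gamma> * cis s) = Re (cis s * (Z s - \<gamma>))"
        by (simp add: algebra_simps)
      then show ?thesis
        using abs_Re_le_cmod[of "cis s * (Z s - \<gamma>)"] by (simp add: norm_mult)
    qed
    ultimately show ?thesis
      by (intro Lim_null_comparison[where f = "\<lambda>s. u s - Re (\<gamma> * cis s)"]) auto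
  qed
  ultimately show thesis using that by blast
qed

section \<open>A Bessel-type integral and its asymptotics\<close>

text \<open>Up to a constant factor this is the Bessel function of order \<open>(n + 1) / 2\<close>
  at \<open>s\<close>, divided by \<open>s\<close> to that order. For \<open>n = d - 1\<close> the
  weight is proportional to the volume of the slices of the unit ball.\<close>

definition slice_transform :: "nat \<Rightarrow> real \<Rightarrow> real" where
  "slice_transform n s = integral {-1..1} (\<lambda>t. sqrt (1 - t\<^sup>2) ^ n * cos (s * t))"

lemma has_real_derivative_integral_cos:
  fixes g :: "real \<Rightarrow> real"
  assumes "continuous_on {a..b} g"
  shows "((\<lambda>s. integral {a..b} (\<lambda>t. g t * cos (s * t))) has_real_derivative
           - integral {a..b} (\<lambda>t. t * g t * sin (s * t))) (at s)"
proof -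
  have "((\<lambda>s. integral (cbox a b) (\<lambda>t. g t * cos (s * t))) has_real_derivative
           integral (cbox a b) (\<lambda>t. - (t * g t * sin (s * t)))) (at s within UNIV)"
    using assms
    by (intro leibniz_rule_field_derivative)
       (auto intro!: derivative_eq_intros integrable_continuous_interval continuous_intros
             continuous_on_compose2[OF assms] simp: split_beta)
  then show ?thesis by (simp add: integral_neg)
qed

lemma has_real_derivative_integral_sin:
  fixes g :: "real \<Rightarrow> real"
  assumes "continuous_on {a..b} g"
  shows "((\<lambda>s. integral {a..b} (\<lambda>t. g t * sin (s * t))) has_real_derivative
           integral {a..b} (\<lambda>t. t * g t * cos (s * t))) (at s)"
proof -
  have "((\<lambda>s. integral (cbox a b) (\<lambda>t. g t * sin (s * t))) has_real_derivative
           integral (cbox a b) (\<lambda>t. t * g t * cos (s * t))) (at s within UNIV)"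
    using assms
    by (intro leibniz_rule_field_derivative)
       (auto intro!: derivative_eq_intros integrable_continuous_interval continuous_intros
             continuous_on_compose2[OF assms] simp: split_beta)
  then show ?thesis by simp
qed

text \<open>Integration by parts gives a Bessel-type equation for the integral \<open>I\<close>.
  Multiplication by \<open>s powr \<alpha>\<close> with \<open>\<alpha> = (n + 2) / 2\<close>
  removes its first-order term and leaves
  \<open>u'' = (\<alpha> * (\<alpha> - 1) / s\<^sup>2 - 1) * u\<close>, a perturbed
  oscillator.\<close>

lemma slice_transform_asymptotics:
  obtains \<gamma> where "\<gamma> \<noteq> 0"
    "((\<lambda>s. s powr (real (n + 2) / 2) * slice_transform n s - Re (\<gamma> * cis s)) \<longlongrightarrow> 0) at_top"
proof -
  define w where "w = (\<lambda>t::real. sqrt (1 - t\<^sup>2) ^ n)"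
  define I where "I = slice_transform n"
  define I1 where "I1 s = - integral {-1..1} (\<lambda>t. t * w t * sin (s * t))" for s
  define I2 where "I2 s = - integral {-1..1} (\<lambda>t. t * (t * w t) * cos (s * t))" for s
  define \<alpha> where "\<alpha> = real (n + 2) / 2"
  have w_cont [continuous_intros]: "continuous_on A w" for A
    unfolding w_def by (intro continuous_intros)
  have I: "(I has_real_derivative I1 s) (at s)" for s
    using has_real_derivative_integral_cos[OF w_cont[of "{-1..1}"], of s]
    by (simp add: I_def I1_def w_def slice_transform_def[abs_def])
  have I1: "(I1 has_real_derivative I2 s) (at s)" for s
    unfolding I1_def[abs_def] I2_def
    by (intro DERIV_minus has_real_derivative_integral_sin continuous_intros)
  have ode: "s * (I s + I2 s) + (real n + 2) * I1 s = 0" for s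
  proof -
    \<comment> \<open>The integrand is the derivative of
      \<open>sqrt (1 - t\<^sup>2) ^ (n + 2) * sin (s * t)\<close>, which vanishes at both ends. The
      square root is not differentiable there, so the interior form of the fundamental theorem is
      used.\<close>
    have "((\<lambda>t. - (real n + 2) * (t * w t * sin (s * t)) + s * ((1 - t\<^sup>2) * w t * cos (s * t)))
        has_integral (sqrt (1 - 1\<^sup>2) ^ (n + 2) * sin (s * 1) - sqrt (1 - (- 1)\<^sup>2) ^ (n + 2) * sin (s * - 1)))
        {-1..1}"
    proof (rule fundamental_theorem_of_calculus_interior)
      show "continuous_on {-1..1} (\<lambda>t. sqrt (1 - t\<^sup>2) ^ (n + 2) * sin (s * t))"
        by (intro continuous_intros)
      fix t :: real assume t: "t \<in> {-1<..<1}"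
      then have pos: "1 - t\<^sup>2 > 0" by (simp add: abs_square_less_1 abs_less_iff)
      define y where "y = sqrt (1 - t\<^sup>2)"
      have y: "y > 0" "1 - t\<^sup>2 = y\<^sup>2" "w t = y ^ n" using pos by (auto simp: y_def w_def)
      have "((\<lambda>t. sqrt (1 - t\<^sup>2)) has_real_derivative - t / y) (at t)"
        using pos by (auto intro!: derivative_eq_intros simp: y_def field_simps)
      note DERIV_power[OF this, of "n + 2"]
      moreover have "((\<lambda>t. sin (s * t)) has_real_derivative cos (s * t) * s) (at t)"
        by (auto intro!: derivative_eq_intros)
      ultimately have "((\<lambda>t. sqrt (1 - t\<^sup>2) ^ (n + 2) * sin (s * t)) has_real_derivative
          real (n + 2) * (- t / y * y ^ (n + 1)) * sin (s * t) + cos (s * t) * s * y ^ (n + 2)) (at t)"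
        unfolding y_def by (rule derivative_eq_intros) simp
      also have "real (n + 2) * (- t / y * y ^ (n + 1)) * sin (s * t) + cos (s * t) * s * y ^ (n + 2)
         = - (real n + 2) * (t * w t * sin (s * t)) + s * ((1 - t\<^sup>2) * w t * cos (s * t))"
        using y(1) unfolding y(2,3) by (simp add: field_simps power2_eq_square)
      finally show "((\<lambda>t. sqrt (1 - t\<^sup>2) ^ (n + 2) * sin (s * t)) has_vector_derivative
         - (real n + 2) * (t * w t * sin (s * t)) + s * ((1 - t\<^sup>2) * w t * cos (s * t))) (at t)"
        by (simp add: has_real_derivative_iff_has_vector_derivative)
    qed simp
    then have "integral {-1..1} (\<lambda>t. - (real n + 2) * (t * w t * sin (s * t))
        + s * ((1 - t\<^sup>2) * w t * cos (s * t))) = 0"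
      by (simp add: integral_unique)
    also have "(\<lambda>t. - (real n + 2) * (t * w t * sin (s * t)) + s * ((1 - t\<^sup>2) * w t * cos (s * t)))
      = (\<lambda>t. - (real n + 2) * (t * w t * sin (s * t)) + s * (w t * cos (s * t) - t * (t * w t) * cos (s * t)))"
      by (auto simp: algebra_simps power2_eq_square)
    also have "integral {-1..1} \<dots> = - (real n + 2) * integral {-1..1} (\<lambda>t. t * w t * sin (s * t))
      + s * (integral {-1..1} (\<lambda>t. w t * cos (s * t)) - integral {-1..1} (\<lambda>t. t * (t * w t) * cos (s * t)))"
      by (subst integral_add integral_diff integral_mult_right
          | intro integrable_continuous_interval continuous_intros)+ simp
    finally show ?thesis
      by (simp add: I_def I1_def I2_def w_def slice_transform_def algebra_simps)
  qed
  define u where "u s = s powr \<alpha> * I s" for s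
  define u' where "u' s = s powr \<alpha> * (I1 s + \<alpha> / s * I s)" for s
  define q where "q s = \<alpha> * (\<alpha> - 1) / s\<^sup>2" for s
  have I2: "I2 s = - I s - 2 * \<alpha> / s * I1 s" if "s > 0" for s
    using ode[of s] that by (simp add: \<alpha>_def field_simps)
  obtain \<gamma> where "\<gamma> \<noteq> 0" "((\<lambda>s. u s - Re (\<gamma> * cis s)) \<longlongrightarrow> 0) at_top"
  proof (rule perturbed_oscillator_asymptotics[of u u' q "\<bar>\<alpha> * (\<alpha> - 1)\<bar>"])
    fix s :: real assume s: "s > 0"
    have powr: "((\<lambda>s. s powr \<alpha>) has_real_derivative \<alpha> / s * s powr \<alpha>) (at s)"
      using has_real_derivative_powr[OF s, of \<alpha>] s by (simp add: powr_diff field_simps)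
    show "(u has_real_derivative u' s) (at s)"
      unfolding u_def[abs_def] u'_def
      by (rule derivative_eq_intros powr I refl)+ (simp add: algebra_simps)
    have "(u' has_real_derivative \<alpha> / s * s powr \<alpha> * (I1 s + \<alpha> / s * I s)
        + (I2 s + (- \<alpha> / s\<^sup>2 * I s + I1 s * (\<alpha> / s))) * s powr \<alpha>) (at s)"
      unfolding u'_def[abs_def]
      by (intro DERIV_mult DERIV_add powr I I1)
         (use s in \<open>auto intro!: derivative_eq_intros simp: power2_eq_square\<close>)
    also have "\<alpha> / s * s powr \<alpha> * (I1 s + \<alpha> / s * I s)
        + (I2 s + (- \<alpha> / s\<^sup>2 * I s + I1 s * (\<alpha> / s))) * s powr \<alpha> = (q s - 1) * u s"
      using s by (simp add: I2 u_def q_def field_simps power2_eq_square)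
    finally show "(u' has_real_derivative (q s - 1) * u s) (at s)" .
    show "\<bar>q s\<bar> \<le> \<bar>\<alpha> * (\<alpha> - 1)\<bar> / s\<^sup>2" by (simp add: q_def)
  next
    \<comment> \<open>Nontriviality is checked at \<open>s = 1\<close>: the cosine is positive on
      the whole interval because \<open>1 < pi / 2\<close>, and on the middle half the integrand is
      at least \<open>(1/2)^n * (1/2)\<close> because \<open>1 / 2 < pi / 3\<close>.\<close>
    have "0 < I 1"
    proof -
      have int: "(\<lambda>t. w t * cos t) integrable_on {-1..1}"
        by (intro integrable_continuous_interval continuous_intros)
      have cos_pos: "cos t > 0" if "t \<in> {-1..1}" for t :: real
        using that pi_gt3 cos_gt_zero_pi[of t] by auto
      have "integral {-1/2..1/2} (\<lambda>t::real. (1/2)^n * (1/2)) \<le> integral {-1/2..1/2} (\<lambda>t. w t * cos t)"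
      proof (rule integral_le)
        fix t :: real assume t: "t \<in> {-1/2..1/2}"
        have "t\<^sup>2 \<le> (1/2)\<^sup>2" using t by (subst abs_le_square_iff[symmetric]) auto
        then have "(1/2)\<^sup>2 \<le> 1 - t\<^sup>2" by (simp add: power2_eq_square)
        then have "1/2 \<le> sqrt (1 - t\<^sup>2)" by (rule real_le_rsqrt)
        moreover have "cos (pi / 3) \<le> cos \<bar>t\<bar>"
          using t pi_gt3 by (intro cos_monotone_0_pi_le) auto
        ultimately show "(1/2)^n * (1/2) \<le> w t * cos t"
          unfolding w_def by (intro mult_mono power_mono) (use \<open>(1/2)\<^sup>2 \<le> 1 - t\<^sup>2\<close> in \<open>auto simp: cos_60 power2_eq_square intro!: zero_le_power\<close>)
      qed (auto intro!: integrable_continuous_interval continuous_intros)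
      also have "\<dots> \<le> integral {-1..1} (\<lambda>t. w t * cos t)"
        using int by (intro integral_subset_le integrable_subinterval_real[OF int] )
          (auto simp: w_def abs_square_le_1 intro!: mult_nonneg_nonneg less_imp_le[OF cos_pos])
      finally show ?thesis by (simp add: I_def slice_transform_def w_def)
        (smt (verit) zero_less_power divide_pos_pos)
    qed
    then show "u 1 \<noteq> 0" by (simp add: u_def)
  qed
  then show thesis using that by (simp add: u_def I_def \<alpha>_def)
qed

section \<open>Rotation invariance and the slices of the ball\<close>

lemma nn_integral_lborel_shift:
  fixes f :: "'a::euclidean_space \<Rightarrow> ennreal"
  assumes [measurable]: "f \<in> borel_measurable borel"
  shows "(\<integral>\<^sup>+x. f (c + x) \<partial>lborel) = (\<integral>\<^sup>+x. f x \<partial>lborel)"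
proof -
  have "(\<integral>\<^sup>+x. f x \<partial>lborel) = (\<integral>\<^sup>+x. f x \<partial>distr lborel borel ((+) c))"
    by (simp add: lborel_distr_plus)
  then show ?thesis by (subst (asm) nn_integral_distr) auto
qed

lemma nn_integral_lborel_reflect:
  fixes f :: "'a::euclidean_space \<Rightarrow> ennreal"
  assumes [measurable]: "f \<in> borel_measurable borel"
  shows "(\<integral>\<^sup>+x. f (c - x) \<partial>lborel) = (\<integral>\<^sup>+x. f x \<partial>lborel)"
proof -
  have "(\<integral>\<^sup>+x. f x \<partial>lborel) = (\<integral>\<^sup>+x. f x \<partial>distr lborel borel (\<lambda>x. c + (-1) *\<^sub>R x))"
    using lborel_affine[of "-1" c] by (simp add: density_1)
  then show ?thesis by (subst (asm) nn_integral_distr) auto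
qed

text \<open>Both sides, multiplied by the volume of the unit ball, are equal to the integral of
  \<open>f (T x) * g (y + T x)\<close> over all \<open>x\<close> and \<open>y\<close>, where \<open>g\<close> is the indicator function of the ball.\<close>

lemma nn_integral_orthogonal_transformation:
  fixes T :: "'a::euclidean_space \<Rightarrow> 'a" and f :: "'a \<Rightarrow> ennreal"
  assumes T: "orthogonal_transformation T" and [measurable]: "f \<in> borel_measurable borel"
  shows "(\<integral>\<^sup>+x. f (T x) \<partial>lborel) = (\<integral>\<^sup>+x. f x \<partial>lborel)"
proof -
  define g :: "'a \<Rightarrow> ennreal" where "g = indicator (cball 0 1)"
  have [measurable]: "g \<in> borel_measurable borel"
    unfolding g_def by (intro borel_measurable_indicator) simp
  have lin: "linear T" using T by (rule orthogonal_transformation_linear)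
  have [measurable]: "T \<in> borel_measurable borel"
    by (intro borel_measurable_continuous_onI linear_continuous_on lin
          linear_conv_bounded_linear[THEN iffD1])
  have surj: "T (inv T y) = y" for y
    using T by (simp add: orthogonal_transformation_surj surj_f_inv_f)
  have shift: "T (x - inv T y) = T x - y" for x y
    by (simp add: linear_diff[OF lin] surj)
  have g_T: "g (T x) = g x" for x
    using T by (simp add: g_def indicator_def orthogonal_transformation_norm)
  define v where "v = (\<integral>\<^sup>+y. g y \<partial>lborel)"
  have "v = ennreal (unit_ball_vol (real DIM('a)))"
    by (simp add: v_def g_def emeasure_cball)
  then have v: "v \<noteq> 0" "v \<noteq> \<infinity>"
    using unit_ball_vol_pos[of "real DIM('a)"] by (auto simp: ennreal_eq_0_iff simp del: unit_ball_vol_pos)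
  have "(\<integral>\<^sup>+x. f (T x) \<partial>lborel) * v = (\<integral>\<^sup>+x. f (T x) * v \<partial>lborel)"
    by (subst nn_integral_multc) auto
  also have "\<dots> = (\<integral>\<^sup>+x. \<integral>\<^sup>+y. f (T x) * g (T x + y) \<partial>lborel \<partial>lborel)"
    by (subst nn_integral_cmult) (auto simp: nn_integral_lborel_shift v_def)
  also have "\<dots> = (\<integral>\<^sup>+y. \<integral>\<^sup>+x. f (T x) * g (T x + y) \<partial>lborel \<partial>lborel)"
    by (rule lborel_pair.Fubini') measurable
  \<comment> \<open>For fixed \<open>y\<close>, translating \<open>x\<close> by
    \<open>- inv T y\<close> moves \<open>y\<close> from the argument of \<open>g\<close> to that of
    \<open>f\<close>. Then \<open>g (T x) = g x\<close> removes \<open>T\<close> from the weight,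
    and the inner integral over \<open>y\<close> no longer sees \<open>T x\<close>.\<close>
  also have "\<dots> = (\<integral>\<^sup>+y. \<integral>\<^sup>+x. f (T x - y) * g (T x) \<partial>lborel \<partial>lborel)"
  proof (rule nn_integral_cong)
    show "(\<integral>\<^sup>+x. f (T x) * g (T x + y) \<partial>lborel) = (\<integral>\<^sup>+x. f (T x - y) * g (T x) \<partial>lborel)" for y
      by (subst nn_integral_lborel_shift[of _ "- inv T y", symmetric]) (simp_all add: shift)
  qed
  also have "\<dots> = (\<integral>\<^sup>+x. \<integral>\<^sup>+y. f (T x - y) * g (T x) \<partial>lborel \<partial>lborel)"
    by (rule lborel_pair.Fubini') measurable
  also have "\<dots> = (\<integral>\<^sup>+x. (\<integral>\<^sup>+y. f y \<partial>lborel) * g x \<partial>lborel)"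
    by (subst nn_integral_multc) (auto simp: nn_integral_lborel_reflect g_T)
  also have "\<dots> = (\<integral>\<^sup>+x. f x \<partial>lborel) * v"
    by (subst nn_integral_cmult) (auto simp: v_def)
  finally show ?thesis using v by (simp add: mult.commute[of _ v] ennreal_mult_cancel_left)
qed

text \<open>Fubini's theorem with the coordinate along \<open>b\<close> integrated last: the slice
  at height \<open>t\<close> is a ball of radius \<open>sqrt (1 - t\<^sup>2)\<close> in one
  dimension less.\<close>

lemma nn_integral_cball_inner_Basis:
  fixes b :: "'a::euclidean_space" and f :: "real \<Rightarrow> ennreal"
  assumes b: "b \<in> Basis" and [measurable]: "f \<in> borel_measurable borel"
  shows "(\<integral>\<^sup>+y. f (b \<bullet> y) * indicator (cball 0 1) y \<partial>lborel) =
    (\<integral>\<^sup>+t. f t * ennreal (unit_ball_vol (real (DIM('a) - 1)) *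
        (indicator {-1..1} t * sqrt (1 - t\<^sup>2) ^ (DIM('a) - 1))) \<partial>lborel)"
proof -
  interpret product_sigma_finite "\<lambda>_::'a. lborel :: real measure" by standard
  define A where "A = Basis - {b}"
  have A: "insert b A = Basis" "b \<notin> A" "finite A" "card A = DIM('a) - 1"
    using b by (auto simp: A_def)
  have inner_sum: "b \<bullet> (\<Sum>c\<in>Basis. g c *\<^sub>R c) = g b" for g
    using b by (simp add: inner_sum_right inner_Basis if_distrib cong: if_cong)
  have norm_sum: "norm (\<Sum>c\<in>Basis. g c *\<^sub>R c :: 'a) = sqrt ((g b)\<^sup>2 + (\<Sum>c\<in>A. (g c)\<^sup>2))" for g
  proof -
    have "norm (\<Sum>c\<in>Basis. g c *\<^sub>R c :: 'a) = sqrt (\<Sum>c\<in>insert b A. (g c)\<^sup>2)"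
      unfolding A(1) by (subst norm_eq_sqrt_inner, subst euclidean_inner) (simp add: power2_eq_square)
    then show ?thesis using A(2,3) by simp
  qed
  have "(\<integral>\<^sup>+y. f (b \<bullet> y) * indicator (cball 0 1) y \<partial>lborel) =
     (\<integral>\<^sup>+g. f (g b) * indicator {g. sqrt ((g b)\<^sup>2 + (\<Sum>c\<in>A. (g c)\<^sup>2)) \<le> 1} g
        \<partial>Pi\<^sub>M (insert b A) (\<lambda>_. lborel))"
    unfolding A(1)
    by (subst lborel_eq, subst nn_integral_distr)
       (auto simp: inner_sum norm_sum indicator_def intro!: nn_integral_cong)
  also have "\<dots> = (\<integral>\<^sup>+t. \<integral>\<^sup>+g. f t * indicator {g. sqrt (t\<^sup>2 + (\<Sum>c\<in>A. (g c)\<^sup>2)) \<le> 1} g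
        \<partial>Pi\<^sub>M A (\<lambda>_. lborel) \<partial>lborel)"
  proof (subst product_nn_integral_insert_rev)
    have "(\<Sum>c\<in>A. (if c = b then t else g c)\<^sup>2) = (\<Sum>c\<in>A. (g c)\<^sup>2)" for g :: "'a \<Rightarrow> real" and t
      using A(2) by (intro sum.cong) auto
    then show "(\<integral>\<^sup>+t. \<integral>\<^sup>+g. f ((g(b := t)) b) *
        indicator {g. sqrt ((g b)\<^sup>2 + (\<Sum>c\<in>A. (g c)\<^sup>2)) \<le> 1} (g(b := t)) \<partial>Pi\<^sub>M A (\<lambda>_. lborel) \<partial>lborel) =
       (\<integral>\<^sup>+t. \<integral>\<^sup>+g. f t * indicator {g. sqrt (t\<^sup>2 + (\<Sum>c\<in>A. (g c)\<^sup>2)) \<le> 1} g \<partial>Pi\<^sub>M A (\<lambda>_. lborel) \<partial>lborel)"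
      by (intro nn_integral_cong) (simp add: indicator_def)
    show "(\<lambda>g. f (g b) * indicator {g. sqrt ((g b)\<^sup>2 + (\<Sum>c\<in>A. (g c)\<^sup>2)) \<le> 1} g)
        \<in> borel_measurable (Pi\<^sub>M (insert b A) (\<lambda>_. lborel))"
      by measurable
  qed (use A in auto)
  also have "\<dots> = (\<integral>\<^sup>+t. f t * ennreal (unit_ball_vol (real (DIM('a) - 1)) *
        (indicator {-1..1} t * sqrt (1 - t\<^sup>2) ^ (DIM('a) - 1))) \<partial>lborel)"
  proof (rule nn_integral_cong_AE)
    \<comment> \<open>At these two heights the slice has radius zero, while the volume formula is
      applied with a positive radius.\<close>
    have "AE t in lborel. t \<notin> {-1, 1 :: real}"
      by (intro AE_not_in countable_imp_null_set_lborel) auto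
    then show "AE t in lborel. (\<integral>\<^sup>+g. f t * indicator {g. sqrt (t\<^sup>2 + (\<Sum>c\<in>A. (g c)\<^sup>2)) \<le> 1} g
        \<partial>Pi\<^sub>M A (\<lambda>_. lborel)) = f t * ennreal (unit_ball_vol (real (DIM('a) - 1)) *
        (indicator {-1..1} t * sqrt (1 - t\<^sup>2) ^ (DIM('a) - 1)))"
    proof eventually_elim
      case (elim t)
      let ?S = "{g. sqrt (t\<^sup>2 + (\<Sum>c\<in>A. (g c)\<^sup>2)) \<le> 1}"
      have "(\<integral>\<^sup>+g. f t * indicator ?S g \<partial>Pi\<^sub>M A (\<lambda>_. lborel)) =
          (\<integral>\<^sup>+g. f t * indicator (?S \<inter> space (Pi\<^sub>M A (\<lambda>_. lborel))) g \<partial>Pi\<^sub>M A (\<lambda>_. lborel))"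
        by (intro nn_integral_cong) (auto simp: indicator_def)
      also have "\<dots> = f t * emeasure (Pi\<^sub>M A (\<lambda>_. lborel)) (?S \<inter> space (Pi\<^sub>M A (\<lambda>_. lborel)))"
        by (subst nn_integral_cmult) auto
      also have "emeasure (Pi\<^sub>M A (\<lambda>_. lborel)) (?S \<inter> space (Pi\<^sub>M A (\<lambda>_. lborel))) =
          ennreal (unit_ball_vol (real (DIM('a) - 1)) * (indicator {-1..1} t * sqrt (1 - t\<^sup>2) ^ (DIM('a) - 1)))"
      proof (cases "t \<in> {-1..1}")
        case True
        with elim have pos: "1 - t\<^sup>2 > 0" by (simp add: abs_square_less_1 abs_less_iff)
        have "?S = {g. sqrt (\<Sum>c\<in>A. (g c)\<^sup>2) \<le> sqrt (1 - t\<^sup>2)}" by auto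
        then show ?thesis
          using emeasure_cball_aux[of A "sqrt (1 - t\<^sup>2)"] A pos True by simp
      next
        case False
        have "1 < t\<^sup>2 + (\<Sum>c\<in>A. (g c)\<^sup>2)" for g :: "'a \<Rightarrow> real"
        proof -
          have "1 < t\<^sup>2" using False abs_square_le_1[of t] by (auto simp: abs_le_iff)
          moreover have "(\<Sum>c\<in>A. (g c)\<^sup>2) \<ge> 0" by (intro sum_nonneg) auto
          ultimately show ?thesis by linarith
        qed
        then have "?S = {}" by (auto simp: not_le)
        then show ?thesis using False by simp
      qed
      finally show ?case .
    qed
  qed
  finally show ?thesis .
qed

lemma borel_measurable_indicator_cball [measurable]:
  "indicator (cball c r) \<in> borel_measurable (borel :: 'a::euclidean_space measure)"
  by (intro borel_measurable_indicator) simp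

text \<open>An orthogonal transformation carries a basis vector to \<open>e\<close> and preserves
  the ball, so the marginal in direction \<open>e\<close> is that of a coordinate.\<close>

lemma distr_cball_inner:
  fixes e :: "real ^ 'n"
  assumes e: "norm e = 1"
  shows "distr (density lborel (indicator (cball 0 1))) borel (\<lambda>y. e \<bullet> y) =
    density lborel (\<lambda>t. ennreal (unit_ball_vol (real (CARD('n) - 1)) *
        (indicator {-1..1} t * sqrt (1 - t\<^sup>2) ^ (CARD('n) - 1))))"
proof (rule measure_eqI)
  fix X assume "X \<in> sets (distr (density lborel (indicator (cball 0 1))) borel (\<lambda>y. e \<bullet> y))"
  then have X [measurable]: "X \<in> sets borel" by simp
  obtain b :: "real ^ 'n" where b: "b \<in> Basis" using nonempty_Basis by blast
  obtain T where T: "orthogonal_transformation T" "T b = e"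
    using orthogonal_transformation_exists_1[of b e] e b by (auto simp: norm_Basis)
  have "emeasure (distr (density lborel (indicator (cball 0 1))) borel (\<lambda>y. e \<bullet> y)) X =
      (\<integral>\<^sup>+y. indicator X (e \<bullet> y) * indicator (cball 0 1) y \<partial>lborel)"
    using measurable_sets[of "\<lambda>y. e \<bullet> y" borel borel X]
    by (subst emeasure_distr, simp, simp, subst emeasure_density)
       (auto simp: indicator_def intro!: nn_integral_cong)
  also have "\<dots> = (\<integral>\<^sup>+y. indicator X (b \<bullet> y) * indicator (cball 0 1) y \<partial>lborel)"
    using T by (subst nn_integral_orthogonal_transformation[OF T(1), symmetric])
      (auto simp: orthogonal_transformation_norm orthogonal_transformation_def indicator_def
            intro!: nn_integral_cong)
  also have "\<dots> = emeasure (density lborel (\<lambda>t. ennreal (unit_ball_vol (real (CARD('n) - 1)) *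
        (indicator {-1..1} t * sqrt (1 - t\<^sup>2) ^ (CARD('n) - 1))))) X"
    by (subst nn_integral_cball_inner_Basis[OF b]) (auto simp: emeasure_density mult.commute)
  finally show "emeasure (distr (density lborel (indicator (cball 0 1))) borel (\<lambda>y. e \<bullet> y)) X = \<dots>" .
qed simp

text \<open>The cosine depends only on the component along \<open>n\<close>, so the integral is one
  over the marginal of the ball in that direction. For \<open>n = 0\<close> any unit vector serves
  as the direction.\<close>

lemma integral_cball_cos_inner:
  fixes n :: "real ^ 'n"
  shows "(LINT y|lborel. indicator (cball 0 1) y * cos (n \<bullet> y)) =
      unit_ball_vol (real (CARD('n) - 1)) * slice_transform (CARD('n) - 1) (norm n)"
proof -
  obtain b :: "real ^ 'n" where b: "b \<in> Basis" using nonempty_Basis by blast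
  obtain e where e: "norm e = 1" "n = norm n *\<^sub>R e"
  proof (cases "n = 0")
    case True
    then show ?thesis using that[of b] b by (simp add: norm_Basis)
  next
    case False
    then show ?thesis using that[of "n /\<^sub>R norm n"] by simp
  qed
  let ?c = "unit_ball_vol (real (CARD('n) - 1))"
  let ?w = "\<lambda>t. indicator {-1..1} t * sqrt (1 - t\<^sup>2) ^ (CARD('n) - 1) :: real"
  have "(LINT y|lborel. indicator (cball 0 1) y * cos (n \<bullet> y)) =
      (LINT y|density lborel (\<lambda>y. ennreal (indicator (cball 0 1) y)). cos (norm n * (e \<bullet> y)))"
    using arg_cong[OF e(2), of "\<lambda>n. n \<bullet> y" for y]
    by (subst integral_density) (auto simp: borel_measurable_indicator)
  also have "\<dots> = (LINT t|distr (density lborel (indicator (cball 0 1))) borel (\<lambda>y. e \<bullet> y). cos (norm n * t))"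
    by (subst integral_distr) (auto simp: ennreal_indicator)
  also have "\<dots> = (LINT t|lborel. (?c * ?w t) * cos (norm n * t))"
    unfolding distr_cball_inner[OF e(1)]
    by (subst integral_density) (auto simp: indicator_def abs_square_le_1)
  also have "\<dots> = ?c * (LINT t:{-1..1}|lborel. sqrt (1 - t\<^sup>2) ^ (CARD('n) - 1) * cos (norm n * t))"
    by (simp add: set_lebesgue_integral_def mult.assoc)
  also have "(LINT t:{-1..1}|lborel. sqrt (1 - t\<^sup>2) ^ (CARD('n) - 1) * cos (norm n * t)) =
      slice_transform (CARD('n) - 1) (norm n)"
    unfolding slice_transform_def
    by (intro set_borel_integral_eq_integral(2) borel_integrable_atLeastAtMost')
       (auto intro!: continuous_intros)
  finally show ?thesis .
qed

section \<open>Smoothing the discrepancy\<close>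

lemma integer_lattice_diff: "k \<in> integer_lattice \<Longrightarrow> l \<in> integer_lattice \<Longrightarrow> k - l \<in> integer_lattice"
  by (auto simp: integer_lattice_def)

lemma finite_integer_lattice_bounded:
  "finite {k \<in> integer_lattice :: (real ^ 'n) set. norm k \<le> B}"
proof -
  define S where "S = (of_int :: int \<Rightarrow> real) ` {- \<lceil>B\<rceil>..\<lceil>B\<rceil>}"
  have "{k \<in> integer_lattice :: (real ^ 'n) set. norm k \<le> B} \<subseteq> vec_lambda ` (PiE UNIV (\<lambda>_. S))"
  proof
    fix k :: "real ^ 'n" assume "k \<in> {k \<in> integer_lattice. norm k \<le> B}"
    then have k: "\<And>i. k $ i \<in> \<int>" "norm k \<le> B" by (auto simp: integer_lattice_def)
    have "k $ i \<in> S" for i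
    proof -
      obtain z where z: "k $ i = of_int z" using k(1) by (auto elim: Ints_cases)
      have "\<bar>of_int z\<bar> \<le> B"
        using component_le_norm_cart[of k i] k(2) z by simp
      then have "z \<in> {- \<lceil>B\<rceil>..\<lceil>B\<rceil>}" by (auto simp: abs_le_iff) linarith+
      then show ?thesis by (auto simp: z S_def)
    qed
    then have "(\<lambda>i. k $ i) \<in> PiE UNIV (\<lambda>_. S)" by auto
    then show "k \<in> vec_lambda ` (PiE UNIV (\<lambda>_. S))"
      by (metis image_eqI vec_nth_inverse)
  qed
  moreover have "finite (vec_lambda ` (PiE UNIV (\<lambda>_::'n. S)) :: (real ^ 'n) set)"
    by (intro finite_imageI finite_PiE) (auto simp: S_def)
  ultimately show ?thesis by (rule finite_subset)
qed

lemma countable_integer_lattice: "countable (integer_lattice :: (real ^ 'n) set)"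
proof -
  have "integer_lattice = (\<Union>B::nat. {k \<in> integer_lattice :: (real ^ 'n) set. norm k \<le> real B})"
    by (auto simp: real_arch_simple)
  also have "countable \<dots>"
    by (rule countable_UN) (auto intro!: countable_finite finite_integer_lattice_bounded)
  finally show ?thesis .
qed

lemma unit_cube_borel [measurable]: "unit_cube \<in> sets (borel :: (real ^ 'n) measure)"
proof -
  have "unit_cube = (\<Inter>i. {x :: real ^ 'n. 0 \<le> x $ i \<and> x $ i < 1})"
    by (auto simp: unit_cube_def)
  also have "\<dots> \<in> sets borel"
    by (intro sets.finite_INT) auto
  finally show ?thesis .
qed

text \<open>The lattice translates of the half-open cube tile the space; the one containing
  \<open>x\<close> is given by the componentwise floor.\<close>

lemma card_unit_cube_translate:
  fixes x :: "real ^ 'n"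
  shows "(\<integral>\<^sup>+k. indicator unit_cube (x - k) \<partial>count_space integer_lattice) = (1 :: ennreal)"
proof -
  define k where "k = (\<chi> i. real_of_int \<lfloor>x $ i\<rfloor>)"
  have k: "k \<in> integer_lattice" "x - k \<in> unit_cube"
    by (auto simp: k_def integer_lattice_def unit_cube_def) linarith
  have uniq: "l = k" if "l \<in> integer_lattice" "x - l \<in> unit_cube" for l
    unfolding vec_eq_iff
  proof
    fix i
    have "l $ i \<in> \<int>" "0 \<le> x $ i - l $ i" "x $ i - l $ i < 1"
      using that by (auto simp: integer_lattice_def unit_cube_def)
    then obtain z where z: "l $ i = of_int z" by (auto elim: Ints_cases)
    then have "z = \<lfloor>x $ i\<rfloor>" using \<open>0 \<le> x $ i - l $ i\<close> \<open>x $ i - l $ i < 1\<close> by linarith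
    then show "l $ i = k $ i" by (simp add: k_def z)
  qed
  have "(\<integral>\<^sup>+l. indicator unit_cube (x - l) \<partial>count_space integer_lattice) =
      (\<integral>\<^sup>+l. indicator {k} l \<partial>count_space integer_lattice)"
  proof (rule nn_integral_cong)
    fix l assume "l \<in> space (count_space (integer_lattice :: (real ^ 'n) set))"
    then have "x - l \<in> unit_cube \<longleftrightarrow> l \<in> {k}" using k(2) uniq[of l] by auto
    then show "indicator unit_cube (x - l) = (indicator {k} l :: ennreal)"
      unfolding indicator_def by simp
  qed
  also have "\<dots> = 1" using k by (subst nn_integral_indicator) auto
  finally show ?thesis .
qed

text \<open>Insert the tiling as a partition of unity, exchange sum and integral, and translate each
  tile back to the unit cube.\<close>

lemma nn_integral_unfold_lattice:
  fixes h :: "real ^ 'n \<Rightarrow> ennreal"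
  assumes [measurable]: "h \<in> borel_measurable borel"
  shows "(\<integral>\<^sup>+x. h x \<partial>lborel) =
    (\<integral>\<^sup>+x\<in>unit_cube. (\<integral>\<^sup>+k. h (k + x) \<partial>count_space integer_lattice) \<partial>lborel)"
proof -
  have "(\<integral>\<^sup>+x. h x \<partial>lborel) =
      (\<integral>\<^sup>+x. (\<integral>\<^sup>+k. h x * indicator unit_cube (x - k) \<partial>count_space integer_lattice) \<partial>lborel)"
    by (subst nn_integral_cmult) (auto simp: card_unit_cube_translate)
  also have "\<dots> = (\<integral>\<^sup>+k. (\<integral>\<^sup>+x. h x * indicator unit_cube (x - k) \<partial>lborel) \<partial>count_space integer_lattice)"
    by (intro nn_integral_count_space_nn_integral countable_integer_lattice) measurable
  also have "\<dots> = (\<integral>\<^sup>+k. (\<integral>\<^sup>+x. h (k + x) * indicator unit_cube x \<partial>lborel) \<partial>count_space integer_lattice)"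
  proof (rule nn_integral_cong)
    show "(\<integral>\<^sup>+x. h x * indicator unit_cube (x - k) \<partial>lborel) = (\<integral>\<^sup>+x. h (k + x) * indicator unit_cube x \<partial>lborel)" for k
      by (subst nn_integral_lborel_shift[of _ k, symmetric]) auto
  qed
  also have "\<dots> = (\<integral>\<^sup>+x. (\<integral>\<^sup>+k. h (k + x) * indicator unit_cube x \<partial>count_space integer_lattice) \<partial>lborel)"
    by (intro nn_integral_count_space_nn_integral[symmetric] countable_integer_lattice) measurable
  also have "\<dots> = (\<integral>\<^sup>+x\<in>unit_cube. (\<integral>\<^sup>+k. h (k + x) \<partial>count_space integer_lattice) \<partial>lborel)"
    by (subst nn_integral_multc) auto
  finally show ?thesis .
qed

text \<open>Shifting \<open>x\<close> moves \<open>v\<close> into the indicator of the cube. After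
  unfolding, periodicity takes \<open>f x\<close> out of the sum over the lattice, and the remaining
  sum counts one tile.\<close>

lemma nn_integral_unit_cube_periodic_shift:
  fixes f :: "real ^ 'n \<Rightarrow> ennreal"
  assumes [measurable]: "f \<in> borel_measurable borel"
    and per: "\<And>k x. k \<in> integer_lattice \<Longrightarrow> f (k + x) = f x"
  shows "(\<integral>\<^sup>+x\<in>unit_cube. f (v + x) \<partial>lborel) = (\<integral>\<^sup>+x\<in>unit_cube. f x \<partial>lborel)"
proof -
  \<comment> \<open>The reflection \<open>k \<mapsto> - k\<close> turns \<open>k + x - v\<close>
    into \<open>(x - v) - k\<close>, the form in which the tiles were counted.\<close>
  have uminus: "(\<integral>\<^sup>+k. F k \<partial>count_space integer_lattice) = (\<integral>\<^sup>+k. F (- k) \<partial>count_space integer_lattice)"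
    for F :: "real ^ 'n \<Rightarrow> ennreal"
    by (rule nn_integral_bij_count_space[symmetric])
       (rule bij_betwI[where g = uminus], auto simp: integer_lattice_def)
  have "(\<integral>\<^sup>+x\<in>unit_cube. f (v + x) \<partial>lborel) = (\<integral>\<^sup>+x. f x * indicator unit_cube (x - v) \<partial>lborel)"
    by (subst nn_integral_lborel_shift[of _ v, symmetric]) auto
  also have "\<dots> = (\<integral>\<^sup>+x\<in>unit_cube.
      (\<integral>\<^sup>+k. f (k + x) * indicator unit_cube (k + x - v) \<partial>count_space integer_lattice) \<partial>lborel)"
    by (subst nn_integral_unfold_lattice) auto
  also have "\<dots> = (\<integral>\<^sup>+x\<in>unit_cube. f x *
      (\<integral>\<^sup>+k. indicator unit_cube ((x - v) - k) \<partial>count_space integer_lattice) \<partial>lborel)"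
  proof (intro nn_integral_cong arg_cong2[where f = "(*)"] refl)
    fix x
    have "(\<integral>\<^sup>+k. f (k + x) * indicator unit_cube (k + x - v) \<partial>count_space integer_lattice)
        = (\<integral>\<^sup>+k. f x * indicator unit_cube (k + x - v) \<partial>count_space integer_lattice)"
      by (intro nn_integral_cong) (auto simp: per)
    also have "\<dots> = f x * (\<integral>\<^sup>+k. indicator unit_cube (k + x - v) \<partial>count_space integer_lattice)"
      by (subst nn_integral_cmult) auto
    also have "(\<integral>\<^sup>+k. indicator unit_cube (k + x - v) \<partial>count_space integer_lattice) =
        (\<integral>\<^sup>+k. indicator unit_cube ((x - v) - k) \<partial>count_space integer_lattice :: ennreal)"
      by (subst uminus) (auto simp: algebra_simps)
    finally show "(\<integral>\<^sup>+k. f (k + x) * indicator unit_cube (k + x - v) \<partial>count_space integer_lattice)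
      = f x * (\<integral>\<^sup>+k. indicator unit_cube ((x - v) - k) \<partial>count_space integer_lattice)" .
  qed
  finally show ?thesis by (simp add: card_unit_cube_translate)
qed

lemma emeasure_unit_cube: "emeasure lborel (unit_cube :: (real ^ 'n) set) = 1"
proof -
  have "emeasure lborel (box 0 (\<chi> i. 1) :: (real ^ 'n) set) \<le> emeasure lborel (unit_cube :: (real ^ 'n) set)"
    by (intro emeasure_mono) (auto simp: unit_cube_def mem_box_cart less_imp_le)
  moreover have "emeasure lborel (unit_cube :: (real ^ 'n) set) \<le> emeasure lborel (cbox 0 (\<chi> i. 1) :: (real ^ 'n) set)"
    by (intro emeasure_mono) (auto simp: unit_cube_def mem_box_cart less_imp_le)
  moreover have "((\<chi> i. 1) :: real ^ 'n) \<bullet> b = 1" if "b \<in> Basis" for b :: "real ^ 'n"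
    using that by (auto simp: Basis_vec_def inner_axis)
  ultimately show ?thesis
    by (simp add: emeasure_lborel_box_eq emeasure_lborel_cbox_eq)
qed

lemma cos_periodic_lattice:
  fixes n k :: "real ^ 'n"
  assumes "n \<in> integer_lattice" "k \<in> integer_lattice"
  shows "cos (2 * pi * (n \<bullet> (k + x))) = cos (2 * pi * (n \<bullet> x))"
proof -
  have "n \<bullet> k \<in> \<int>"
    using assms by (auto simp: inner_vec_def integer_lattice_def intro!: Ints_sum Ints_mult)
  then obtain z where "n \<bullet> k = of_int z" by (auto elim: Ints_cases)
  then have "2 * pi * (n \<bullet> (k + x)) = 2 * pi * (n \<bullet> x) + of_int z * (2 * pi)"
    by (simp add: inner_add_right algebra_simps)
  also have "cos \<dots> = cos (2 * pi * (n \<bullet> x))"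
    using cos_int_2pin[of z] sin_int_2pin[of z] by (simp add: cos_add mult.commute)
  finally show ?thesis .
qed

lemma integrable_unit_cube: "integrable lborel (indicator unit_cube :: real ^ 'n \<Rightarrow> real)"
  by (simp add: emeasure_unit_cube)

lemma set_integrable_unit_cube_cos:
  "integrable lborel (\<lambda>x :: real ^ 'n. indicator unit_cube x * cos (2 * pi * (n \<bullet> x)))"
proof (rule Bochner_Integration.integrable_bound)
  show "integrable lborel (indicator unit_cube :: real ^ 'n \<Rightarrow> real)"
    by (rule integrable_unit_cube)
qed (auto simp: indicator_def)

text \<open>A translation by \<open>v\<close> with \<open>n \<bullet> v = 1 / 2\<close> reverses the
  sign of the cosine but preserves its integral over the torus.\<close>

lemma integral_unit_cube_cos:
  fixes n :: "real ^ 'n"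
  assumes n: "n \<in> integer_lattice" "n \<noteq> 0"
  shows "(LINT x|lborel. indicator unit_cube x * cos (2 * pi * (n \<bullet> x))) = 0"
proof -
  obtain i where i: "n $ i \<noteq> 0" using n by (auto simp: vec_eq_iff)
  define v :: "real ^ 'n" where "v = (1 / (2 * n $ i)) *\<^sub>R axis i 1"
  have nv: "n \<bullet> v = 1 / 2" using i by (simp add: v_def inner_axis)
  \<comment> \<open>Translation invariance is available for nonnegative functions; adding the
    constant 1 makes the integrand nonnegative. The cases \<open>c = 1\<close> and
    \<open>c = -1\<close> are compared below.\<close>
  have int: "(\<integral>\<^sup>+x\<in>unit_cube. ennreal (1 + c * cos (2 * pi * (n \<bullet> x))) \<partial>lborel) =
      ennreal (1 + c * (LINT x|lborel. indicator unit_cube x * cos (2 * pi * (n \<bullet> x))))" (is "?l = _")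
    if "\<bar>c\<bar> \<le> 1" for c :: real
  proof -
    have nonneg: "1 + c * cos t \<ge> 0" for t
    proof -
      have "\<bar>c * cos t\<bar> \<le> 1" using that by (simp add: abs_mult mult_le_one)
      then show ?thesis by linarith
    qed
    have "?l = (\<integral>\<^sup>+x. ennreal (indicator unit_cube x + c * (indicator unit_cube x * cos (2 * pi * (n \<bullet> x)))) \<partial>lborel)"
      by (intro nn_integral_cong) (auto simp: indicator_def)
    also have "\<dots> = ennreal (LINT x|lborel. indicator unit_cube x + c * (indicator unit_cube x * cos (2 * pi * (n \<bullet> x))))"
    proof (rule nn_integral_eq_integral)
      show "integrable lborel (\<lambda>x. indicator unit_cube x + c * (indicator unit_cube x * cos (2 * pi * (n \<bullet> x))))"
        by (intro Bochner_Integration.integrable_add integrable_mult_right set_integrable_unit_cube_cos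
              integrable_unit_cube)
    qed (use nonneg in \<open>auto simp: indicator_def\<close>)
    also have "(LINT x|lborel. indicator unit_cube x + c * (indicator unit_cube x * cos (2 * pi * (n \<bullet> x))))
      = 1 + c * (LINT x|lborel. indicator unit_cube x * cos (2 * pi * (n \<bullet> x)))"
      using Bochner_Integration.integral_add[OF integrable_unit_cube
        integrable_mult_right[OF set_integrable_unit_cube_cos[of n], of c]]
      by (simp add: emeasure_unit_cube measure_def)
    finally show ?thesis .
  qed
  let ?I = "LINT x|lborel. indicator unit_cube x * cos (2 * pi * (n \<bullet> x))"
  have "\<bar>?I\<bar> \<le> (LINT x|lborel. norm (indicator unit_cube x * cos (2 * pi * (n \<bullet> x))))"
    unfolding real_norm_def[symmetric] by (rule integral_norm_bound)
  also have "\<dots> \<le> (LINT x|lborel. indicator (unit_cube :: (real ^ 'n) set) x)"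
    by (intro integral_mono integrable_norm set_integrable_unit_cube_cos integrable_unit_cube)
       (auto simp: indicator_def)
  also have "\<dots> = 1" by (simp add: measure_def emeasure_unit_cube)
  finally have I: "\<bar>?I\<bar> \<le> 1" .
  have "ennreal (1 + ?I) = (\<integral>\<^sup>+x\<in>unit_cube. ennreal (1 + cos (2 * pi * (n \<bullet> x))) \<partial>lborel)"
    using int[of 1] by simp
  also have "\<dots> = (\<integral>\<^sup>+x\<in>unit_cube. ennreal (1 + cos (2 * pi * (n \<bullet> (v + x)))) \<partial>lborel)"
    using n by (intro nn_integral_unit_cube_periodic_shift[symmetric]) (auto simp: cos_periodic_lattice)
  also have "\<dots> = (\<integral>\<^sup>+x\<in>unit_cube. ennreal (1 + (-1) * cos (2 * pi * (n \<bullet> x))) \<partial>lborel)"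
  proof -
    have "2 * pi * (n \<bullet> (v + x)) = 2 * pi * (n \<bullet> x) + pi" for x
      by (simp add: inner_add_right nv distrib_left)
    then show ?thesis by simp
  qed
  also have "\<dots> = ennreal (1 - ?I)" using int[of "-1"] by simp
  finally have "1 + ?I = 1 - ?I" using I by (subst (asm) ennreal_inj) (auto simp: abs_le_iff)
  then show ?thesis by simp
qed

section \<open>Counting lattice points in balls\<close>

text \<open>The modulus covers negative dilations, which give the same set because the ball is
  symmetric.\<close>

definition lattice_count :: "real \<Rightarrow> real ^ 'n \<Rightarrow> nat" where
  "lattice_count r x = card {k \<in> integer_lattice. norm (k + x) \<le> \<bar>r\<bar>}"

lemma finite_lattice_count: "finite {k \<in> integer_lattice :: (real ^ 'n) set. norm (k + x) \<le> R}"
proof (rule finite_subset[OF _ finite_integer_lattice_bounded[of "R + norm x"]])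
  have "norm k \<le> R + norm x" if "norm (k + x) \<le> R" for k
    using norm_triangle_ineq4[of "k + x" x] that by simp
  then show "{k \<in> integer_lattice. norm (k + x) \<le> R} \<subseteq> {k \<in> integer_lattice. norm k \<le> R + norm x}"
    by auto
qed

lemma mem_dilate_translate_cball:
  "k \<in> dilate_translate r (cball 0 1) x \<longleftrightarrow> norm (k + x) \<le> \<bar>r\<bar>"
proof
  assume "k \<in> dilate_translate r (cball 0 1) x"
  then obtain y where "norm y \<le> 1" "k = r *\<^sub>R y - x" by (auto simp: dilate_translate_def)
  then show "norm (k + x) \<le> \<bar>r\<bar>" by (simp add: mult_left_le)
next
  assume le: "norm (k + x) \<le> \<bar>r\<bar>"
  show "k \<in> dilate_translate r (cball 0 1) x"
  proof (cases "r = 0")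
    case True
    then have "k = r *\<^sub>R 0 - x" using le by (simp add: eq_neg_iff_add_eq_0)
    then show ?thesis unfolding dilate_translate_def by (intro image_eqI[of _ _ 0]) auto
  next
    case False
    have "norm ((k + x) /\<^sub>R r) = norm (k + x) / \<bar>r\<bar>"
      by (simp add: divide_inverse mult.commute)
    then have "k = r *\<^sub>R ((k + x) /\<^sub>R r) - x" "(k + x) /\<^sub>R r \<in> cball 0 1"
      using le False by (auto simp del: norm_scaleR)
    then show ?thesis unfolding dilate_translate_def by (rule image_eqI)
  qed
qed

lemma discrepancy_cball:
  "discrepancy (cball 0 1 :: (real ^ 'n) set) r x =
     real (lattice_count r x) - \<bar>r\<bar> ^ CARD('n) * unit_ball_vol (real CARD('n))"
proof -
  have "(\<Sum>\<^sub>\<infinity>k\<in>integer_lattice. indicat_real (dilate_translate r (cball 0 1) x) k) =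
      (\<Sum>\<^sub>\<infinity>k\<in>{k \<in> integer_lattice. norm (k + x) \<le> \<bar>r\<bar>}. 1)"
    by (intro infsum_cong_neutral) (auto simp: mem_dilate_translate_cball indicator_def)
  also have "\<dots> = real (lattice_count r x)"
    using finite_lattice_count by (simp add: lattice_count_def)
  finally show ?thesis
    by (simp add: discrepancy_def content_cball)
qed

lemma ennreal_lattice_count:
  "ennreal (real (lattice_count r x)) =
     (\<integral>\<^sup>+k. indicator (cball 0 \<bar>r\<bar>) (k + x) \<partial>count_space integer_lattice)"
proof -
  let ?S = "{k \<in> integer_lattice. norm (k + x) \<le> \<bar>r\<bar>}"
  have "(\<integral>\<^sup>+k. indicator (cball 0 \<bar>r\<bar>) (k + x) \<partial>count_space integer_lattice) =
      (\<integral>\<^sup>+k. indicator ?S k \<partial>count_space integer_lattice)"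
    by (intro nn_integral_cong) (auto simp: indicator_def)
  also have "\<dots> = emeasure (count_space integer_lattice) ?S"
    by (subst nn_integral_indicator) auto
  also have "\<dots> = of_nat (card ?S)"
    using finite_lattice_count by (subst emeasure_count_space_finite) auto
  finally show ?thesis by (simp add: lattice_count_def ennreal_of_nat_eq_real_of_nat)
qed

text \<open>Joint measurability is what Tonelli's theorem in \<open>x\<close> and \<open>r\<close>
  will require. It comes from writing the count as an integral of indicators over the countable
  lattice.\<close>

lemma borel_measurable_discrepancy:
  "(\<lambda>(x, r). discrepancy (cball 0 1 :: (real ^ 'n) set) r x) \<in> borel_measurable (borel \<Otimes>\<^sub>M borel)"
proof -
  interpret sigma_finite_measure "count_space (integer_lattice :: (real ^ 'n) set)"
    by (intro sigma_finite_measure_count_space_countable countable_integer_lattice)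
  have "(\<lambda>(k, p). indicator (cball 0 \<bar>snd p\<bar>) (k + fst p) :: ennreal) \<in>
      borel_measurable (count_space (integer_lattice :: (real ^ 'n) set) \<Otimes>\<^sub>M (borel \<Otimes>\<^sub>M borel))"
  proof (intro measurable_pair_measure_countable1 countable_integer_lattice)
    fix k :: "real ^ 'n"
    have "(\<lambda>p. indicator {p. norm (k + fst p) \<le> \<bar>snd p\<bar>} p :: ennreal) \<in> borel_measurable (borel \<Otimes>\<^sub>M borel)"
      by measurable
    also have "(\<lambda>p. indicator {p. norm (k + fst p) \<le> \<bar>snd p\<bar>} p :: ennreal) =
        (\<lambda>p. indicator (cball 0 \<bar>snd p\<bar>) (k + fst p))"
      by (auto simp: indicator_def)
    finally show "(\<lambda>p. case (k, p) of (k, p) \<Rightarrow> (indicator (cball 0 \<bar>snd p\<bar>) (k + fst p) :: ennreal))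
        \<in> borel_measurable (borel \<Otimes>\<^sub>M borel)"
      by simp
  qed
  then have "(\<lambda>(p, k). indicator (cball 0 \<bar>snd p\<bar>) (k + fst p) :: ennreal) \<in>
      borel_measurable ((borel \<Otimes>\<^sub>M borel) \<Otimes>\<^sub>M count_space (integer_lattice :: (real ^ 'n) set))"
    by (subst measurable_pair_swap_iff) (simp add: split_beta)
  then have "(\<lambda>p. \<integral>\<^sup>+k. indicator (cball 0 \<bar>snd p\<bar>) (k + fst p) \<partial>count_space (integer_lattice :: (real ^ 'n) set))
      \<in> borel_measurable (borel \<Otimes>\<^sub>M borel)"
    by (rule borel_measurable_nn_integral)
  then have "(\<lambda>p. ennreal (real (lattice_count (snd p) (fst p :: real ^ 'n)))) \<in> borel_measurable (borel \<Otimes>\<^sub>M borel)"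
    by (simp only: ennreal_lattice_count)
  then have [measurable]: "(\<lambda>p. real (lattice_count (snd p) (fst p :: real ^ 'n))) \<in> borel_measurable (borel \<Otimes>\<^sub>M borel)"
    using borel_measurable_enn2real by fastforce
  show ?thesis unfolding discrepancy_cball split_beta by measurable
qed

section \<open>Fejer kernels and the smoothed discrepancy\<close>

text \<open>The double sum is the squared modulus of the exponential sum over \<open>M\<close>,
  written with real terms; for a box this is the product Fejer kernel.\<close>

definition fejer_kernel :: "(real ^ 'n) set \<Rightarrow> real ^ 'n \<Rightarrow> real" where
  "fejer_kernel M x = (\<Sum>m\<in>M. \<Sum>m'\<in>M. cos (2 * pi * ((m - m') \<bullet> x))) / real (card M)"

text \<open>The Fourier coefficient of the indicator of a ball, which is real by symmetry.\<close>

definition ball_cosine_integral :: "real ^ 'n \<Rightarrow> real \<Rightarrow> real" where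
  "ball_cosine_integral n r = (LINT y|lborel. indicator (cball 0 r) y * cos (2 * pi * (n \<bullet> y)))"

text \<open>The diagonal pairs are left out because together they give the volume of the ball, which
  the discrepancy subtracts.\<close>

definition smoothed_discrepancy :: "(real ^ 'n) set \<Rightarrow> real \<Rightarrow> real" where
  "smoothed_discrepancy M r =
     (\<Sum>m\<in>M. \<Sum>m'\<in>M - {m}. ball_cosine_integral (m - m') r) / real (card M)"

lemma fejer_kernel_measurable [measurable]: "fejer_kernel M \<in> borel_measurable borel"
  unfolding fejer_kernel_def[abs_def] by measurable

lemma fejer_kernel_nonneg: "fejer_kernel M x \<ge> 0"
proof -
  have "(\<Sum>m\<in>M. \<Sum>m'\<in>M. cos (2 * pi * ((m - m') \<bullet> x))) =
      (\<Sum>m\<in>M. cos (2 * pi * (m \<bullet> x)))\<^sup>2 + (\<Sum>m\<in>M. sin (2 * pi * (m \<bullet> x)))\<^sup>2"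
    by (simp add: power2_eq_square sum_product inner_diff_left right_diff_distrib cos_diff sum.distrib)
  then show ?thesis by (simp add: fejer_kernel_def)
qed

lemma fejer_kernel_le: "fejer_kernel M x \<le> real (card M)"
proof -
  have "(\<Sum>m\<in>M. \<Sum>m'\<in>M. cos (2 * pi * ((m - m') \<bullet> x))) \<le> (\<Sum>m\<in>M. \<Sum>m'\<in>M. 1)"
    by (intro sum_mono) simp
  then show ?thesis by (cases "card M = 0") (auto simp: fejer_kernel_def field_simps)
qed

lemma fejer_kernel_periodic:
  assumes "M \<subseteq> integer_lattice" "k \<in> integer_lattice"
  shows "fejer_kernel M (k + x) = fejer_kernel M x"
  unfolding fejer_kernel_def using assms
  by (intro arg_cong2[where f = "(/)"] sum.cong refl cos_periodic_lattice integer_lattice_diff) auto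

text \<open>Each of the \<open>card M\<close> diagonal pairs contributes the measure of
  \<open>S\<close>. The set \<open>S\<close> will be the unit cube or a ball.\<close>

lemma integral_fejer_kernel_indicator:
  fixes M :: "(real ^ 'n) set"
  assumes M: "finite M" "M \<noteq> {}" and S: "S \<in> sets lborel" "emeasure lborel S < \<infinity>"
  shows "integrable lborel (\<lambda>x. indicator S x * fejer_kernel M x)"
    and "(LINT x|lborel. indicator S x * fejer_kernel M x) = measure lborel S +
      (\<Sum>m\<in>M. \<Sum>m'\<in>M - {m}. LINT x|lborel. indicator S x * cos (2 * pi * ((m - m') \<bullet> x))) / real (card M)"
proof -
  have S_int: "integrable lborel (indicator S :: real ^ 'n \<Rightarrow> real)" using S by simp
  have int: "integrable lborel (\<lambda>x. indicator S x * cos (2 * pi * (n \<bullet> x)))" for n :: "real ^ 'n"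
    by (rule Bochner_Integration.integrable_bound[OF S_int])
       (use S in \<open>auto simp: indicator_def intro!: borel_measurable_times borel_measurable_indicator\<close>)
  have eq: "(\<lambda>x. indicator S x * fejer_kernel M x) =
      (\<lambda>x. (\<Sum>m\<in>M. \<Sum>m'\<in>M. indicator S x * cos (2 * pi * ((m - m') \<bullet> x))) / real (card M))"
    by (simp add: fejer_kernel_def sum_distrib_left)
  show "integrable lborel (\<lambda>x. indicator S x * fejer_kernel M x)"
    unfolding eq by (intro integrable_divide Bochner_Integration.integrable_sum int)
  have "(LINT x|lborel. indicator S x * fejer_kernel M x) =
      (\<Sum>m\<in>M. \<Sum>m'\<in>M. LINT x|lborel. indicator S x * cos (2 * pi * ((m - m') \<bullet> x))) / real (card M)"
    unfolding eq using int by (simp add: Bochner_Integration.integral_sum)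
  also have "(\<Sum>m\<in>M. \<Sum>m'\<in>M. LINT x|lborel. indicator S x * cos (2 * pi * ((m - m') \<bullet> x))) =
      (\<Sum>m\<in>M. measure lborel S +
        (\<Sum>m'\<in>M - {m}. LINT x|lborel. indicator S x * cos (2 * pi * ((m - m') \<bullet> x))))"
    using M S by (intro sum.cong refl) (simp add: sum.remove)
  finally show "(LINT x|lborel. indicator S x * fejer_kernel M x) = measure lborel S +
      (\<Sum>m\<in>M. \<Sum>m'\<in>M - {m}. LINT x|lborel. indicator S x * cos (2 * pi * ((m - m') \<bullet> x))) / real (card M)"
    using M by (simp add: sum.distrib field_simps)
qed

lemma nn_integral_fejer_kernel:
  assumes M: "finite M" "M \<noteq> {}" "M \<subseteq> integer_lattice"
  shows "(\<integral>\<^sup>+x\<in>unit_cube. ennreal (fejer_kernel M x) \<partial>lborel) = 1"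
proof -
  have "(\<integral>\<^sup>+x\<in>unit_cube. ennreal (fejer_kernel M x) \<partial>lborel) =
      (\<integral>\<^sup>+x. ennreal (indicator unit_cube x * fejer_kernel M x) \<partial>lborel)"
    by (intro nn_integral_cong) (auto simp: indicator_def)
  also have "\<dots> = ennreal (LINT x|lborel. indicator unit_cube x * fejer_kernel M x)"
    using M by (intro nn_integral_eq_integral integral_fejer_kernel_indicator)
      (auto simp: emeasure_unit_cube fejer_kernel_nonneg)
  also have "(LINT x|lborel. indicator unit_cube x * fejer_kernel M x) = 1"
  proof (subst integral_fejer_kernel_indicator(2))
    have "(\<Sum>m\<in>M. \<Sum>m'\<in>M - {m}. LINT x|lborel. indicator unit_cube x * cos (2 * pi * ((m - m') \<bullet> x))) = 0"
      using M by (intro sum.neutral ballI integral_unit_cube_cos integer_lattice_diff) auto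
    then show "measure lborel unit_cube +
      (\<Sum>m\<in>M. \<Sum>m'\<in>M - {m}. LINT x|lborel. indicator unit_cube x * cos (2 * pi * ((m - m') \<bullet> x))) / real (card M) = 1"
      by (simp add: measure_def emeasure_unit_cube)
  qed (use M in \<open>auto simp: emeasure_unit_cube\<close>)
  finally show ?thesis by simp
qed

text \<open>By periodicity the kernel can be moved inside the sum over the lattice; unfolding then
  gives the integral of the kernel over the whole ball. The second claim allows the first to be read
  as an equation between real numbers.\<close>

lemma nn_integral_fejer_kernel_lattice_count:
  fixes M :: "(real ^ 'n) set"
  assumes M: "finite M" "M \<noteq> {}" "M \<subseteq> integer_lattice"
  shows "(\<integral>\<^sup>+x\<in>unit_cube. ennreal (fejer_kernel M x * real (lattice_count r x)) \<partial>lborel) =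
    ennreal (\<bar>r\<bar> ^ CARD('n) * unit_ball_vol (real CARD('n)) + smoothed_discrepancy M \<bar>r\<bar>)"
    and "0 \<le> \<bar>r\<bar> ^ CARD('n) * unit_ball_vol (real CARD('n)) + smoothed_discrepancy M \<bar>r\<bar>"
proof -
  let ?B = "cball 0 \<bar>r\<bar> :: (real ^ 'n) set"
  have finB: "emeasure lborel ?B < \<infinity>" by (simp add: emeasure_cball ennreal_mult_less_top)
  have "(\<integral>\<^sup>+x\<in>unit_cube. ennreal (fejer_kernel M x * real (lattice_count r x)) \<partial>lborel) =
      (\<integral>\<^sup>+x\<in>unit_cube. (\<integral>\<^sup>+k. ennreal (fejer_kernel M (k + x)) * indicator ?B (k + x)
          \<partial>count_space integer_lattice) \<partial>lborel)"
  proof (intro nn_integral_cong arg_cong2[where f = "(*)"] refl)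
    fix x
    have "ennreal (fejer_kernel M x * real (lattice_count r x)) =
        (\<integral>\<^sup>+k. ennreal (fejer_kernel M x) * indicator ?B (k + x) \<partial>count_space integer_lattice)"
      by (subst nn_integral_cmult) (auto simp: ennreal_mult' fejer_kernel_nonneg ennreal_lattice_count)
    also have "\<dots> = (\<integral>\<^sup>+k. ennreal (fejer_kernel M (k + x)) * indicator ?B (k + x) \<partial>count_space integer_lattice)"
      using M by (intro nn_integral_cong) (simp add: fejer_kernel_periodic)
    finally show "ennreal (fejer_kernel M x * real (lattice_count r x)) = \<dots>" .
  qed
  also have "\<dots> = (\<integral>\<^sup>+x. ennreal (fejer_kernel M x) * indicator ?B x \<partial>lborel)"
    by (subst nn_integral_unfold_lattice) auto
  also have "\<dots> = (\<integral>\<^sup>+x. ennreal (indicator ?B x * fejer_kernel M x) \<partial>lborel)"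
    by (intro nn_integral_cong) (auto simp: indicator_def)
  also have "\<dots> = ennreal (LINT x|lborel. indicator ?B x * fejer_kernel M x)"
    using M finB by (intro nn_integral_eq_integral integral_fejer_kernel_indicator) (auto simp: fejer_kernel_nonneg)
  also have eq: "(LINT x|lborel. indicator ?B x * fejer_kernel M x) =
      \<bar>r\<bar> ^ CARD('n) * unit_ball_vol (real CARD('n)) + smoothed_discrepancy M \<bar>r\<bar>"
    using M finB by (subst integral_fejer_kernel_indicator(2))
      (auto simp: content_cball smoothed_discrepancy_def ball_cosine_integral_def)
  finally show "(\<integral>\<^sup>+x\<in>unit_cube. ennreal (fejer_kernel M x * real (lattice_count r x)) \<partial>lborel) =
    ennreal (\<bar>r\<bar> ^ CARD('n) * unit_ball_vol (real CARD('n)) + smoothed_discrepancy M \<bar>r\<bar>)" .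
  show "0 \<le> \<bar>r\<bar> ^ CARD('n) * unit_ball_vol (real CARD('n)) + smoothed_discrepancy M \<bar>r\<bar>"
    unfolding eq[symmetric] by (intro integral_nonneg_AE) (auto simp: fejer_kernel_nonneg)
qed

text \<open>The kernel is the density of a probability measure \<open>Q\<close> on the torus, under
  which the discrepancy has expectation \<open>smoothed_discrepancy M \<bar>r\<bar>\<close>. The
  inequality says that its variance is nonnegative.\<close>

lemma smoothed_discrepancy_square_le:
  fixes M :: "(real ^ 'n) set"
  assumes M: "finite M" "M \<noteq> {}" "M \<subseteq> integer_lattice"
  shows "ennreal ((smoothed_discrepancy M \<bar>r\<bar>)\<^sup>2) \<le>
    (\<integral>\<^sup>+x\<in>unit_cube. ennreal (fejer_kernel M x * (discrepancy (cball 0 1) r x)\<^sup>2) \<partial>lborel)"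
proof -
  define Q where "Q = density lborel (\<lambda>x :: real ^ 'n. ennreal (fejer_kernel M x) * indicator unit_cube x)"
  have Q_nn: "(\<integral>\<^sup>+x. ennreal (f x) \<partial>Q) = (\<integral>\<^sup>+x\<in>unit_cube. ennreal (fejer_kernel M x * f x) \<partial>lborel)"
    if "f \<in> borel_measurable borel" for f :: "real ^ 'n \<Rightarrow> real"
    unfolding Q_def using that
    by (subst nn_integral_density)
       (auto intro!: nn_integral_cong simp: ennreal_mult'[OF fejer_kernel_nonneg] indicator_def)
  have "emeasure Q (space Q) = 1"
    unfolding Q_def using nn_integral_fejer_kernel[OF M] by (subst emeasure_density) auto
  then interpret Q: prob_space Q by (rule prob_spaceI)
  define D where "D = (\<lambda>x :: real ^ 'n. discrepancy (cball 0 1) r x)"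
  have "(\<lambda>x. (x, r)) \<in> borel \<rightarrow>\<^sub>M (borel :: (real ^ 'n) measure) \<Otimes>\<^sub>M (borel :: real measure)" by measurable
  from measurable_compose[OF this borel_measurable_discrepancy]
  have D [measurable]: "D \<in> borel_measurable borel" by (simp add: D_def)
  have count: "real (lattice_count r x) = D x + \<bar>r\<bar> ^ CARD('n) * unit_ball_vol (real CARD('n))" for x
    by (simp add: D_def discrepancy_cball)
  have [measurable]: "(\<lambda>x :: real ^ 'n. real (lattice_count r x)) \<in> borel_measurable borel"
    unfolding count by measurable
  show ?thesis
  proof (cases "(\<integral>\<^sup>+x. ennreal ((D x)\<^sup>2) \<partial>Q) < \<infinity>")
    case True
    then have int2: "integrable Q (\<lambda>x. (D x)\<^sup>2)"
      by (intro integrableI_bounded) (auto simp: Q_def)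
    have int: "integrable Q D"
      by (intro Q.square_integrable_imp_integrable[OF _ int2]) (simp add: Q_def)
    then have int_count: "integrable Q (\<lambda>x. real (lattice_count r x))" by (simp add: count)
    \<comment> \<open>The discrepancy changes sign, so its expectation is obtained from that of the
      nonnegative count by subtracting the volume.\<close>
    have "ennreal (LINT x|Q. real (lattice_count r x)) = (\<integral>\<^sup>+x. ennreal (real (lattice_count r x)) \<partial>Q)"
      by (rule nn_integral_eq_integral[OF int_count, symmetric]) simp
    also have "\<dots> = ennreal (\<bar>r\<bar> ^ CARD('n) * unit_ball_vol (real CARD('n)) + smoothed_discrepancy M \<bar>r\<bar>)"
      by (subst Q_nn) (auto simp: nn_integral_fejer_kernel_lattice_count[OF M])
    finally have "(LINT x|Q. real (lattice_count r x)) =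
        \<bar>r\<bar> ^ CARD('n) * unit_ball_vol (real CARD('n)) + smoothed_discrepancy M \<bar>r\<bar>"
      by (subst (asm) ennreal_inj) (auto intro!: nn_integral_fejer_kernel_lattice_count M integral_nonneg_AE)
    then have "Q.expectation D = smoothed_discrepancy M \<bar>r\<bar>"
      using int by (simp add: count Q.prob_space)
    then have "(smoothed_discrepancy M \<bar>r\<bar>)\<^sup>2 \<le> Q.expectation (\<lambda>x. (D x)\<^sup>2)"
      using Q.variance_eq[OF int int2] Q.variance_positive[of D] by simp
    then have "ennreal ((smoothed_discrepancy M \<bar>r\<bar>)\<^sup>2) \<le> ennreal (Q.expectation (\<lambda>x. (D x)\<^sup>2))"
      by (rule ennreal_leI)
    also have "\<dots> = (\<integral>\<^sup>+x. ennreal ((D x)\<^sup>2) \<partial>Q)"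
      using int2 by (intro nn_integral_eq_integral[symmetric]) auto
    finally show ?thesis by (subst (asm) Q_nn) (auto simp: D_def[symmetric])
  next
    case False
    then show ?thesis by (subst (asm) Q_nn) (auto simp: D_def[symmetric] not_less top_unique)
  qed
qed

section \<open>Lower bound for the mixed norm\<close>

lemma borel_measurable_ennpowr [measurable]: "(\<lambda>t. ennpowr t a) \<in> borel_measurable borel"
  unfolding ennpowr_def by measurable

lemma ennpowr_mono:
  assumes "s \<le> t" "a \<ge> 0"
  shows "ennpowr s a \<le> ennpowr t a"
proof (cases "t = \<infinity>")
  case False
  then have "enn2real s \<le> enn2real t" "s \<noteq> \<infinity>"
    using assms by (auto simp: enn2real_mono top.not_eq_extremum)
  then show ?thesis using False assms by (auto simp: ennpowr_def intro!: ennreal_leI powr_mono2)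
qed (simp add: ennpowr_def)

lemma ennpowr_ennreal: "x \<ge> 0 \<Longrightarrow> ennpowr (ennreal x) a = ennreal (x powr a)"
  by (simp add: ennpowr_def)

text \<open>Either \<open>t \<le> c\<close>, or the factor \<open>t powr (1 - q)\<close> in
  \<open>t = t powr (1 - q) * t powr q\<close> is at most its value at \<open>c\<close>. This affine
  bound takes the place of Jensen's inequality for the power \<open>q\<close> and also covers
  \<open>t = \<infinity>\<close>.\<close>

lemma le_affine_ennpowr:
  assumes "q \<ge> 1" "c > 0"
  shows "t \<le> ennreal c + ennreal (c powr (1 - q)) * ennpowr t q"
proof (cases "t = \<infinity>")
  case False
  then obtain s where s: "t = ennreal s" "s \<ge> 0" by (cases t) auto
  have "s \<le> c + c powr (1 - q) * s powr q"
  proof (cases "s \<le> c")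
    case False
    then have "s = s powr (1 - q) * s powr q"
      using assms by (simp flip: powr_add)
    also have "\<dots> \<le> c powr (1 - q) * s powr q"
      using assms False by (intro mult_right_mono powr_mono2') auto
    finally show ?thesis using assms by simp
  qed (use assms in \<open>auto intro: add_increasing2\<close>)
  then have "ennreal s \<le> ennreal (c + c powr (1 - q) * s powr q)" by (rule ennreal_leI)
  then show ?thesis using assms s by (simp add: ennpowr_ennreal ennreal_mult')
qed (use assms in \<open>simp add: ennpowr_def ennreal_mult_top\<close>)

text \<open>Averaging over \<open>x\<close> against the kernel and exchanging integrals bounds
  \<open>m\<close> by the kernel average of the inner integral \<open>F\<close>. The affine bound
  for \<open>F\<close> brings in its power \<open>q = p / 2\<close>, and the kernel is at most
  \<open>card M\<close>.\<close>

lemma mixed_norm_lower_bound: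
  fixes M :: "(real ^ 'n) set"
  assumes M: "finite M" "M \<noteq> {}" "M \<subseteq> integer_lattice"
    and \<nu>: "sigma_finite_measure \<nu>" and sets_\<nu> [measurable_cong]: "sets \<nu> = sets borel"
    and p: "p \<ge> 2" and m: "m > 0"
    and le: "ennreal m \<le> (\<integral>\<^sup>+r. ennreal ((\<bar>r\<bar> powr (- (real CARD('n) - 1) / 2)
                 * smoothed_discrepancy M \<bar>r\<bar>)\<^sup>2) \<partial>\<nu>)"
  shows "ennreal (((m / 2) powr (p / 2) / real (card M)) powr (1 / p)) \<le>
           mixed_norm p (cball 0 1 :: (real ^ 'n) set) \<nu>"
proof -
  interpret \<nu>: sigma_finite_measure \<nu> by fact
  interpret pair_sigma_finite "lborel :: (real ^ 'n) measure" \<nu> ..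
  define \<rho> where "\<rho> r = \<bar>r\<bar> powr (- (real CARD('n) - 1) / 2)" for r :: real
  define D where "D x r = discrepancy (cball 0 1 :: (real ^ 'n) set) r x" for x r
  have [measurable]: "(\<lambda>(x, r). D x r) \<in> borel_measurable (borel \<Otimes>\<^sub>M borel)"
    unfolding D_def by (rule borel_measurable_discrepancy)
  have [measurable]: "\<rho> \<in> borel_measurable borel"
    unfolding \<rho>_def[abs_def] by measurable
  define F where "F x = (\<integral>\<^sup>+r. ennreal (\<bar>\<rho> r * D x r\<bar> ^ 2) \<partial>\<nu>)" for x
  have F [measurable]: "F \<in> borel_measurable borel"
    unfolding F_def[abs_def] by measurable
  define q where "q = p / 2"
  define X where "X = (\<integral>\<^sup>+x\<in>unit_cube. ennpowr (F x) q \<partial>lborel)"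
  \<comment> \<open>The kernel has mass one, so the constant \<open>l\<close> of the affine bound
    uses up exactly half of \<open>m\<close>; the other half is left for the integral
    \<open>X\<close>.\<close>
  define l where "l = m / 2"
  have q: "q \<ge> 1" and l: "l > 0" using p m by (auto simp: q_def l_def)
  have c: "real (card M) > 0" using M by (simp add: card_gt_0_iff)
  have "ennreal m \<le> (\<integral>\<^sup>+r. ennreal ((\<rho> r)\<^sup>2) * ennreal ((smoothed_discrepancy M \<bar>r\<bar>)\<^sup>2) \<partial>\<nu>)"
    using le by (simp add: \<rho>_def power_mult_distrib ennreal_mult')
  also have "\<dots> \<le> (\<integral>\<^sup>+r. ennreal ((\<rho> r)\<^sup>2) *
      (\<integral>\<^sup>+x\<in>unit_cube. ennreal (fejer_kernel M x * (D x r)\<^sup>2) \<partial>lborel) \<partial>\<nu>)"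
    unfolding D_def by (intro nn_integral_mono mult_left_mono smoothed_discrepancy_square_le M) simp
  also have "\<dots> = (\<integral>\<^sup>+r. \<integral>\<^sup>+x. ennreal (fejer_kernel M x) * indicator unit_cube x *
      ennreal (\<bar>\<rho> r * D x r\<bar> ^ 2) \<partial>lborel \<partial>\<nu>)"
  proof (rule nn_integral_cong)
    fix r
    have "ennreal ((\<rho> r)\<^sup>2) * (\<integral>\<^sup>+x\<in>unit_cube. ennreal (fejer_kernel M x * (D x r)\<^sup>2) \<partial>lborel)
      = (\<integral>\<^sup>+x. ennreal ((\<rho> r)\<^sup>2) * (ennreal (fejer_kernel M x * (D x r)\<^sup>2) * indicator unit_cube x) \<partial>lborel)"
      by (subst nn_integral_cmult) auto
    also have "\<dots> = (\<integral>\<^sup>+x. ennreal (fejer_kernel M x) * indicator unit_cube x *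
      ennreal (\<bar>\<rho> r * D x r\<bar> ^ 2) \<partial>lborel)"
      by (intro nn_integral_cong)
         (auto simp: indicator_def fejer_kernel_nonneg power_mult_distrib mult_ac simp flip: ennreal_mult')
    finally show "ennreal ((\<rho> r)\<^sup>2) * (\<integral>\<^sup>+x\<in>unit_cube. ennreal (fejer_kernel M x * (D x r)\<^sup>2) \<partial>lborel)
      = \<dots>" .
  qed
  also have "\<dots> = (\<integral>\<^sup>+x. \<integral>\<^sup>+r. ennreal (fejer_kernel M x) * indicator unit_cube x *
      ennreal (\<bar>\<rho> r * D x r\<bar> ^ 2) \<partial>\<nu> \<partial>lborel)"
    by (rule Fubini') measurable
  also have "\<dots> = (\<integral>\<^sup>+x. ennreal (fejer_kernel M x) * indicator unit_cube x * F x \<partial>lborel)"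
    unfolding F_def by (intro nn_integral_cong nn_integral_cmult) measurable
  \<comment> \<open>The kernel is kept in the constant term, where its mass counts, and replaced by
    its maximum in front of the power.\<close>
  also have "\<dots> \<le> (\<integral>\<^sup>+x. ennreal l * (ennreal (fejer_kernel M x) * indicator unit_cube x) +
      ennreal (l powr (1 - q) * real (card M)) * (ennpowr (F x) q * indicator unit_cube x) \<partial>lborel)"
  proof (rule nn_integral_mono)
    fix x
    let ?K = "ennreal (fejer_kernel M x) * indicator unit_cube x"
    have "?K * F x \<le> ?K * (ennreal l + ennreal (l powr (1 - q)) * ennpowr (F x) q)"
      using q l by (intro mult_left_mono le_affine_ennpowr) auto
    also have "\<dots> = ennreal l * ?K + ?K * (ennreal (l powr (1 - q)) * ennpowr (F x) q)"
      by (simp add: distrib_left mult.commute)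
    also have "\<dots> \<le> ennreal l * ?K + (ennreal (real (card M)) * indicator unit_cube x) *
        (ennreal (l powr (1 - q)) * ennpowr (F x) q)"
      by (intro add_left_mono mult_right_mono ennreal_leI fejer_kernel_le) auto
    finally show "?K * F x \<le> ennreal l * ?K +
        ennreal (l powr (1 - q) * real (card M)) * (ennpowr (F x) q * indicator unit_cube x)"
      by (simp add: ennreal_mult' mult_ac)
  qed
  also have "\<dots> = ennreal l + ennreal (l powr (1 - q) * real (card M)) * X"
    unfolding X_def using nn_integral_fejer_kernel[OF M]
    by (subst nn_integral_add; (subst nn_integral_cmult)?) (auto simp: nn_integral_cmult)
  finally have main: "ennreal m \<le> ennreal l + ennreal (l powr (1 - q) * real (card M)) * X" .
  have "ennreal (l powr q / real (card M)) \<le> X"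
  proof (cases "X = \<infinity>")
    case False
    then obtain y where y: "X = ennreal y" "y \<ge> 0" by (cases X) auto
    have "ennreal m \<le> ennreal (l + l powr (1 - q) * real (card M) * y)"
      using main y l by (simp add: ennreal_mult' ennreal_plus)
    then have "m \<le> l + l powr (1 - q) * real (card M) * y"
      using y l by (subst (asm) ennreal_le_iff) auto
    then have "l \<le> l powr (1 - q) * (real (card M) * y)" by (simp add: l_def mult_ac)
    then have "l powr (q - 1) * l \<le> l powr (q - 1) * (l powr (1 - q) * (real (card M) * y))"
      by (intro mult_left_mono) auto
    also have "\<dots> = real (card M) * y"
      using l by (simp add: mult.assoc[symmetric] flip: powr_add)
    also have "l powr (q - 1) * l = l powr q" using l by (simp add: powr_diff)
    finally show ?thesis using y c by (simp add: field_simps)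
  qed simp
  then have "ennpowr (ennreal (l powr q / real (card M))) (1 / p) \<le> ennpowr X (1 / p)"
    using p by (intro ennpowr_mono) auto
  then show ?thesis
    by (simp add: ennpowr_ennreal mixed_norm_def X_def F_def D_def \<rho>_def q_def l_def)
qed

section \<open>Asymptotics of the smoothed discrepancy\<close>

lemma ball_cosine_integral_eq:
  fixes n :: "real ^ 'n"
  assumes r: "r > 0"
  shows "ball_cosine_integral n r = r ^ CARD('n) * (unit_ball_vol (real (CARD('n) - 1)) *
           slice_transform (CARD('n) - 1) (2 * pi * norm n * r))"
proof -
  have "ball_cosine_integral n r = (LINT y|density (distr lborel borel (\<lambda>x. 0 + r *\<^sub>R x))
      (\<lambda>_. ennreal (\<bar>r\<bar> ^ DIM(real ^ 'n))). indicator (cball 0 r) y * cos (2 * pi * (n \<bullet> y)))"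
    unfolding ball_cosine_integral_def using r by (subst lborel_affine[of r 0]) (auto simp: ennreal_power)
  also have "\<dots> = r ^ CARD('n) * (LINT y|lborel. indicator (cball 0 r) (r *\<^sub>R y) * cos (2 * pi * (n \<bullet> (r *\<^sub>R y))))"
    using r by (subst integral_density) (auto simp: integral_distr)
  also have "(LINT y|lborel. indicator (cball 0 r) (r *\<^sub>R y) * cos (2 * pi * (n \<bullet> (r *\<^sub>R y)))) =
      (LINT y|lborel. indicator (cball 0 1) y * cos (((2 * pi * r) *\<^sub>R n) \<bullet> y))"
    using r by (intro Bochner_Integration.integral_cong refl) (auto simp: indicator_def mult_ac)
  also have "\<dots> = unit_ball_vol (real (CARD('n) - 1)) * slice_transform (CARD('n) - 1) (2 * pi * norm n * r)"
    using r by (subst integral_cball_cos_inner) (simp add: mult_ac)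
  finally show ?thesis .
qed

text \<open>With \<open>d\<close> the dimension, scaling gives a factor \<open>r ^ d\<close>, which
  with the weight makes \<open>r powr ((d + 1) / 2)\<close>. This is the power for which the slice
  transform of index \<open>d - 1\<close> approaches a wave; passing from \<open>r\<close> to
  \<open>l * r\<close> costs the power of \<open>l\<close>.\<close>

lemma ball_cosine_integral_asymptotics:
  fixes n :: "real ^ 'n"
  assumes \<gamma>: "((\<lambda>s. s powr (real (CARD('n) - 1 + 2) / 2) * slice_transform (CARD('n) - 1) s
      - Re (\<gamma> * cis s)) \<longlongrightarrow> 0) at_top"
    and n: "n \<noteq> 0"
  defines "l \<equiv> 2 * pi * norm n"
  shows "((\<lambda>r. r powr (- (real CARD('n) - 1) / 2) * ball_cosine_integral n r -
    unit_ball_vol (real (CARD('n) - 1)) * l powr (- (real CARD('n) + 1) / 2) * Re (\<gamma> * cis (l * r)))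
      \<longlongrightarrow> 0) at_top"
proof -
  define \<alpha> where "\<alpha> = (real CARD('n) + 1) / 2"
  have neg: "- (real CARD('n) + 1) / 2 = - \<alpha>" by (simp add: \<alpha>_def field_simps)
  have \<alpha>: "\<alpha> = real (CARD('n) - 1 + 2) / 2" by (simp add: \<alpha>_def of_nat_diff Suc_leI)
  define c where "c = unit_ball_vol (real (CARD('n) - 1))"
  have l: "l > 0" using n by (simp add: l_def)
  have "filterlim (\<lambda>r. l * r) at_top at_top"
    using l by (intro filterlim_tendsto_pos_mult_at_top[OF tendsto_const] filterlim_ident)
  with \<gamma> have "((\<lambda>r. (l * r) powr \<alpha> * slice_transform (CARD('n) - 1) (l * r)
      - Re (\<gamma> * cis (l * r))) \<longlongrightarrow> 0) at_top"
    unfolding \<alpha> by (rule filterlim_compose)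
  then have "((\<lambda>r. c * l powr (- \<alpha>) * ((l * r) powr \<alpha> * slice_transform (CARD('n) - 1) (l * r)
      - Re (\<gamma> * cis (l * r)))) \<longlongrightarrow> c * l powr (- \<alpha>) * 0) at_top"
    by (intro tendsto_intros)
  moreover have "\<forall>\<^sub>F r in at_top. c * l powr (- \<alpha>) * ((l * r) powr \<alpha> * slice_transform (CARD('n) - 1) (l * r)
      - Re (\<gamma> * cis (l * r))) = r powr (- (real CARD('n) - 1) / 2) * ball_cosine_integral n r -
    c * l powr (- \<alpha>) * Re (\<gamma> * cis (l * r))"
    using eventually_gt_at_top[of 0]
  proof eventually_elim
    case (elim r)
    have "r powr (- (real CARD('n) - 1) / 2) * r ^ CARD('n) = r powr (- (real CARD('n) - 1) / 2 + real CARD('n))"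
      using elim by (simp add: powr_add powr_realpow)
    also have "- (real CARD('n) - 1) / 2 + real CARD('n) = \<alpha>" by (simp add: \<alpha>_def field_simps)
    finally have "r powr (- (real CARD('n) - 1) / 2) * ball_cosine_integral n r =
        c * r powr \<alpha> * slice_transform (CARD('n) - 1) (l * r)"
      unfolding ball_cosine_integral_eq[OF elim] by (simp add: c_def l_def mult_ac)
    moreover have "l powr (- \<alpha>) * (l * r) powr \<alpha> = r powr \<alpha>"
      using elim l by (simp add: powr_mult powr_minus field_simps)
    ultimately show ?case by (simp add: right_diff_distrib mult_ac)
  qed
  ultimately show ?thesis
    unfolding c_def[symmetric] neg by (simp add: Lim_transform_eventually)
qed

section \<open>The lattice box and its distances\<close>

definition lattice_box :: "nat \<Rightarrow> (real ^ 'n) set" where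
  "lattice_box N = {k. \<forall>i. k $ i \<in> real ` {..<N}}"

lemma lattice_box_subset: "lattice_box N \<subseteq> integer_lattice"
proof -
  have "real ` {..<N} \<subseteq> \<int>" by auto
  then show ?thesis unfolding lattice_box_def integer_lattice_def by blast
qed

lemma lattice_box_eq: "lattice_box N = vec_lambda ` (PiE UNIV (\<lambda>_. real ` {..<N}))"
proof (intro equalityI subsetI)
  fix k :: "real ^ 'n" assume "k \<in> lattice_box N"
  then have "(\<lambda>i. k $ i) \<in> PiE UNIV (\<lambda>_. real ` {..<N})" by (auto simp: lattice_box_def)
  then show "k \<in> vec_lambda ` (PiE UNIV (\<lambda>_. real ` {..<N}))"
    by (metis image_eqI vec_nth_inverse)
qed (auto simp: lattice_box_def PiE_iff)

lemma finite_lattice_box: "finite (lattice_box N)"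
  unfolding lattice_box_eq by (intro finite_imageI finite_PiE) auto

lemma card_lattice_box: "card (lattice_box N :: (real ^ 'n) set) = N ^ CARD('n)"
proof -
  have "card (lattice_box N :: (real ^ 'n) set) = card (PiE (UNIV :: 'n set) (\<lambda>_. real ` {..<N}))"
    unfolding lattice_box_eq by (intro card_image inj_onI) (simp add: vec_lambda_inject)
  also have "\<dots> = N ^ CARD('n)" by (simp add: card_PiE card_image)
  finally show ?thesis .
qed

text \<open>Squared distances between lattice points are integers. Hence there are at most
  \<open>CARD('n) * N\<^sup>2\<close> positive distances in the box, far fewer than pairs of points
  in high dimension.\<close>

lemma norm_lattice_box_diff:
  fixes m m' :: "real ^ 'n"
  assumes "m \<in> lattice_box N" "m' \<in> lattice_box N" "m \<noteq> m'"
  shows "norm (m - m') \<in> (\<lambda>k. sqrt (real k)) ` {1..CARD('n) * N\<^sup>2}"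
proof -
  have "\<forall>i. \<exists>k \<le> N\<^sup>2. (m $ i - m' $ i)\<^sup>2 = real k"
  proof
    fix i
    obtain a b where ab: "m $ i = real a" "m' $ i = real b" "a < N" "b < N"
      using assms by (auto simp: lattice_box_def) (metis imageE lessThan_iff)
    define k where "k = (nat \<bar>int a - int b\<bar>)\<^sup>2"
    have "nat \<bar>int a - int b\<bar> \<le> N" using ab by auto
    then have "k \<le> N\<^sup>2" unfolding k_def by (intro power_mono) auto
    moreover have "(m $ i - m' $ i)\<^sup>2 = real k"
      by (simp add: ab k_def)
    ultimately show "\<exists>k \<le> N\<^sup>2. (m $ i - m' $ i)\<^sup>2 = real k" by blast
  qed
  then obtain k where k: "\<And>i. k i \<le> N\<^sup>2" "\<And>i. (m $ i - m' $ i)\<^sup>2 = real (k i)" by metis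
  have norm: "norm (m - m') = sqrt (real (\<Sum>i\<in>UNIV. k i))"
    by (simp add: norm_vec_def L2_set_def k(2))
  have "(\<Sum>i\<in>UNIV. k i) \<le> (\<Sum>i\<in>(UNIV :: 'n set). N\<^sup>2)" by (intro sum_mono k)
  moreover have "(\<Sum>i\<in>UNIV. k i) \<noteq> 0"
  proof
    assume "(\<Sum>i\<in>UNIV. k i) = 0"
    then have "norm (m - m') = 0" unfolding norm by simp
    then show False using assms(3) by simp
  qed
  then have "1 \<le> (\<Sum>i\<in>UNIV. k i)" by linarith
  ultimately show ?thesis unfolding norm by (intro image_eqI[OF refl]) simp
qed

text \<open>Pairs with equal distance oscillate with the same frequency and the same phase, so their
  amplitudes add up. By Cauchy-Schwarz the sum of squared multiplicities is at least the squared
  number of pairs over the number of distances. The constants \<open>\<kappa>\<close> and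
  \<open>\<gamma>\<close> do not depend on \<open>N\<close>.\<close>

lemma smoothed_discrepancy_asymptotics:
  obtains \<kappa> \<gamma> where "\<kappa> > 0" "\<gamma> \<noteq> 0"
    "\<And>N. N \<ge> 2 \<Longrightarrow> \<exists>L a. finite L \<and> (\<forall>l\<in>L. l > 0) \<and>
       \<kappa> * real N powr (real CARD('n) - 3) \<le> (\<Sum>l\<in>L. (a l)\<^sup>2) \<and>
       ((\<lambda>r. r powr (- (real CARD('n) - 1) / 2) * smoothed_discrepancy (lattice_box N :: (real ^ 'n) set) r
          - (\<Sum>l\<in>L. a l * Re (\<gamma> * cis (l * r)))) \<longlongrightarrow> 0) at_top"
proof -
  define d where "d = CARD('n)"
  have d: "d \<ge> 1" by (simp add: d_def Suc_leI)
  obtain \<gamma> where \<gamma>: "\<gamma> \<noteq> 0"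
    "((\<lambda>s. s powr (real (d - 1 + 2) / 2) * slice_transform (d - 1) s - Re (\<gamma> * cis s)) \<longlongrightarrow> 0) at_top"
    using slice_transform_asymptotics .
  define c where "c = unit_ball_vol (real (d - 1))"
  have c: "c > 0" by (simp add: c_def)
  define \<beta> where "\<beta> = - (real d + 1) / 2"
  define K where "K = 2 * pi * sqrt (real d)"
  have K: "K > 0" using d by (simp add: K_def)
  \<comment> \<open>The power of \<open>K\<close> comes from evaluating
    \<open>l powr \<beta>\<close> at the largest possible frequency \<open>K * N\<close>; the 4 from
    losing a factor 2 in the number of pairs, squared; and \<open>d\<close> from the count of
    distances.\<close>
  define \<kappa> where "\<kappa> = c\<^sup>2 * K powr (2 * \<beta>) / (4 * real d)"
  have \<kappa>: "\<kappa> > 0" using c d K by (simp add: \<kappa>_def)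
  show thesis
  proof (rule that[OF \<kappa> \<gamma>(1)])
    fix N :: nat assume N: "N \<ge> 2"
    define M where "M = (lattice_box N :: (real ^ 'n) set)"
    have M: "finite M" "card M = N ^ d" by (simp_all add: M_def finite_lattice_box card_lattice_box d_def)
    define S where "S = Sigma M (\<lambda>m. M - {m})"
    define f where "f = (\<lambda>(m, m'). 2 * pi * norm (m - m' :: real ^ 'n))"
    define L where "L = f ` S"
    define num where "num l = card {x \<in> S. f x = l}" for l
    define a where "a l = c * l powr \<beta> * real (num l) / real (N ^ d)" for l
    have S: "finite S" using M by (auto simp: S_def)
    have L: "finite L" using S by (simp add: L_def)
    have sqrt_mono: "L \<subseteq> (\<lambda>k. 2 * pi * sqrt (real k)) ` {1..d * N\<^sup>2}"
      using norm_lattice_box_diff[of _ N] unfolding L_def S_def f_def M_def d_def by fastforce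
    then have card_L: "card L \<le> d * N\<^sup>2"
      using card_mono[OF _ sqrt_mono] card_image_le[of "{1..d * N\<^sup>2}" "\<lambda>k. 2 * pi * sqrt (real k)"] by simp
    have L_bounds: "0 < l" "l \<le> K * real N" if l: "l \<in> L" for l
    proof -
      obtain k where k: "l = 2 * pi * sqrt (real k)" "1 \<le> k" "k \<le> d * N\<^sup>2" using sqrt_mono l by auto
      then show "0 < l" by simp
      have "real k \<le> real (d * N\<^sup>2)" using k by (subst of_nat_le_iff)
      then have "sqrt (real k) \<le> sqrt (real d * (real N)\<^sup>2)" by simp
      then show "l \<le> K * real N" by (simp add: k(1) K_def real_sqrt_mult)
    qed
    \<comment> \<open>The sum over frequencies is spread out again over the pairs in
      \<open>S\<close>, so that the limit can be taken separately for each pair.\<close>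
    have "(\<lambda>r. r powr (- (real d - 1) / 2) * smoothed_discrepancy M r
        - (\<Sum>l\<in>L. a l * Re (\<gamma> * cis (l * r)))) =
      (\<lambda>r. \<Sum>x\<in>S. (r powr (- (real d - 1) / 2) * ball_cosine_integral (fst x - snd x) r -
          c * f x powr \<beta> * Re (\<gamma> * cis (f x * r))) / real (N ^ d))"
    proof
      fix r
      have "(\<Sum>l\<in>L. a l * Re (\<gamma> * cis (l * r))) =
          (\<Sum>l\<in>L. \<Sum>x\<in>{x \<in> S. f x = l}. c * f x powr \<beta> * Re (\<gamma> * cis (f x * r)) / real (N ^ d))"
        by (intro sum.cong refl) (simp add: a_def num_def)
      also have "\<dots> = (\<Sum>x\<in>S. c * f x powr \<beta> * Re (\<gamma> * cis (f x * r)) / real (N ^ d))"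
        unfolding L_def by (rule sum.image_gen[OF S, symmetric])
      finally have 1: "(\<Sum>l\<in>L. a l * Re (\<gamma> * cis (l * r))) =
        (\<Sum>x\<in>S. c * f x powr \<beta> * Re (\<gamma> * cis (f x * r)) / real (N ^ d))" .
      have "smoothed_discrepancy M r = (\<Sum>x\<in>S. ball_cosine_integral (fst x - snd x) r) / real (N ^ d)"
        unfolding smoothed_discrepancy_def S_def using M by (subst sum.Sigma) (auto simp: split_beta)
      then have "r powr (- (real d - 1) / 2) * smoothed_discrepancy M r =
        (\<Sum>x\<in>S. r powr (- (real d - 1) / 2) * ball_cosine_integral (fst x - snd x) r / real (N ^ d))"
        by (simp add: sum_distrib_left sum_divide_distrib)
      with 1 show "r powr (- (real d - 1) / 2) * smoothed_discrepancy M r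
        - (\<Sum>l\<in>L. a l * Re (\<gamma> * cis (l * r))) =
        (\<Sum>x\<in>S. (r powr (- (real d - 1) / 2) * ball_cosine_integral (fst x - snd x) r -
          c * f x powr \<beta> * Re (\<gamma> * cis (f x * r))) / real (N ^ d))"
        by (simp add: sum_subtractf diff_divide_distrib)
    qed
    moreover have "((\<lambda>r. \<Sum>x\<in>S. (r powr (- (real d - 1) / 2) * ball_cosine_integral (fst x - snd x) r -
          c * f x powr \<beta> * Re (\<gamma> * cis (f x * r))) / real (N ^ d)) \<longlongrightarrow> (\<Sum>x\<in>S. 0 / real (N ^ d))) at_top"
    proof (intro tendsto_sum tendsto_divide[OF _ tendsto_const])
      fix x assume "x \<in> S"
      then have "fst x - snd x \<noteq> 0" by (auto simp: S_def)
      from ball_cosine_integral_asymptotics[OF \<gamma>(2)[unfolded d_def] this]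
      show "((\<lambda>r. r powr (- (real d - 1) / 2) * ball_cosine_integral (fst x - snd x) r -
          c * f x powr \<beta> * Re (\<gamma> * cis (f x * r))) \<longlongrightarrow> 0) at_top"
        by (simp add: f_def split_beta d_def c_def \<beta>_def)
    qed (use N in auto)
    ultimately have lim: "((\<lambda>r. r powr (- (real d - 1) / 2) * smoothed_discrepancy M r
        - (\<Sum>l\<in>L. a l * Re (\<gamma> * cis (l * r)))) \<longlongrightarrow> 0) at_top"
      by simp
    have "\<kappa> * real N powr (real d - 3) \<le> (\<Sum>l\<in>L. (a l)\<^sup>2)"
    proof -
      have "card S = N ^ d * (N ^ d - 1)"
        using M by (simp add: S_def card_SigmaI card_Diff_singleton)
      moreover have "2 \<le> N ^ d" using N d self_le_power[of N d] by linarith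
      then have "N ^ d \<le> 2 * (N ^ d - 1)" by linarith
      ultimately have "N ^ d * N ^ d \<le> 2 * card S"
        using mult_left_mono[of "N ^ d" "2 * (N ^ d - 1)" "N ^ d"] by (simp add: mult_ac)
      then have card_S: "(real N ^ d)\<^sup>2 \<le> 2 * real (card S)"
        by (simp add: power2_eq_square flip: of_nat_power of_nat_mult)
      have "(\<Sum>l\<in>L. num l) = card S"
        unfolding num_def L_def using sum.image_gen[OF S, of "\<lambda>_. 1 :: nat" f] by simp
      then have "(real (card S))\<^sup>2 = (\<Sum>l\<in>L. 1 * real (num l))\<^sup>2"
        by (simp flip: of_nat_sum)
      also have "\<dots> \<le> (\<Sum>l\<in>L. 1\<^sup>2) * (\<Sum>l\<in>L. (real (num l))\<^sup>2)"
        by (rule Cauchy_Schwarz_ineq_sum)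
      also have "\<dots> \<le> real (d * N\<^sup>2) * (\<Sum>l\<in>L. (real (num l))\<^sup>2)"
        using card_L by (intro mult_right_mono) (auto intro: sum_nonneg simp flip: of_nat_mult of_nat_power)
      finally have CS: "(real (card S))\<^sup>2 \<le> real (d * N\<^sup>2) * (\<Sum>l\<in>L. (real (num l))\<^sup>2)" .
      have "(real N ^ d)\<^sup>2 * (real N ^ d)\<^sup>2 \<le> (2 * real (card S)) * (2 * real (card S))"
        using card_S by (intro mult_mono) auto
      also have "\<dots> = 4 * (real (card S))\<^sup>2" by (simp add: power2_eq_square)
      finally have "(real N ^ d)\<^sup>2 * (real N ^ d)\<^sup>2 \<le> 4 * (real (d * N\<^sup>2) * (\<Sum>l\<in>L. (real (num l))\<^sup>2))"
        using CS by linarith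
      then have num: "(real N ^ d)\<^sup>2 * (real N ^ d)\<^sup>2 / (4 * real d * (real N)\<^sup>2) \<le> (\<Sum>l\<in>L. (real (num l))\<^sup>2)"
        using N d by (simp add: field_simps)
      \<comment> \<open>The exponents of \<open>N\<close> add up as
        \<open>2 * \<beta> - 2 * d + 4 * d - 2 = d - 3\<close>, since
        \<open>2 * \<beta> = - (d + 1)\<close>.\<close>
      have "\<kappa> * real N powr (real d - 3) =
          (c * (K * real N) powr \<beta> / real N ^ d)\<^sup>2 * ((real N ^ d)\<^sup>2 * (real N ^ d)\<^sup>2 / (4 * real d * (real N)\<^sup>2))"
      proof -
        have "((K * real N) powr \<beta>)\<^sup>2 = K powr (2 * \<beta>) * real N powr (2 * \<beta>)"
          using K by (simp add: powr_mult power2_eq_square mult_ac flip: powr_add)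
        also have "real N powr (2 * \<beta>) = real N powr (real d - 3) * (real N)\<^sup>2 / (real N ^ d)\<^sup>2"
        proof -
          have "2 * \<beta> = (real d - 3) + 2 - 2 * real d" by (simp add: \<beta>_def field_simps)
          then have "real N powr (2 * \<beta>) = real N powr (real d - 3) * real N powr 2 / real N powr (2 * real d)"
            by (simp only: powr_add powr_diff)
          also have "real N powr 2 = (real N)\<^sup>2" using N by simp
          also have "real N powr (2 * real d) = (real N ^ d)\<^sup>2"
            using N powr_realpow[of "real N" "d * 2"] by (simp add: power_mult mult.commute)
          finally show ?thesis .
        qed
        finally have Q: "((K * real N) powr \<beta>)\<^sup>2 =
          K powr (2 * \<beta>) * (real N powr (real d - 3) * (real N)\<^sup>2 / (real N ^ d)\<^sup>2)" .
        \<comment> \<open>The powers are replaced by variables, so that only a rational identity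
          remains.\<close>
        have "c\<^sup>2 * Z / (4 * D) * P = c\<^sup>2 * Q / W * (W * W / (4 * D * n))"
          if "Q = Z * (P * n / W)" "W > 0" "D > 0" "n > 0" for Z D P Q W n :: real
          using that by (simp add: field_simps)
        from this[OF Q, of "real d"] show ?thesis
          using N d by (simp add: \<kappa>_def power_mult_distrib power_divide)
      qed
      also have "\<dots> \<le> (c * (K * real N) powr \<beta> / real N ^ d)\<^sup>2 * (\<Sum>l\<in>L. (real (num l))\<^sup>2)"
        by (intro mult_left_mono num) auto
      also have "\<dots> = (\<Sum>l\<in>L. (c * (K * real N) powr \<beta> * real (num l) / real N ^ d)\<^sup>2)"
        by (simp add: sum_distrib_left power_mult_distrib power_divide)
      \<comment> \<open>Since \<open>\<beta>\<close> is negative, \<open>l powr \<beta>\<close> is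
        smallest at the upper bound \<open>K * N\<close> for the frequencies.\<close>
      also have "\<dots> \<le> (\<Sum>l\<in>L. (a l)\<^sup>2)"
        unfolding a_def of_nat_power using c L_bounds N
        by (intro sum_mono power_mono divide_right_mono mult_right_mono mult_left_mono powr_mono2')
           (auto simp: \<beta>_def)
      finally show ?thesis .
    qed
    then show "\<exists>L a. finite L \<and> (\<forall>l\<in>L. l > 0) \<and>
       \<kappa> * real N powr (real CARD('n) - 3) \<le> (\<Sum>l\<in>L. (a l)\<^sup>2) \<and>
       ((\<lambda>r. r powr (- (real CARD('n) - 1) / 2) * smoothed_discrepancy (lattice_box N :: (real ^ 'n) set) r
          - (\<Sum>l\<in>L. a l * Re (\<gamma> * cis (l * r)))) \<longlongrightarrow> 0) at_top"
      using lim L L_bounds(1) unfolding d_def M_def by blast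
  qed
qed

section \<open>Mean values of trigonometric sums\<close>

text \<open>A product of two waves splits into a wave at the sum and one at the difference of the
  frequencies; \<open>True\<close> and \<open>False\<close> in the index mark the two kinds. Sums
  are positive, and a difference vanishes only on the diagonal, which gives the constant
  term.\<close>

lemma square_trigonometric_sum:
  fixes L :: "real set" and a :: "real \<Rightarrow> real"
  assumes L: "finite L" "\<And>l. l \<in> L \<Longrightarrow> l > 0"
  obtains I :: "(bool \<times> real \<times> real) set" and c z where "finite I" "\<And>i. i \<in> I \<Longrightarrow> z i \<noteq> 0"
    "\<And>r. (\<Sum>l\<in>L. a l * Re (\<gamma> * cis (l * r)))\<^sup>2 =
       (norm \<gamma>)\<^sup>2 / 2 * (\<Sum>l\<in>L. (a l)\<^sup>2) + (\<Sum>i\<in>I. Re (c i * cis (z i * r)))"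
proof -
  define c :: "bool \<times> real \<times> real \<Rightarrow> complex"
    where "c = (\<lambda>(b, x, y). of_real (a x * a y / 2) * (if b then \<gamma>\<^sup>2 else of_real ((norm \<gamma>)\<^sup>2)))"
  define z :: "bool \<times> real \<times> real \<Rightarrow> real"
    where "z = (\<lambda>(b, x, y). if b then x + y else x - y)"
  define I\<^sub>1 where "I\<^sub>1 = {True} \<times> L \<times> L"
  define I\<^sub>2 where "I\<^sub>2 = {False} \<times> (SIGMA x:L. L - {x})"
  show thesis
  proof (rule that[of "I\<^sub>1 \<union> I\<^sub>2" z c])
    show "finite (I\<^sub>1 \<union> I\<^sub>2)" using L by (auto simp: I\<^sub>1_def I\<^sub>2_def)
    show "z i \<noteq> 0" if "i \<in> I\<^sub>1 \<union> I\<^sub>2" for i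
      using that L(2) by (auto simp: I\<^sub>1_def I\<^sub>2_def z_def dest!: L(2))
    fix r
    have Re_mult: "Re u * Re v = Re (u * v) / 2 + Re (u * cnj v) / 2" for u v
      by (simp add: field_simps)
    have Re_of_real_mult: "Re (of_real k * w) = k * Re w" for k w by simp
    have sum_I\<^sub>1: "(\<Sum>i\<in>I\<^sub>1. g i) = (\<Sum>x\<in>L. \<Sum>y\<in>L. g (True, x, y))" for g :: "_ \<Rightarrow> real"
      by (simp add: I\<^sub>1_def sum.cartesian_product')
    have sum_I\<^sub>2: "(\<Sum>i\<in>I\<^sub>2. g i) = (\<Sum>x\<in>L. \<Sum>y\<in>L - {x}. g (False, x, y))" for g :: "_ \<Rightarrow> real"
    proof -
      have "(\<Sum>i\<in>I\<^sub>2. g i) = (\<Sum>p\<in>(SIGMA x:L. L - {x}). g (False, p))"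
        by (simp add: I\<^sub>2_def sum.cartesian_product')
      also have "\<dots> = (\<Sum>x\<in>L. \<Sum>y\<in>L - {x}. g (False, x, y))"
        using L(1) by (subst sum.Sigma) auto
      finally show ?thesis .
    qed
    have pair: "(a x * Re (\<gamma> * cis (x * r))) * (a y * Re (\<gamma> * cis (y * r))) =
        Re (c (True, x, y) * cis (z (True, x, y) * r)) + Re (c (False, x, y) * cis (z (False, x, y) * r))" for x y
    proof -
      have 1: "(\<gamma> * cis (x * r)) * (\<gamma> * cis (y * r)) = \<gamma>\<^sup>2 * cis ((x + y) * r)"
        by (simp add: power2_eq_square cis_mult[symmetric] distrib_right)
      have 2: "(\<gamma> * cis (x * r)) * cnj (\<gamma> * cis (y * r)) = of_real ((norm \<gamma>)\<^sup>2) * cis ((x - y) * r)"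
      proof -
        have "cis ((x - y) * r) = cis (x * r) * cis (- (y * r))"
          by (simp add: cis_mult left_diff_distrib)
        then show ?thesis by (simp add: complex_norm_square cis_cnj mult_ac del: of_real_power)
      qed
      have "(a x * Re (\<gamma> * cis (x * r))) * (a y * Re (\<gamma> * cis (y * r))) =
          a x * a y * (Re (\<gamma> * cis (x * r)) * Re (\<gamma> * cis (y * r)))" by simp
      also have "\<dots> = a x * a y * (Re (\<gamma>\<^sup>2 * cis ((x + y) * r)) / 2 +
          Re (of_real ((norm \<gamma>)\<^sup>2) * cis ((x - y) * r)) / 2)"
        unfolding Re_mult 1 2 ..
      also have "\<dots> = Re (of_real (a x * a y / 2) * (\<gamma>\<^sup>2 * cis ((x + y) * r))) +
          Re (of_real (a x * a y / 2) * (of_real ((norm \<gamma>)\<^sup>2) * cis ((x - y) * r)))"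
        unfolding Re_of_real_mult[of "a x * a y / 2"] by (simp add: field_simps)
      finally show ?thesis by (simp only: c_def z_def case_prod_conv if_True if_False mult.assoc)
    qed
    have "(\<Sum>l\<in>L. a l * Re (\<gamma> * cis (l * r)))\<^sup>2 =
        (\<Sum>x\<in>L. \<Sum>y\<in>L. Re (c (True, x, y) * cis (z (True, x, y) * r))) +
        (\<Sum>x\<in>L. \<Sum>y\<in>L. Re (c (False, x, y) * cis (z (False, x, y) * r)))"
      unfolding power2_eq_square sum_product pair sum.distrib ..
    also have "(\<Sum>x\<in>L. \<Sum>y\<in>L. Re (c (True, x, y) * cis (z (True, x, y) * r))) =
        (\<Sum>i\<in>I\<^sub>1. Re (c i * cis (z i * r)))"
      by (rule sum_I\<^sub>1[symmetric])
    also have "(\<Sum>x\<in>L. \<Sum>y\<in>L. Re (c (False, x, y) * cis (z (False, x, y) * r))) =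
        (\<Sum>x\<in>L. Re (c (False, x, x)) + (\<Sum>y\<in>L - {x}. Re (c (False, x, y) * cis (z (False, x, y) * r))))"
      using L by (intro sum.cong refl) (simp add: sum.remove z_def)
    also have "\<dots> = (norm \<gamma>)\<^sup>2 / 2 * (\<Sum>l\<in>L. (a l)\<^sup>2) +
        (\<Sum>x\<in>L. \<Sum>y\<in>L - {x}. Re (c (False, x, y) * cis (z (False, x, y) * r)))"
      by (simp add: sum.distrib c_def sum_distrib_left power2_eq_square mult_ac)
    also have "(\<Sum>x\<in>L. \<Sum>y\<in>L - {x}. Re (c (False, x, y) * cis (z (False, x, y) * r))) =
        (\<Sum>i\<in>I\<^sub>2. Re (c i * cis (z i * r)))"
      by (rule sum_I\<^sub>2[symmetric])
    finally show "(\<Sum>l\<in>L. a l * Re (\<gamma> * cis (l * r)))\<^sup>2 =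
       (norm \<gamma>)\<^sup>2 / 2 * (\<Sum>l\<in>L. (a l)\<^sup>2) + (\<Sum>i\<in>I\<^sub>1 \<union> I\<^sub>2. Re (c i * cis (z i * r)))"
      using L by (subst sum.union_disjoint) (auto simp: I\<^sub>1_def I\<^sub>2_def)
  qed
qed

text \<open>A trigonometric polynomial without constant term has a bounded antiderivative.\<close>

lemma trigonometric_sum_not_eventually_negative:
  fixes c :: "'i \<Rightarrow> complex" and z :: "'i \<Rightarrow> real"
  assumes I: "finite I" "\<And>i. i \<in> I \<Longrightarrow> z i \<noteq> 0" and \<delta>: "\<delta> > 0"
  shows "\<exists>r\<ge>r0. (\<Sum>i\<in>I. Re (c i * cis (z i * r))) > - \<delta>"
proof (rule ccontr)
  assume "\<not> ?thesis"
  then have neg: "\<And>r. r \<ge> r0 \<Longrightarrow> (\<Sum>i\<in>I. Re (c i * cis (z i * r))) \<le> - \<delta>" by (auto simp: not_less)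
  define F where "F r = (\<Sum>i\<in>I. (Re (c i) * sin (z i * r) + Im (c i) * cos (z i * r)) / z i)" for r
  define B where "B = (\<Sum>i\<in>I. (\<bar>Re (c i)\<bar> + \<bar>Im (c i)\<bar>) / \<bar>z i\<bar>)"
  have F_bound: "\<bar>F r\<bar> \<le> B" for r
    unfolding F_def B_def
  proof (rule order_trans[OF sum_abs sum_mono])
    fix i
    have "\<bar>Re (c i) * sin (z i * r) + Im (c i) * cos (z i * r)\<bar> \<le> \<bar>Re (c i)\<bar> * 1 + \<bar>Im (c i)\<bar> * 1"
      by (rule order_trans[OF abs_triangle_ineq add_mono]; unfold abs_mult; intro mult_left_mono) auto
    then show "\<bar>(Re (c i) * sin (z i * r) + Im (c i) * cos (z i * r)) / z i\<bar> \<le>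
        (\<bar>Re (c i)\<bar> + \<bar>Im (c i)\<bar>) / \<bar>z i\<bar>"
      by (simp add: abs_divide divide_right_mono)
  qed
  have F_deriv: "(F has_real_derivative (\<Sum>i\<in>I. Re (c i * cis (z i * r)))) (at r)" for r
    unfolding F_def[abs_def]
  proof (rule DERIV_sum)
    fix i assume "i \<in> I"
    then show "((\<lambda>r. (Re (c i) * sin (z i * r) + Im (c i) * cos (z i * r)) / z i) has_real_derivative
        Re (c i * cis (z i * r))) (at r)"
      using I(2) by (auto intro!: derivative_eq_intros simp: field_simps)
  qed
  \<comment> \<open>Over this length the antiderivative \<open>F\<close> would drop by
    \<open>2 * B + 1\<close>, more than the \<open>2 * B\<close> that its bound permits.\<close>
  define T where "T = (2 * B + 1) / \<delta>"
  have B: "B \<ge> 0" unfolding B_def by (intro sum_nonneg) auto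
  have "F (r0 + T) + \<delta> * (r0 + T) \<le> F r0 + \<delta> * r0"
  proof (rule DERIV_nonpos_imp_nonincreasing[where f = "\<lambda>r. F r + \<delta> * r"])
    show "r0 \<le> r0 + T" using B \<delta> by (simp add: T_def)
    fix r assume "r0 \<le> r"
    then have "(\<Sum>i\<in>I. Re (c i * cis (z i * r))) + \<delta> \<le> 0" using neg[of r] by simp
    moreover have "((\<lambda>r. F r + \<delta> * r) has_real_derivative (\<Sum>i\<in>I. Re (c i * cis (z i * r))) + \<delta>) (at r)"
      by (auto intro!: derivative_eq_intros F_deriv)
    ultimately show "\<exists>y. ((\<lambda>r. F r + \<delta> * r) has_real_derivative y) (at r) \<and> y \<le> 0" by blast
  qed
  then have "F (r0 + T) \<le> F r0 - (2 * B + 1)"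
  proof -
    have "\<delta> * T = 2 * B + 1" using \<delta> by (simp add: T_def)
    with \<open>F (r0 + T) + \<delta> * (r0 + T) \<le> F r0 + \<delta> * r0\<close> show ?thesis by (simp add: distrib_left)
  qed
  then show False using F_bound[of "r0 + T"] F_bound[of r0] by linarith
qed

text \<open>If the integrals over \<open>B\<close> did not tend to zero, then one could choose many nearly orthogonal
  characters, all of which correlate with the indicator function of \<open>B\<close>; this contradicts
  Bessel's inequality.\<close>

lemma characteristic_integral_restrict_tendsto_0:
  fixes \<mu> :: "real measure"
  assumes "prob_space \<mu>" and sets_\<mu> [measurable_cong]: "sets \<mu> = sets borel"
    and lim: "\<And>e. e > 0 \<Longrightarrow> \<exists>T. \<forall>t. \<bar>t\<bar> \<ge> T \<longrightarrow> norm (CLINT r|\<mu>. cis (t * r)) < e"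
    and B [measurable]: "B \<in> sets borel" and \<delta>: "\<delta> > 0"
  shows "\<exists>T. \<forall>t. \<bar>t\<bar> \<ge> T \<longrightarrow> norm (CLINT r|\<mu>. of_real (indicator B r) * cis (t * r)) < \<delta>"
proof (rule ccontr)
  interpret prob_space \<mu> by fact
  have cis_meas [measurable]: "(\<lambda>r. cis (t * r)) \<in> borel_measurable borel" for t
    by (intro borel_measurable_continuous_onI continuous_intros)
  have int_cis: "integrable \<mu> (\<lambda>r. cis (t * r))" for t
    by (rule integrable_const_bound[of _ 1]) auto
  have int_B: "integrable \<mu> (\<lambda>r. of_real (indicator B r) * cis (t * r))" for t
    by (rule integrable_const_bound[of _ 1]) (auto simp: norm_mult indicator_def)
  define \<phi> where "\<phi> t = (CLINT r|\<mu>. cis (t * r))" for t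
  define \<psi> where "\<psi> t = (CLINT r|\<mu>. of_real (indicator B r) * cis (t * r))" for t
  assume "\<not> ?thesis"
  then have large: "\<exists>t. \<bar>t\<bar> \<ge> T \<and> norm (\<psi> t) \<ge> \<delta>" for T
    by (auto simp: \<psi>_def not_less)
  \<comment> \<open>With \<open>K\<close> characters the correlations will give
    \<open>(K * \<delta>)\<^sup>2 \<le> 2 * K\<close>, which fails for \<open>K\<close> beyond
    \<open>2 / \<delta>\<^sup>2\<close>.\<close>
  obtain K :: nat where K: "2 / \<delta>\<^sup>2 < real K" using reals_Archimedean2 by blast
  have "K > 0" using K \<delta> by (cases K) (auto simp: field_simps)
  obtain T where T: "\<And>t. \<bar>t\<bar> \<ge> T \<Longrightarrow> norm (\<phi> t) < 1 / real K"
    using lim[of "1 / real K"] \<open>K > 0\<close> by (auto simp: \<phi>_def)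
  \<comment> \<open>Each modulus exceeds the previous one by at least \<open>\<bar>T\<bar>\<close>,
    so all differences of distinct members have modulus at least \<open>T\<close>, whatever their
    signs.\<close>
  obtain t where t: "\<And>n. norm (\<psi> (t n)) \<ge> \<delta>" "\<And>n. \<bar>t (Suc n)\<bar> \<ge> \<bar>t n\<bar> + \<bar>T\<bar>"
  proof -
    have "\<exists>t. \<forall>n. norm (\<psi> (t n)) \<ge> \<delta> \<and> \<bar>t (Suc n)\<bar> \<ge> \<bar>t n\<bar> + \<bar>T\<bar>"
      by (rule dependent_nat_choice) (use large in \<open>auto simp: conj_commute\<close>)
    then show ?thesis using that by blast
  qed
  have gap: "\<bar>t n\<bar> \<ge> \<bar>t m\<bar> + \<bar>T\<bar>" if "m < n" for m n
    using that
  proof (induction n)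
    case (Suc n)
    then show ?case using t(2)[of n] by (cases "m = n") auto
  qed simp
  have sep: "\<bar>t n - t m\<bar> \<ge> T" if "m \<noteq> n" for m n
    using gap[of m n] gap[of n m] that by (cases m n rule: linorder_cases) auto
  \<comment> \<open>Unimodular factors that align the phases of the correlations, so that their
    moduli add up.\<close>
  define \<sigma> where "\<sigma> n = cnj (sgn (\<psi> (t n)))" for n
  have \<psi>_nz: "\<psi> (t n) \<noteq> 0" for n using t(1)[of n] \<delta> by auto
  have \<sigma>: "norm (\<sigma> n) = 1" "\<sigma> n * \<psi> (t n) = of_real (norm (\<psi> (t n)))" for n
  proof -
    show "norm (\<sigma> n) = 1" using \<psi>_nz by (simp add: \<sigma>_def norm_sgn)
    have "\<sigma> n * \<psi> (t n) = (\<psi> (t n) * cnj (\<psi> (t n))) / of_real (norm (\<psi> (t n)))"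
      by (simp add: \<sigma>_def sgn_eq)
    also have "\<dots> = of_real (norm (\<psi> (t n)))"
      using \<psi>_nz by (simp add: complex_norm_square[symmetric] power2_eq_square)
    finally show "\<sigma> n * \<psi> (t n) = of_real (norm (\<psi> (t n)))" .
  qed
  define S where "S r = (\<Sum>n<K. \<sigma> n * cis (t n * r))" for r
  have [measurable]: "S \<in> borel_measurable borel" unfolding S_def[abs_def] by measurable
  have S_bound: "norm (S r) \<le> real K" for r
  proof -
    have "norm (S r) \<le> (\<Sum>n<K. norm (\<sigma> n * cis (t n * r)))" unfolding S_def by (rule norm_sum)
    also have "\<dots> = real K" by (simp add: norm_mult \<sigma>)
    finally show ?thesis .
  qed
  have int_norm: "integrable \<mu> (\<lambda>r. norm (S r))"
    by (rule integrable_const_bound[of _ "real K"]) (auto simp: S_bound)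
  have int_norm2: "integrable \<mu> (\<lambda>r. (norm (S r))\<^sup>2)"
    by (rule integrable_const_bound[of _ "(real K)\<^sup>2"]) (auto simp: S_bound power_mono)
  have "real K * \<delta> \<le> (\<Sum>n<K. norm (\<psi> (t n)))"
    using sum_mono[of "{..<K}" "\<lambda>_. \<delta>" "\<lambda>n. norm (\<psi> (t n))"] t(1) by simp
  also have "\<dots> = norm (\<Sum>n<K. \<sigma> n * \<psi> (t n))"
    unfolding \<sigma>(2) by (simp add: sum_nonneg flip: of_real_sum)
  also have "(\<Sum>n<K. \<sigma> n * \<psi> (t n)) = (CLINT r|\<mu>. (\<Sum>n<K. \<sigma> n * (of_real (indicator B r) * cis (t n * r))))"
    using int_B by (simp add: \<psi>_def Bochner_Integration.integral_sum)
  also have "\<dots> = (CLINT r|\<mu>. of_real (indicator B r) * S r)"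
    by (simp add: S_def sum_distrib_left mult_ac)
  also have "norm \<dots> \<le> (LINT r|\<mu>. norm (of_real (indicator B r) * S r))"
    by (rule integral_norm_bound)
  also have "\<dots> \<le> (LINT r|\<mu>. norm (S r))"
  proof (rule integral_mono[OF _ int_norm])
    show "integrable \<mu> (\<lambda>r. norm (of_real (indicator B r) * S r))"
      by (rule integrable_const_bound[of _ "real K"]) (auto simp: S_bound norm_mult indicator_def)
  qed (auto simp: norm_mult indicator_def)
  finally have lower: "real K * \<delta> \<le> expectation (\<lambda>r. norm (S r))" .
  have "complex_of_real (LINT r|\<mu>. (norm (S r))\<^sup>2) = (CLINT r|\<mu>. S r * cnj (S r))"
    unfolding complex_norm_square[symmetric] by (rule integral_complex_of_real[symmetric])
  also have "\<dots> = (CLINT r|\<mu>. (\<Sum>n<K. \<Sum>m<K. \<sigma> n * cnj (\<sigma> m) * cis ((t n - t m) * r)))"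
  proof (intro Bochner_Integration.integral_cong refl)
    fix r
    have "cis ((t n - t m) * r) = cis (t n * r) * cnj (cis (t m * r))" for n m
      by (simp add: cis_cnj cis_mult left_diff_distrib)
    then show "S r * cnj (S r) = (\<Sum>n<K. \<Sum>m<K. \<sigma> n * cnj (\<sigma> m) * cis ((t n - t m) * r))"
      by (simp add: S_def sum_product mult_ac)
  qed
  also have "\<dots> = (\<Sum>n<K. \<Sum>m<K. \<sigma> n * cnj (\<sigma> m) * \<phi> (t n - t m))"
    using int_cis by (simp add: Bochner_Integration.integral_sum \<phi>_def)
  finally have "\<bar>LINT r|\<mu>. (norm (S r))\<^sup>2\<bar> = norm (\<Sum>n<K. \<Sum>m<K. \<sigma> n * cnj (\<sigma> m) * \<phi> (t n - t m))"
    by (metis norm_of_real)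
  also have "\<dots> \<le> (\<Sum>n<K. \<Sum>m<K. norm (\<sigma> n * cnj (\<sigma> m) * \<phi> (t n - t m)))"
    by (intro order_trans[OF norm_sum] sum_mono norm_sum)
  \<comment> \<open>Near orthogonality: the diagonal contributes \<open>K\<close>, and
    \<open>K\<^sup>2\<close> entries of at most \<open>1 / K\<close> contribute another
    \<open>K\<close>.\<close>
  also have "\<dots> \<le> (\<Sum>n<K. \<Sum>m<K. (if m = n then 1 else 0) + 1 / real K)"
  proof (intro sum_mono)
    fix n m
    have "norm (\<phi> s) \<le> 1" for s
      using integral_norm_bound[of \<mu> "\<lambda>r. cis (s * r)"] by (simp add: \<phi>_def prob_space)
    then have "norm (\<phi> (t n - t m)) \<le> (if m = n then 1 else 0) + 1 / real K"
      using T[OF sep, of m n] by (cases "m = n") (auto intro: add_increasing2)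
    then show "norm (\<sigma> n * cnj (\<sigma> m) * \<phi> (t n - t m)) \<le> (if m = n then 1 else 0) + 1 / real K"
      by (simp add: norm_mult \<sigma>)
  qed
  also have "\<dots> = 2 * real K"
    using \<open>K > 0\<close> by (simp add: sum.distrib)
  finally have upper: "expectation (\<lambda>r. (norm (S r))\<^sup>2) \<le> 2 * real K" by linarith
  have "(real K * \<delta>)\<^sup>2 \<le> (expectation (\<lambda>r. norm (S r)))\<^sup>2"
    using lower \<delta> by (intro power_mono) auto
  also have "\<dots> \<le> expectation (\<lambda>r. (norm (S r))\<^sup>2)"
    using variance_eq[OF int_norm int_norm2] variance_positive[of "\<lambda>r. norm (S r)"] by simp
  finally have "real K * (real K * \<delta>\<^sup>2) \<le> real K * 2"
    using upper by (simp add: power2_eq_square mult_ac)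
  then have "real K * \<delta>\<^sup>2 \<le> 2" using \<open>K > 0\<close> by simp
  then show False using K \<delta> by (simp add: field_simps)
qed

text \<open>The integral on the right drops the negative part of \<open>f\<close>; the minorants
  used below may be negative.\<close>

lemma ennreal_integral_le_nn_integral:
  fixes f :: "'a \<Rightarrow> real"
  assumes "integrable M f"
  shows "ennreal (integral\<^sup>L M f) \<le> (\<integral>\<^sup>+x. ennreal (f x) \<partial>M)"
proof -
  have int: "integrable M (\<lambda>x. max 0 (f x))" using assms by auto
  have "integral\<^sup>L M f \<le> (LINT x|M. max 0 (f x))"
    using assms int by (intro integral_mono) auto
  then have "ennreal (integral\<^sup>L M f) \<le> ennreal (LINT x|M. max 0 (f x))" by (rule ennreal_leI)
  also have "\<dots> = (\<integral>\<^sup>+x. ennreal (max 0 (f x)) \<partial>M)"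
    using int by (intro nn_integral_eq_integral[symmetric]) auto
  also have "\<dots> = (\<integral>\<^sup>+x. ennreal (f x) \<partial>M)"
    by (intro nn_integral_cong) (simp add: max_def ennreal_neg)
  finally show ?thesis .
qed

section \<open>Mean squares of functions asymptotic to a trigonometric sum\<close>

text \<open>Because every \<open>z i\<close> is nonzero, \<open>A\<close> is the mean value of the
  square of \<open>P\<close>. The role of \<open>h\<close> will be played by the rescaled smoothed
  discrepancy.\<close>

locale asymptotic_trigonometric_sum =
  fixes h P :: "real \<Rightarrow> real" and A :: real and I :: "'i set" and c :: "'i \<Rightarrow> complex" and z :: "'i \<Rightarrow> real"
  assumes finite_I: "finite I" and z: "\<And>i. i \<in> I \<Longrightarrow> z i \<noteq> 0"
    and P_square: "\<And>r. (P r)\<^sup>2 = A + (\<Sum>i\<in>I. Re (c i * cis (z i * r)))"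
    and h_P: "((\<lambda>r. h r - P r) \<longlongrightarrow> 0) at_top"
begin

definition bd :: real where "bd = \<bar>A\<bar> + (\<Sum>i\<in>I. norm (c i))"

lemma bd_nonneg: "bd \<ge> 0"
  by (auto simp: bd_def intro!: add_nonneg_nonneg sum_nonneg)

lemma P_square_le: "(P r)\<^sup>2 \<le> bd"
proof -
  have "(\<Sum>i\<in>I. Re (c i * cis (z i * r))) \<le> (\<Sum>i\<in>I. norm (c i))"
  proof (rule sum_mono)
    fix i
    show "Re (c i * cis (z i * r)) \<le> norm (c i)"
      using complex_Re_le_cmod[of "c i * cis (z i * r)"] by (simp add: norm_mult)
  qed
  then show ?thesis unfolding P_square bd_def by linarith
qed

text \<open>Expand the square of \<open>P + (h - P)\<close>: the last square is nonnegative, and the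
  cross term is small since \<open>P\<close> is bounded.\<close>

lemma h_square_lower:
  assumes "\<delta> > 0"
  obtains r0 where "\<And>r. r \<ge> r0 \<Longrightarrow> (P r)\<^sup>2 - \<delta> \<le> (h r)\<^sup>2"
proof -
  define B where "B = sqrt bd"
  have B: "B \<ge> 0" "\<And>r. \<bar>P r\<bar> \<le> B"
    using bd_nonneg P_square_le by (auto simp: B_def intro!: real_le_rsqrt)
  define e where "e = \<delta> / (2 * B + 1)"
  have e: "e > 0" "2 * B * e \<le> \<delta>" using B assms by (auto simp: e_def field_simps)
  have "\<forall>\<^sub>F r in at_top. \<bar>h r - P r\<bar> < e"
    using tendstoD[OF h_P e(1)] by (simp add: dist_norm)
  then obtain r0 where r0: "\<And>r. r \<ge> r0 \<Longrightarrow> \<bar>h r - P r\<bar> < e"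
    by (auto simp: eventually_at_top_linorder)
  have "(P r)\<^sup>2 - \<delta> \<le> (h r)\<^sup>2" if "r \<ge> r0" for r
  proof -
    have "\<bar>P r * (h r - P r)\<bar> \<le> B * e"
      unfolding abs_mult using B r0[OF that] by (intro mult_mono) auto
    then have "- (2 * B * e) \<le> 2 * (P r * (h r - P r))" by (simp add: abs_le_iff)
    moreover have "(h r)\<^sup>2 = (P r)\<^sup>2 + 2 * (P r * (h r - P r)) + (h r - P r)\<^sup>2"
      by (simp add: power2_eq_square algebra_simps)
    moreover have "(h r - P r)\<^sup>2 \<ge> 0" by simp
    ultimately show ?thesis using e(2) by linarith
  qed
  then show thesis by (rule that)
qed

text \<open>On \<open>B\<close> the sign \<open>\<sigma>\<close> turns \<open>R + H * r\<close> into
  its modulus. The oscillating terms become integrals over \<open>B\<close> at the frequencies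
  \<open>z i * \<sigma> * H\<close>, which are small for large \<open>H\<close>. The bound is
  uniform in \<open>R\<close>, which enters these terms only through factors of modulus one.\<close>

lemma restricted_mean_square_lower:
  fixes \<mu> :: "real measure"
  assumes \<mu>: "prob_space \<mu>" and sets_\<mu> [measurable_cong]: "sets \<mu> = sets borel"
    and lim: "\<And>e. e > 0 \<Longrightarrow> \<exists>T. \<forall>t. \<bar>t\<bar> \<ge> T \<longrightarrow> norm (CLINT r|\<mu>. cis (t * r)) < e"
    and B [measurable]: "B \<in> sets borel" and \<sigma>: "\<bar>\<sigma>\<bar> = 1" and \<delta>: "\<delta> > 0"
  shows "\<exists>H0 r0. \<forall>H R. H \<ge> H0 \<longrightarrow> (\<forall>r\<in>B. \<sigma> * (R + H * r) \<ge> r0) \<longrightarrow>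
     ennreal (A * measure \<mu> B - \<delta>) \<le> (\<integral>\<^sup>+r. ennreal ((h \<bar>R + H * r\<bar>)\<^sup>2) \<partial>\<mu>)"
proof -
  interpret prob_space \<mu> by fact
  define \<psi> where "\<psi> t = (CLINT r|\<mu>. of_real (indicator B r) * cis (t * r))" for t
  obtain r0 where r0: "\<And>r. r \<ge> r0 \<Longrightarrow> (P r)\<^sup>2 - \<delta> / 2 \<le> (h r)\<^sup>2"
    using h_square_lower[of "\<delta> / 2"] \<delta> by auto
  define C where "C = (\<Sum>i\<in>I. norm (c i))"
  have C: "C \<ge> 0" by (auto simp: C_def intro: sum_nonneg)
  define e where "e = \<delta> / (2 * (C + 1))"
  have e: "e > 0" "C * e \<le> \<delta> / 2" using C \<delta> by (auto simp: e_def field_simps)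
  obtain T where T: "\<And>t. \<bar>t\<bar> \<ge> T \<Longrightarrow> norm (\<psi> t) < e"
    using characteristic_integral_restrict_tendsto_0[OF \<mu> sets_\<mu> lim B e(1)] by (auto simp: \<psi>_def)
  \<comment> \<open>A sum instead of a maximum: it dominates each
    \<open>\<bar>T\<bar> / \<bar>z i\<bar>\<close> and makes sense for empty
    \<open>I\<close>.\<close>
  define H0 where "H0 = (\<Sum>i\<in>I. \<bar>T\<bar> / \<bar>z i\<bar>)"
  have cis_meas [measurable]: "(\<lambda>r. cis (t * r)) \<in> borel_measurable borel" for t
    by (intro borel_measurable_continuous_onI continuous_intros)
  have int_B: "integrable \<mu> (\<lambda>r. of_real (indicator B r) * cis (t * r))" for t
    by (rule integrable_const_bound[of _ 1]) (auto simp: norm_mult indicator_def)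
  have int_ind: "integrable \<mu> (indicator B :: real \<Rightarrow> real)"
    by (rule integrable_const_bound[of _ 1]) (auto simp: indicator_def)
  show ?thesis
  proof (intro exI allI impI)
    \<comment> \<open>The threshold supplied is \<open>max r0 0\<close>; the zero ensures that
      \<open>\<sigma> * (R + H * r)\<close> is equal to the modulus of
      \<open>R + H * r\<close>.\<close>
    fix H R assume H: "H \<ge> H0" and R: "\<forall>r\<in>B. \<sigma> * (R + H * r) \<ge> max r0 0"
    have large: "\<bar>z i * \<sigma> * H\<bar> \<ge> T" if i: "i \<in> I" for i
    proof -
      have "\<bar>T\<bar> / \<bar>z i\<bar> \<le> H0"
        unfolding H0_def using finite_I i by (intro member_le_sum) auto
      then have "\<bar>T\<bar> \<le> \<bar>z i\<bar> * H0" using z[OF i] by (simp add: field_simps)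
      also have "\<dots> \<le> \<bar>z i\<bar> * \<bar>H\<bar>" using H by (intro mult_left_mono) auto
      finally show ?thesis using \<sigma> by (simp add: abs_mult)
    qed
    define g where "g r = A * indicator B r +
      (\<Sum>i\<in>I. Re (c i * cis (z i * \<sigma> * R) * (of_real (indicator B r) * cis (z i * \<sigma> * H * r)))) -
      \<delta> / 2 * indicator B r" for r
    have g_eq: "g r = indicator B r * ((P (\<sigma> * (R + H * r)))\<^sup>2 - \<delta> / 2)" for r
    proof -
      have "c i * cis (z i * (\<sigma> * (R + H * r))) =
          c i * cis (z i * \<sigma> * R) * cis (z i * \<sigma> * H * r)" for i
        by (simp add: cis_mult algebra_simps)
      then show ?thesis by (simp only: g_def P_square) (simp add: indicator_def)
    qed
    have int_term: "integrable \<mu> (\<lambda>r. c i * cis (z i * \<sigma> * R) * (of_real (indicator B r) * cis (z i * \<sigma> * H * r)))" for i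
      by (intro integrable_mult_right int_B)
    have int_g: "integrable \<mu> g"
      unfolding g_def
      by (intro Bochner_Integration.integrable_add Bochner_Integration.integrable_diff
            Bochner_Integration.integrable_sum integrable_mult_right int_ind integrable_Re int_term)
    have "(LINT r|\<mu>. g r) = A * measure \<mu> B +
        (\<Sum>i\<in>I. Re (c i * cis (z i * \<sigma> * R) * \<psi> (z i * \<sigma> * H))) - \<delta> / 2 * measure \<mu> B"
      unfolding g_def \<psi>_def using int_ind int_term int_B
      by (simp add: Bochner_Integration.integral_add Bochner_Integration.integral_diff
          Bochner_Integration.integral_sum Bochner_Integration.integrable_sum integrable_Re integral_Re
          del: Re_complex_of_real times_complex.sel)
    also have "\<dots> \<ge> A * measure \<mu> B - \<delta>"
    proof -
      have "\<bar>\<Sum>i\<in>I. Re (c i * cis (z i * \<sigma> * R) * \<psi> (z i * \<sigma> * H))\<bar> \<le> (\<Sum>i\<in>I. norm (c i) * e)"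
      proof (rule order_trans[OF sum_abs sum_mono])
        fix i assume i: "i \<in> I"
        have "\<bar>Re (c i * cis (z i * \<sigma> * R) * \<psi> (z i * \<sigma> * H))\<bar> \<le> norm (c i * cis (z i * \<sigma> * R) * \<psi> (z i * \<sigma> * H))"
          by (rule abs_Re_le_cmod)
        also have "\<dots> = norm (c i) * norm (\<psi> (z i * \<sigma> * H))" by (simp add: norm_mult)
        also have "\<dots> \<le> norm (c i) * e"
          using T[OF large[OF i]] by (intro mult_left_mono) auto
        finally show "\<bar>Re (c i * cis (z i * \<sigma> * R) * \<psi> (z i * \<sigma> * H))\<bar> \<le> norm (c i) * e" .
      qed
      also have "\<dots> = C * e" by (simp add: C_def sum_distrib_right)
      finally have "\<bar>\<Sum>i\<in>I. Re (c i * cis (z i * \<sigma> * R) * \<psi> (z i * \<sigma> * H))\<bar> \<le> \<delta> / 2" using e(2) by linarith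
      moreover have "\<delta> / 2 * measure \<mu> B \<le> \<delta> / 2" using \<delta> by (intro mult_left_le) auto
      ultimately show ?thesis by linarith
    qed
    finally have "ennreal (A * measure \<mu> B - \<delta>) \<le> ennreal (LINT r|\<mu>. g r)" by (intro ennreal_leI)
    also have "\<dots> \<le> (\<integral>\<^sup>+r. ennreal (g r) \<partial>\<mu>)" by (rule ennreal_integral_le_nn_integral[OF int_g])
    also have "\<dots> \<le> (\<integral>\<^sup>+r. ennreal ((h \<bar>R + H * r\<bar>)\<^sup>2) \<partial>\<mu>)"
    proof (intro nn_integral_mono ennreal_leI)
      fix r
      show "g r \<le> (h \<bar>R + H * r\<bar>)\<^sup>2"
      proof (cases "r \<in> B")
        case True
        then have ge: "\<sigma> * (R + H * r) \<ge> max r0 0" using R by blast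
        then have "\<sigma> * (R + H * r) = \<bar>\<sigma> * (R + H * r)\<bar>" by simp
        also have "\<dots> = \<bar>R + H * r\<bar>" using \<sigma> by (simp only: abs_mult) simp
        finally show ?thesis using r0[of "\<bar>R + H * r\<bar>"] ge True by (simp add: g_eq)
      qed (simp add: g_eq)
    qed
    finally show "ennreal (A * measure \<mu> B - \<delta>) \<le> (\<integral>\<^sup>+r. ennreal ((h \<bar>R + H * r\<bar>)\<^sup>2) \<partial>\<mu>)" .
  qed
qed

text \<open>As a function of \<open>R\<close>, the mean of the square of
  \<open>P (R + H * r)\<close> is \<open>A\<close> plus a trigonometric sum with the same nonzero
  frequencies, which cannot stay below a negative constant. Large \<open>R\<close> makes the set
  where \<open>R + H * r\<close> is small nearly null. Each of the three losses costs at most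
  \<open>\<delta> / 3\<close>.\<close>

lemma frequent_mean_square_lower:
  fixes \<mu> :: "real measure"
  assumes \<mu>: "prob_space \<mu>" and sets_\<mu> [measurable_cong]: "sets \<mu> = sets borel"
    and H: "H > 0" and \<delta>: "\<delta> > 0"
  shows "\<exists>R\<ge>R0. ennreal (A - \<delta>) \<le> (\<integral>\<^sup>+r. ennreal ((h \<bar>R + H * r\<bar>)\<^sup>2) \<partial>\<mu>)"
proof -
  interpret prob_space \<mu> by fact
  interpret real_distribution \<mu> by standard (rule sets_\<mu>)
  define \<phi> where "\<phi> t = (CLINT r|\<mu>. cis (t * r))" for t
  obtain r0 where r0: "\<And>r. r \<ge> r0 \<Longrightarrow> (P r)\<^sup>2 - \<delta> / 3 \<le> (h r)\<^sup>2"
    using h_square_lower[of "\<delta> / 3"] \<delta> by auto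
  define r1 where "r1 = max r0 0"
  define e where "e = \<delta> / (3 * (bd + 1))"
  have e: "e > 0" "bd * e \<le> \<delta> / 3" using bd_nonneg \<delta> by (auto simp: e_def field_simps)
  have "\<forall>\<^sub>F x in at_bot. cdf \<mu> x < e"
    using cdf_lim_at_bot e(1) by (rule order_tendstoD)
  then obtain K where K: "\<And>x. x \<le> K \<Longrightarrow> cdf \<mu> x < e"
    by (auto simp: eventually_at_bot_linorder)
  have cis_meas [measurable]: "(\<lambda>r. cis (t * r)) \<in> borel_measurable borel" for t
    by (intro borel_measurable_continuous_onI continuous_intros)
  have int_cis: "integrable \<mu> (\<lambda>r. cis (t * r))" for t
    by (rule integrable_const_bound[of _ 1]) auto
  \<comment> \<open>The bound \<open>r1 - H * K\<close> places the exceptional set \<open>B\<close>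
    to the left of \<open>K\<close>, where the distribution function is below
    \<open>e\<close>.\<close>
  have "\<exists>R\<ge>max R0 (r1 - H * K). (\<Sum>i\<in>I. Re (c i * \<phi> (z i * H) * cis (z i * R))) > - (\<delta> / 3)"
    by (rule trigonometric_sum_not_eventually_negative[OF finite_I z]) (use \<delta> in auto)
  then obtain R where R: "R \<ge> max R0 (r1 - H * K)"
    "(\<Sum>i\<in>I. Re (c i * \<phi> (z i * H) * cis (z i * R))) > - (\<delta> / 3)"
    by blast
  define B where "B = {r. R + H * r < r1}"
  have [measurable]: "B \<in> sets borel" unfolding B_def by measurable
  have "B \<subseteq> {..(r1 - R) / H}" using H by (auto simp: B_def field_simps)
  then have "measure \<mu> B \<le> cdf \<mu> ((r1 - R) / H)"
    unfolding cdf_def by (intro finite_measure_mono) auto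
  also have "\<dots> < e" using R(1) H by (intro K) (simp add: field_simps)
  finally have "bd * measure \<mu> B \<le> bd * e" using bd_nonneg by (intro mult_left_mono) auto
  then have B: "bd * measure \<mu> B \<le> \<delta> / 3" using e(2) by linarith
  \<comment> \<open>Subtracting the bound \<open>bd\<close> of the square of \<open>P\<close> on
    \<open>B\<close> makes \<open>g\<close> nonpositive there, so \<open>g\<close> is a minorant
    everywhere.\<close>
  define g where "g r = (A - \<delta> / 3) + (\<Sum>i\<in>I. Re (c i * cis (z i * R) * cis (z i * H * r))) -
     bd * indicator B r" for r
  have g_eq: "g r = (P (R + H * r))\<^sup>2 - \<delta> / 3 - bd * indicator B r" for r
  proof -
    have "c i * cis (z i * (R + H * r)) = c i * cis (z i * R) * cis (z i * H * r)" for i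
      by (simp add: cis_mult algebra_simps)
    then show ?thesis by (simp only: g_def P_square)
  qed
  have int_term: "integrable \<mu> (\<lambda>r. c i * cis (z i * R) * cis (z i * H * r))" for i
    by (intro integrable_mult_right int_cis)
  have int_ind: "integrable \<mu> (indicator B :: real \<Rightarrow> real)"
    by (rule integrable_const_bound[of _ 1]) (auto simp: indicator_def)
  have int_g: "integrable \<mu> g"
    unfolding g_def
    by (intro Bochner_Integration.integrable_add Bochner_Integration.integrable_diff integrable_const
          Bochner_Integration.integrable_sum integrable_mult_right int_ind integrable_Re int_term)
  have "(LINT r|\<mu>. g r) = (A - \<delta> / 3) + (\<Sum>i\<in>I. Re (c i * cis (z i * R) * \<phi> (z i * H))) - bd * measure \<mu> B"
    unfolding g_def \<phi>_def using int_ind int_term int_cis prob_space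
    by (simp add: Bochner_Integration.integral_add Bochner_Integration.integral_diff
          Bochner_Integration.integral_sum Bochner_Integration.integrable_sum integrable_Re integral_Re
          del: Re_complex_of_real times_complex.sel)
  also have "(\<Sum>i\<in>I. Re (c i * cis (z i * R) * \<phi> (z i * H))) = (\<Sum>i\<in>I. Re (c i * \<phi> (z i * H) * cis (z i * R)))"
    by (simp only: mult_ac)
  also have "(A - \<delta> / 3) + \<dots> - bd * measure \<mu> B \<ge> A - \<delta>" using R(2) B by linarith
  finally have "ennreal (A - \<delta>) \<le> ennreal (LINT r|\<mu>. g r)" by (intro ennreal_leI)
  also have "\<dots> \<le> (\<integral>\<^sup>+r. ennreal (g r) \<partial>\<mu>)" by (rule ennreal_integral_le_nn_integral[OF int_g])
  also have "\<dots> \<le> (\<integral>\<^sup>+r. ennreal ((h \<bar>R + H * r\<bar>)\<^sup>2) \<partial>\<mu>)"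
  proof (intro nn_integral_mono ennreal_leI)
    fix r
    show "g r \<le> (h \<bar>R + H * r\<bar>)\<^sup>2"
    proof (cases "r \<in> B")
      case True
      then have "g r \<le> 0" using P_square_le[of "R + H * r"] \<delta> by (simp add: g_eq)
      then show ?thesis by (rule order_trans) simp
    next
      case False
      then have "R + H * r \<ge> r1" by (simp add: B_def)
      then show ?thesis using r0[of "R + H * r"] False by (simp add: g_eq r1_def)
    qed
  qed
  finally show ?thesis using R(1) by auto
qed

end

section \<open>Divergence of the mixed norms\<close>

lemma borel_measurable_ball_cosine_integral [measurable]:
  fixes n :: "real ^ 'n"
  shows "ball_cosine_integral n \<in> borel_measurable borel"
proof -
  have "(\<lambda>(r, y). indicator {p. norm (snd p) \<le> fst p} (r, y) * cos (2 * pi * (n \<bullet> y)))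
      \<in> borel_measurable (borel \<Otimes>\<^sub>M lborel)"
    by measurable
  then have "(\<lambda>r. LINT y|lborel. indicator {p. norm (snd p) \<le> fst p} (r, y) * cos (2 * pi * (n \<bullet> y)))
      \<in> borel_measurable borel"
    by (rule lborel.borel_measurable_lebesgue_integral)
  also have "(\<lambda>r. LINT y|lborel. indicator {p. norm (snd p) \<le> fst p} (r, y) * cos (2 * pi * (n \<bullet> y))) =
      ball_cosine_integral n"
    by (auto simp: ball_cosine_integral_def indicator_def intro!: Bochner_Integration.integral_cong)
  finally show ?thesis .
qed

text \<open>Without atoms the distribution function is continuous and takes the values 1/3 and 2/3.
  The two rays, separated by a gap, will be the sets on which \<open>R + H * r\<close> has constant
  sign.\<close>

lemma prob_space_no_atoms_split:
  assumes "real_distribution \<mu>" and atoms: "\<And>x. measure \<mu> {x} = 0"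
  obtains a b where "a < b" "measure \<mu> {..a} = 1 / 3" "measure \<mu> {b<..} = 1 / 3"
proof -
  interpret real_distribution \<mu> by fact
  have cont: "isCont (cdf \<mu>) x" for x using atoms by (simp add: isCont_cdf)
  have ex: "\<exists>x. cdf \<mu> x = y" if "0 < y" "y < 1" for y
  proof -
    have "\<forall>\<^sub>F x in at_bot. cdf \<mu> x < y" using cdf_lim_at_bot that(1) by (rule order_tendstoD)
    then obtain l where l: "cdf \<mu> l < y" by (auto simp: eventually_at_bot_linorder)
    have "\<forall>\<^sub>F x in at_top. cdf \<mu> x > y" using cdf_lim_at_top_prob that(2) by (rule order_tendstoD)
    then obtain u where u: "cdf \<mu> u > y" by (auto simp: eventually_at_top_linorder)
    have "l \<le> u" using l u cdf_nondecreasing[of u l] by (cases "l \<le> u") auto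
    then show ?thesis using IVT[of "cdf \<mu>" l y u] l u cont by auto
  qed
  obtain a where a: "cdf \<mu> a = 1 / 3" using ex[of "1 / 3"] by auto
  obtain b where b: "cdf \<mu> b = 2 / 3" using ex[of "2 / 3"] by auto
  have "a < b" using a b cdf_nondecreasing[of b a] by (cases "a < b") auto
  moreover have "measure \<mu> {b<..} = 1 / 3"
  proof -
    have "space \<mu> - {..b} = {b<..}" by auto
    then show ?thesis using prob_compl[of "{..b}"] b by (simp add: cdf_def)
  qed
  ultimately show thesis using that a by (simp add: cdf_def)
qed

text \<open>The general bound with \<open>m\<close> of order \<open>N ^ (d - 3)\<close> and
  \<open>card M = N ^ d\<close>, where \<open>d\<close> is the dimension. The hypothesis on
  \<open>p\<close> forces \<open>p > 2\<close>, as that bound requires.\<close>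

lemma mixed_norm_lower_bound_box:
  fixes p :: real
  assumes dim: "CARD('n::finite) \<ge> 4" and p: "p > 2 * real CARD('n) / (real CARD('n) - 3)"
    and \<mu>: "prob_space \<mu>" and sets_\<mu> [measurable_cong]: "sets \<mu> = sets borel" and \<kappa>: "\<kappa> > 0" and N: "N > 0"
    and le: "ennreal (\<kappa> * real N powr (real CARD('n) - 3)) \<le>
      (\<integral>\<^sup>+r. ennreal ((\<bar>R + H * r\<bar> powr (- (real CARD('n) - 1) / 2)
         * smoothed_discrepancy (lattice_box N :: (real ^ 'n) set) \<bar>R + H * r\<bar>)\<^sup>2) \<partial>\<mu>)"
  shows "ennreal (sqrt (\<kappa> / 2) * real N powr ((real CARD('n) - 3) / 2 - real CARD('n) / p)) \<le>
    mixed_norm p (cball 0 1 :: (real ^ 'n) set) (dilated_translated_measure \<mu> H R)"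
proof -
  interpret prob_space \<mu> by fact
  define d where "d = real CARD('n)"
  have d: "d \<ge> 4" using dim by (simp add: d_def)
  define M where "M = (lattice_box N :: (real ^ 'n) set)"
  have M: "finite M" "M \<noteq> {}" "M \<subseteq> integer_lattice" "card M = N ^ CARD('n)"
    using N card_lattice_box[of N, where 'n = 'n]
    by (auto simp: M_def finite_lattice_box lattice_box_subset simp flip: card_gt_0_iff)
  have p2: "p > 2"
  proof -
    have "2 * (d - 3) \<le> 2 * d" by simp
    then have "2 \<le> 2 * d / (d - 3)" using d by (simp add: pos_le_divide_eq)
    then show ?thesis using p by (simp add: d_def)
  qed
  let ?\<nu> = "dilated_translated_measure \<mu> H R"
  interpret \<nu>: prob_space ?\<nu>
    unfolding dilated_translated_measure_def by (rule prob_space_distr) measurable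
  define m where "m = \<kappa> * real N powr (d - 3)"
  have [measurable]: "smoothed_discrepancy M \<in> borel_measurable borel"
    unfolding smoothed_discrepancy_def[abs_def] by measurable
  have "(\<integral>\<^sup>+r. ennreal ((\<bar>r\<bar> powr (- (d - 1) / 2) * smoothed_discrepancy M \<bar>r\<bar>)\<^sup>2) \<partial>?\<nu>) =
     (\<integral>\<^sup>+r. ennreal ((\<bar>R + H * r\<bar> powr (- (d - 1) / 2) * smoothed_discrepancy M \<bar>R + H * r\<bar>)\<^sup>2) \<partial>\<mu>)"
    unfolding dilated_translated_measure_def by (rule nn_integral_distr) measurable
  then have "ennreal m \<le> (\<integral>\<^sup>+r. ennreal ((\<bar>r\<bar> powr (- (d - 1) / 2) * smoothed_discrepancy M \<bar>r\<bar>)\<^sup>2) \<partial>?\<nu>)"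
    using le by (simp add: m_def d_def M_def)
  then have "ennreal (((m / 2) powr (p / 2) / real (card M)) powr (1 / p)) \<le>
      mixed_norm p (cball 0 1 :: (real ^ 'n) set) ?\<nu>"
    unfolding d_def using \<kappa> N p2
    by (intro mixed_norm_lower_bound[OF M(1-3)] \<nu>.sigma_finite_measure)
       (auto simp: m_def dilated_translated_measure_def)
  also have "((m / 2) powr (p / 2) / real (card M)) powr (1 / p) =
      sqrt (\<kappa> / 2) * real N powr ((d - 3) / 2 - d / p)"
  proof -
    have "(x powr (p / 2) / real (card M)) powr (1 / p) = x powr (1 / 2) / real N powr (d / p)"
      if "x > 0" for x
      using N p2 that by (simp add: M(4) powr_divide powr_powr d_def flip: powr_realpow)
    from this[of "m / 2"] have "((m / 2) powr (p / 2) / real (card M)) powr (1 / p) =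
        (m / 2) powr (1 / 2) / real N powr (d / p)"
      using \<kappa> N by (simp add: m_def)
    also have "(m / 2) powr (1 / 2) = (\<kappa> / 2) powr (1 / 2) * real N powr ((d - 3) / 2)"
      unfolding m_def times_divide_eq_left[symmetric] powr_mult by (simp add: powr_powr)
    finally show ?thesis using \<kappa> by (simp add: powr_half_sqrt powr_diff)
  qed
  finally show ?thesis by (simp add: d_def)
qed

text \<open>One constant, independent of \<open>N\<close>, \<open>H\<close> and \<open>R\<close>,
  serves both parts of the theorem. Without decay of the transform the bound holds for arbitrarily
  large \<open>R\<close>; with decay it holds for all large \<open>H\<close> and every
  \<open>R\<close>.\<close>

lemma mean_square_lower_bounds:
  fixes \<mu> :: "real measure" and h :: "nat \<Rightarrow> real \<Rightarrow> real"
  assumes \<mu>: "prob_space \<mu>" and sets_\<mu>: "sets \<mu> = sets borel"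
  defines "h \<equiv> \<lambda>N r. r powr (- (real CARD('n::finite) - 1) / 2) *
              smoothed_discrepancy (lattice_box N :: (real ^ 'n) set) r"
  obtains \<kappa> where "\<kappa> > 0"
    and "\<And>N H R0. N \<ge> 2 \<Longrightarrow> H > 0 \<Longrightarrow> \<exists>R\<ge>R0. ennreal (\<kappa> * real N powr (real CARD('n) - 3)) \<le>
          (\<integral>\<^sup>+r. ennreal ((h N \<bar>R + H * r\<bar>)\<^sup>2) \<partial>\<mu>)"
    and "\<And>N. N \<ge> 2 \<Longrightarrow>
       (\<And>e. e > 0 \<Longrightarrow> \<exists>T. \<forall>t. \<bar>t\<bar> \<ge> T \<longrightarrow> norm (CLINT r|\<mu>. cis (t * r)) < e) \<Longrightarrow>
       \<exists>H0. \<forall>H\<ge>H0. \<forall>R. ennreal (\<kappa> * real N powr (real CARD('n) - 3)) \<le>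
          (\<integral>\<^sup>+r. ennreal ((h N \<bar>R + H * r\<bar>)\<^sup>2) \<partial>\<mu>)"
proof -
  interpret prob_space \<mu> by fact
  interpret real_distribution \<mu> by standard (rule sets_\<mu>)
  obtain \<kappa>\<^sub>0 \<gamma> where \<kappa>\<^sub>0: "\<kappa>\<^sub>0 > 0" "\<gamma> \<noteq> 0"
    "\<And>N. N \<ge> 2 \<Longrightarrow> \<exists>L a. finite L \<and> (\<forall>l\<in>L. l > 0) \<and>
       \<kappa>\<^sub>0 * real N powr (real CARD('n) - 3) \<le> (\<Sum>l\<in>L. (a l)\<^sup>2) \<and>
       ((\<lambda>r. h N r - (\<Sum>l\<in>L. a l * Re (\<gamma> * cis (l * r)))) \<longlongrightarrow> 0) at_top"
    using smoothed_discrepancy_asymptotics[where 'n = 'n] unfolding h_def by blast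
  \<comment> \<open>The 6 leaves room for restricting to a third of the mass: with
    \<open>A \<ge> 6 * m\<close>, still \<open>A * (1 / 3) - m \<ge> m\<close>.\<close>
  define \<kappa> where "\<kappa> = (norm \<gamma>)\<^sup>2 / 2 * \<kappa>\<^sub>0 / 6"
  have \<kappa>: "\<kappa> > 0" using \<kappa>\<^sub>0 by (simp add: \<kappa>_def)
  have model: "\<exists>P A I c z. 6 * (\<kappa> * real N powr (real CARD('n) - 3)) \<le> A \<and>
      asymptotic_trigonometric_sum (h N) P A (I :: (bool \<times> real \<times> real) set) c z" if N: "N \<ge> 2" for N
  proof -
    obtain L a where L: "finite L" "\<And>l. l \<in> L \<Longrightarrow> l > 0"
      and ge: "\<kappa>\<^sub>0 * real N powr (real CARD('n) - 3) \<le> (\<Sum>l\<in>L. (a l)\<^sup>2)"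
      and lim: "((\<lambda>r. h N r - (\<Sum>l\<in>L. a l * Re (\<gamma> * cis (l * r)))) \<longlongrightarrow> 0) at_top"
      using \<kappa>\<^sub>0(3)[OF N] by blast
    obtain I :: "(bool \<times> real \<times> real) set" and c z where I: "finite I" "\<And>i. i \<in> I \<Longrightarrow> z i \<noteq> 0"
      "\<And>r. (\<Sum>l\<in>L. a l * Re (\<gamma> * cis (l * r)))\<^sup>2 =
       (norm \<gamma>)\<^sup>2 / 2 * (\<Sum>l\<in>L. (a l)\<^sup>2) + (\<Sum>i\<in>I. Re (c i * cis (z i * r)))"
      by (rule square_trigonometric_sum[OF L, where a = a and \<gamma> = \<gamma>]) (assumption, rule that)
    have "asymptotic_trigonometric_sum (h N) (\<lambda>r. \<Sum>l\<in>L. a l * Re (\<gamma> * cis (l * r)))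
        ((norm \<gamma>)\<^sup>2 / 2 * (\<Sum>l\<in>L. (a l)\<^sup>2)) I c z"
      by (standard; fact I lim)
    moreover have "6 * (\<kappa> * real N powr (real CARD('n) - 3)) \<le> (norm \<gamma>)\<^sup>2 / 2 * (\<Sum>l\<in>L. (a l)\<^sup>2)"
      using mult_left_mono[OF ge, of "(norm \<gamma>)\<^sup>2 / 2"] by (simp add: \<kappa>_def mult_ac)
    ultimately show ?thesis by blast
  qed
  show thesis
  proof (rule that[OF \<kappa>])
    fix N :: nat and H R0 :: real assume N: "N \<ge> 2" and H: "H > 0"
    define m where "m = \<kappa> * real N powr (real CARD('n) - 3)"
    have m: "m > 0" using \<kappa> N by (simp add: m_def)
    obtain P A c z and I :: "(bool \<times> real \<times> real) set" where A: "6 * m \<le> A"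
      and model: "asymptotic_trigonometric_sum (h N) P A I c z"
      using model[OF N] unfolding m_def by blast
    interpret asymptotic_trigonometric_sum "h N" P A I c z by (rule model)
    have "\<exists>R\<ge>R0. ennreal (A - m) \<le> (\<integral>\<^sup>+r. ennreal ((h N \<bar>R + H * r\<bar>)\<^sup>2) \<partial>\<mu>)"
      using m by (intro frequent_mean_square_lower \<mu> sets_\<mu> H)
    moreover have "ennreal m \<le> ennreal (A - m)" using A m by (intro ennreal_leI) linarith
    ultimately show "\<exists>R\<ge>R0. ennreal m \<le> (\<integral>\<^sup>+r. ennreal ((h N \<bar>R + H * r\<bar>)\<^sup>2) \<partial>\<mu>)"
      using order_trans by blast
  next
    fix N :: nat assume N: "N \<ge> 2"
    assume lim: "\<And>e. e > 0 \<Longrightarrow> \<exists>T. \<forall>t. \<bar>t\<bar> \<ge> T \<longrightarrow> norm (CLINT r|\<mu>. cis (t * r)) < e"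
    define m where "m = \<kappa> * real N powr (real CARD('n) - 3)"
    have m: "m > 0" using \<kappa> N by (simp add: m_def)
    obtain P A c z and I :: "(bool \<times> real \<times> real) set" where A: "6 * m \<le> A"
      and model: "asymptotic_trigonometric_sum (h N) P A I c z"
      using model[OF N] unfolding m_def by blast
    interpret asymptotic_trigonometric_sum "h N" P A I c z by (rule model)
    \<comment> \<open>Restricted to an atom, the characteristic integral has the mass of the atom as
      its modulus at every frequency, so it could not become small.\<close>
    have atoms: "measure \<mu> {x} = 0" for x
    proof (rule ccontr)
      assume "measure \<mu> {x} \<noteq> 0"
      then have pos: "measure \<mu> {x} > 0" by (simp add: less_le)
      obtain T where T: "\<And>t. \<bar>t\<bar> \<ge> T \<Longrightarrow>
          norm (CLINT r|\<mu>. of_real (indicator {x} r) * cis (t * r)) < measure \<mu> {x}"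
        using characteristic_integral_restrict_tendsto_0[OF \<mu> sets_\<mu> lim _ pos, of "{x}"] by auto
      have "(CLINT r|\<mu>. of_real (indicator {x} r) * cis (T * r)) =
          (CLINT r|\<mu>. of_real (indicator {x} r) * cis (T * x))"
        by (intro Bochner_Integration.integral_cong refl) (auto simp: indicator_def)
      also have "\<dots> = of_real (measure \<mu> {x}) * cis (T * x)"
        by simp
      finally show False using T[OF abs_ge_self] by (simp add: norm_mult)
    qed
    obtain a b where ab: "a < b" "measure \<mu> {..a} = 1 / 3" "measure \<mu> {b<..} = 1 / 3"
      using prob_space_no_atoms_split[OF real_distribution_axioms atoms] .
    have "\<exists>H0 r0. \<forall>H R. H \<ge> H0 \<longrightarrow> (\<forall>r\<in>{..a}. (-1) * (R + H * r) \<ge> r0) \<longrightarrow>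
       ennreal (A * measure \<mu> {..a} - m) \<le> (\<integral>\<^sup>+r. ennreal ((h N \<bar>R + H * r\<bar>)\<^sup>2) \<partial>\<mu>)"
      by (rule restricted_mean_square_lower[OF \<mu> sets_\<mu> lim]) (use m in auto)
    then obtain H1 r1 where 1: "\<And>H R. H \<ge> H1 \<Longrightarrow> (\<forall>r\<in>{..a}. (-1) * (R + H * r) \<ge> r1) \<Longrightarrow>
       ennreal (A * measure \<mu> {..a} - m) \<le> (\<integral>\<^sup>+r. ennreal ((h N \<bar>R + H * r\<bar>)\<^sup>2) \<partial>\<mu>)"
      by blast
    have "\<exists>H0 r0. \<forall>H R. H \<ge> H0 \<longrightarrow> (\<forall>r\<in>{b<..}. 1 * (R + H * r) \<ge> r0) \<longrightarrow>
       ennreal (A * measure \<mu> {b<..} - m) \<le> (\<integral>\<^sup>+r. ennreal ((h N \<bar>R + H * r\<bar>)\<^sup>2) \<partial>\<mu>)"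
      by (rule restricted_mean_square_lower[OF \<mu> sets_\<mu> lim]) (use m in auto)
    then obtain H2 r2 where 2: "\<And>H R. H \<ge> H2 \<Longrightarrow> (\<forall>r\<in>{b<..}. 1 * (R + H * r) \<ge> r2) \<Longrightarrow>
       ennreal (A * measure \<mu> {b<..} - m) \<le> (\<integral>\<^sup>+r. ennreal ((h N \<bar>R + H * r\<bar>)\<^sup>2) \<partial>\<mu>)"
      by blast
    define r0 where "r0 = max 0 (max r1 r2)"
    define H0 where "H0 = max (max H1 H2) (2 * r0 / (b - a))"
    have "ennreal m \<le> (\<integral>\<^sup>+r. ennreal ((h N \<bar>R + H * r\<bar>)\<^sup>2) \<partial>\<mu>)" if H: "H \<ge> H0" for H R
    proof -
      \<comment> \<open>The sign of \<open>R + H * x\<close> at the midpoint selects a ray. Beyond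
        the half gap, \<open>R + H * r\<close> keeps that sign, with modulus at least
        \<open>H * ((b - a) / 2)\<close>, hence at least \<open>r0\<close>. No condition on
        \<open>R\<close> arises.\<close>
      define x where "x = (a + b) / 2"
      have "H \<ge> 2 * r0 / (b - a)" using H by (simp add: H0_def)
      then have Hr: "H * ((b - a) / 2) \<ge> r0" using ab by (simp add: field_simps)
      have "H0 \<ge> 0" using ab by (auto simp: H0_def r0_def le_max_iff_disj)
      then have "H \<ge> 0" using H by simp
      have "ennreal m \<le> ennreal (A * (1 / 3) - m)" using A m by (intro ennreal_leI) linarith
      also have "\<dots> \<le> (\<integral>\<^sup>+r. ennreal ((h N \<bar>R + H * r\<bar>)\<^sup>2) \<partial>\<mu>)"
      proof (cases "R + H * x \<ge> 0")
        case True
        have "1 * (R + H * r) \<ge> r2" if "r \<in> {b<..}" for r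
        proof -
          have "H * r - H * x \<ge> H * ((b - a) / 2)"
            unfolding right_diff_distrib[symmetric]
            using that \<open>H \<ge> 0\<close> by (intro mult_left_mono) (auto simp: x_def field_simps)
          then have "R + H * r \<ge> r0" using True Hr by linarith
          then show ?thesis by (simp add: r0_def)
        qed
        then show ?thesis using 2[of H R] H ab by (simp add: H0_def)
      next
        case False
        have "(-1) * (R + H * r) \<ge> r1" if "r \<in> {..a}" for r
        proof -
          have "H * x - H * r \<ge> H * ((b - a) / 2)"
            unfolding right_diff_distrib[symmetric]
            using that \<open>H \<ge> 0\<close> by (intro mult_left_mono) (auto simp: x_def field_simps)
          then have "- (R + H * r) \<ge> r0" using False Hr by linarith
          then show ?thesis by (simp add: r0_def)
        qed
        then show ?thesis using 1[of H R] H ab by (simp add: H0_def)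
      qed
      finally show ?thesis .
    qed
    then show "\<exists>H0. \<forall>H\<ge>H0. \<forall>R. ennreal m \<le> (\<integral>\<^sup>+r. ennreal ((h N \<bar>R + H * r\<bar>)\<^sup>2) \<partial>\<mu>)"
      by blast
  qed
qed

theorem theorem1p4:
  fixes \<mu> :: "real measure" and p :: real
  assumes dim: "CARD('n::finite) \<ge> 4"
    and \<mu>: "prob_space \<mu>" "sets \<mu> = sets borel"
    and p: "p > 2 * real CARD('n) / (real CARD('n) - 3)"
  shows "Limsup (at_top \<times>\<^sub>F at_top)
           (\<lambda>(H, R). mixed_norm p (cball 0 1 :: (real ^ 'n) set)
                        (dilated_translated_measure \<mu> H R)) = \<infinity>
    \<and> (((\<lambda>\<zeta>. cmod (fourier_transform \<mu> \<zeta>)) \<longlongrightarrow> 0) at_infinity \<longrightarrow>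
         ((\<lambda>(H, R). mixed_norm p (cball 0 1 :: (real ^ 'n) set)
                        (dilated_translated_measure \<mu> H R)) \<longlongrightarrow> \<infinity>) (at_top \<times>\<^sub>F at_top))"
proof -
  let ?X = "\<lambda>H R. mixed_norm p (cball 0 1 :: (real ^ 'n) set) (dilated_translated_measure \<mu> H R)"
  let ?F = "at_top \<times>\<^sub>F at_top :: (real \<times> real) filter"
  let ?h = "\<lambda>N r. r powr (- (real CARD('n) - 1) / 2) * smoothed_discrepancy (lattice_box N :: (real ^ 'n) set) r"
  \<comment> \<open>The exponent of \<open>N\<close> in the bound for the box; its positivity is
    where the range of \<open>p\<close> enters.\<close>
  define e where "e = (real CARD('n) - 3) / 2 - real CARD('n) / p"
  have e: "e > 0"
  proof -
    have "real CARD('n) - 3 > 0" using dim by simp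
    moreover from this have "2 * real CARD('n) / (real CARD('n) - 3) > 0" by simp
    then have "p > 0" using p by linarith
    ultimately show ?thesis using p by (simp add: e_def field_simps)
  qed
  obtain \<kappa> where \<kappa>: "\<kappa> > 0"
    and frequent: "\<And>N H R0. N \<ge> 2 \<Longrightarrow> H > 0 \<Longrightarrow> \<exists>R\<ge>R0. ennreal (\<kappa> * real N powr (real CARD('n) - 3)) \<le>
          (\<integral>\<^sup>+r. ennreal ((?h N \<bar>R + H * r\<bar>)\<^sup>2) \<partial>\<mu>)"
    and evtl: "\<And>N. N \<ge> 2 \<Longrightarrow>
       (\<And>e. e > 0 \<Longrightarrow> \<exists>T. \<forall>t. \<bar>t\<bar> \<ge> T \<longrightarrow> norm (CLINT r|\<mu>. cis (t * r)) < e) \<Longrightarrow>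
       \<exists>H0. \<forall>H\<ge>H0. \<forall>R. ennreal (\<kappa> * real N powr (real CARD('n) - 3)) \<le>
          (\<integral>\<^sup>+r. ennreal ((?h N \<bar>R + H * r\<bar>)\<^sup>2) \<partial>\<mu>)"
    using mean_square_lower_bounds[OF \<mu>, where 'n = 'n] by blast
  have bound: "ennreal (sqrt (\<kappa> / 2) * real N powr e) \<le> ?X H R"
    if "N \<ge> 2" "ennreal (\<kappa> * real N powr (real CARD('n) - 3)) \<le> (\<integral>\<^sup>+r. ennreal ((?h N \<bar>R + H * r\<bar>)\<^sup>2) \<partial>\<mu>)"
    for N H R
    unfolding e_def using that \<kappa> by (intro mixed_norm_lower_bound_box dim p \<mu>) auto
  have large: "\<exists>N\<ge>2. y < ennreal (sqrt (\<kappa> / 2) * real N powr e)" if y: "y < \<infinity>" for y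
  proof -
    obtain s where s: "y = ennreal s" "s \<ge> 0" using y by (cases y) auto
    have "filterlim (\<lambda>N. sqrt (\<kappa> / 2) * real N powr e) at_top sequentially"
      using \<kappa> e by (intro filterlim_tendsto_pos_mult_at_top[OF tendsto_const]
          filterlim_compose[OF real_powr_at_top filterlim_real_sequentially]) auto
    then have "\<forall>\<^sub>F N in sequentially. s < sqrt (\<kappa> / 2) * real N powr e"
      by (simp add: filterlim_at_top_dense)
    then have "\<forall>\<^sub>F N in sequentially. N \<ge> 2 \<and> s < sqrt (\<kappa> / 2) * real N powr e"
      using eventually_ge_at_top[of 2] by eventually_elim simp
    then obtain N where "N \<ge> 2" "s < sqrt (\<kappa> / 2) * real N powr e"
      by (auto simp: eventually_sequentially)
    then show ?thesis using s by (auto simp: ennreal_less_iff)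
  qed
  \<comment> \<open>A finite upper limit would keep the norms below some lower bound from
    \<open>large\<close> on a whole quadrant of pairs. With \<open>H\<close> fixed in it,
    \<open>frequent\<close> finds a large \<open>R\<close> violating this.\<close>
  have "Limsup ?F (\<lambda>(H, R). ?X H R) = \<infinity>"
  proof (rule ccontr)
    assume "Limsup ?F (\<lambda>(H, R). ?X H R) \<noteq> \<infinity>"
    then have "Limsup ?F (\<lambda>(H, R). ?X H R) < \<infinity>" by (simp add: top.not_eq_extremum)
    then obtain N where N: "N \<ge> 2" "Limsup ?F (\<lambda>(H, R). ?X H R) < ennreal (sqrt (\<kappa> / 2) * real N powr e)"
      using large by blast
    have "\<forall>\<^sub>F (H, R) in ?F. ?X H R < ennreal (sqrt (\<kappa> / 2) * real N powr e)"
      using Limsup_lessD[OF N(2)] by (simp add: case_prod_unfold)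
    then obtain Q1 Q2 where Q: "eventually Q1 at_top" "eventually Q2 at_top"
      "\<And>H R. Q1 H \<Longrightarrow> Q2 R \<Longrightarrow> ?X H R < ennreal (sqrt (\<kappa> / 2) * real N powr e)"
      unfolding eventually_prod_filter by auto
    obtain H0 where H0: "\<And>H. H \<ge> H0 \<Longrightarrow> Q1 H" using Q(1) by (auto simp: eventually_at_top_linorder)
    obtain R0 where R0: "\<And>R. R \<ge> R0 \<Longrightarrow> Q2 R" using Q(2) by (auto simp: eventually_at_top_linorder)
    define H where "H = max H0 1"
    have "H > 0" by (simp add: H_def)
    then obtain R where "R \<ge> R0" "ennreal (\<kappa> * real N powr (real CARD('n) - 3)) \<le>
          (\<integral>\<^sup>+r. ennreal ((?h N \<bar>R + H * r\<bar>)\<^sup>2) \<partial>\<mu>)"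
      using frequent[OF N(1)] by blast
    then have "ennreal (sqrt (\<kappa> / 2) * real N powr e) \<le> ?X H R" "Q1 H" "Q2 R"
      using bound[OF N(1)] H0 R0 by (auto simp: H_def)
    then show False using Q(3)[of H R] by simp
  qed
  moreover have "((\<lambda>(H, R). ?X H R) \<longlongrightarrow> \<infinity>) ?F"
    if lim: "((\<lambda>\<zeta>. cmod (fourier_transform \<mu> \<zeta>)) \<longlongrightarrow> 0) at_infinity"
  proof (rule order_tendstoI)
    \<comment> \<open>The two conventions for the transform are related by
      \<open>\<zeta> = - t / (2 * pi)\<close>.\<close>
    have char: "\<exists>T. \<forall>t. \<bar>t\<bar> \<ge> T \<longrightarrow> norm (CLINT r|\<mu>. cis (t * r)) < \<epsilon>" if "\<epsilon> > 0" for \<epsilon> :: real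
    proof -
      have "\<forall>\<^sub>F \<zeta> in at_infinity. cmod (fourier_transform \<mu> \<zeta>) < \<epsilon>"
        using lim that by (rule order_tendstoD)
      then obtain b where b: "\<And>\<zeta>. \<bar>\<zeta>\<bar> \<ge> b \<Longrightarrow> cmod (fourier_transform \<mu> \<zeta>) < \<epsilon>"
        by (auto simp: eventually_at_infinity)
      have "norm (CLINT r|\<mu>. cis (t * r)) < \<epsilon>" if "\<bar>t\<bar> \<ge> 2 * pi * b" for t
      proof -
        have "\<bar>- t / (2 * pi)\<bar> \<ge> b" using that by (simp add: field_simps)
        moreover have "fourier_transform \<mu> (- t / (2 * pi)) = (CLINT r|\<mu>. cis (t * r))"
          unfolding fourier_transform_def cis_conv_exp
          by (intro Bochner_Integration.integral_cong refl arg_cong[where f = exp]) (simp add: field_simps)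
        ultimately show ?thesis using b by metis
      qed
      then show ?thesis by blast
    qed
    fix y :: ennreal assume "y < \<infinity>"
    then obtain N where N: "N \<ge> 2" "y < ennreal (sqrt (\<kappa> / 2) * real N powr e)"
      using large by blast
    obtain H0 where "\<And>H R. H \<ge> H0 \<Longrightarrow> ennreal (\<kappa> * real N powr (real CARD('n) - 3)) \<le>
          (\<integral>\<^sup>+r. ennreal ((?h N \<bar>R + H * r\<bar>)\<^sup>2) \<partial>\<mu>)"
      using evtl[OF N(1) char] by blast
    then have "y < ?X H R" if "H \<ge> H0" for H R
      using bound[OF N(1)] N(2) that less_le_trans by blast
    \<comment> \<open>The threshold \<open>H0\<close> works for all \<open>R\<close>, so the
      condition on \<open>R\<close> is taken to be trivially true.\<close>
    then show "\<forall>\<^sub>F x in ?F. y < (case x of (H, R) \<Rightarrow> ?X H R)"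
      unfolding eventually_prod_filter
      by (intro exI[of _ "\<lambda>H. H \<ge> H0"] exI[of _ "\<lambda>_. True"]) (auto simp: eventually_ge_at_top)
  qed simp
  ultimately show ?thesis by blast
qed

end
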